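(* Let $n\ge5$ be an integer, let $\lambda<0$ and $\mu\in\mathbb{R}$, and put $2^{**}=\frac{2n}{n-4}$. Then there exist $\bar\alpha>0$ and $\bar p\in(2,2^{**})$, depending only on $\lambda,\mu$ (for the given $n$), such that for all $\alpha\in(-n,n-4)$ with $|\alpha|<\bar\alpha$ and $\mu>\frac{(n-4-\alpha)^2}{4}\lambda$, and all $p\in(\bar p-1,2^{**}-1)$, one has $$S_{\alpha,p}(\lambda,\mu)<S^{rad}_{\alpha,p}(\lambda,\mu).$$
   Context: Given $n,\alpha,p$ with $-n<\alpha<n-4$, $p>1$, the exponent $\beta$ is determined by $\frac{n+\alpha}{2}+\frac{n+\beta}{p+1}=n-2$. The space $D^{2,2}(\mathbb{R}^n,\alpha)$ is the completion of $C_0^\infty(\mathbb{R}^n\setminus\{0\})$ in the norm given by $\int_{\mathbb{R}^n}|x|^{-\alpha}|\Delta u|^2dx$ (the square of the norm), and $D^{2,2}_{rad}(\mathbb{R}^n,\alpha)$ is its subspace of radial functions. Define $$S_{\alpha,p}(\lambda,\mu)=\inf_{u\in D^{2,2}(\mathbb{R}^n,\alpha)\setminus\{0\}}\frac{\int_{\mathbb{R}^n}\left(|x|^{-\alpha}|\Delta u|^2-\lambda|x|^{-\alpha-2}|\nabla u|^2+\mu|x|^{-\alpha-4}u^2\right)dx}{\left(\int_{\mathbb{R}^n}|x|^\beta|u|^{p+1}dx\right)^{\frac{2}{p+1}}},$$ and let $S^{rad}_{\alpha,p}(\lambda,\mu)$ be the infimum of the same quotient over $D^{2,2}_{rad}(\mathbb{R}^n,\alpha)\setminus\{0\}$.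 *)

theory Defs
  imports "HOL-Analysis.Analysis"
begin

text \<open>
  Throughout, the dimension is \<open>n = CARD('n)\<close>, functions are real-valued functions on
  \<open>real ^ 'n\<close>, and all integrals are Lebesgue integrals. A power \<open>norm x powr a\<close> is \<open>0\<close> at the
  origin whatever \<open>a\<close> is, which does not matter for the integrals.
\<close>

subsection \<open>Test functions and their derivatives\<close>

definition partial :: "'n::finite \<Rightarrow> (real ^ 'n \<Rightarrow> real) \<Rightarrow> real ^ 'n \<Rightarrow> real" where
  "partial i f = (\<lambda>x. frechet_derivative f (at x) (axis i 1))"

definition smooth :: "(real ^ 'n::finite \<Rightarrow> real) \<Rightarrow> bool" where
  "smooth f \<longleftrightarrow> (\<forall>is x. foldr partial is f differentiable (at x))"

definition laplacian :: "(real ^ 'n::finite \<Rightarrow> real) \<Rightarrow> real ^ 'n \<Rightarrow> real" where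
  "laplacian f = (\<lambda>x. \<Sum>i\<in>UNIV. partial i (partial i f) x)"

text \<open>The space \<open>C\<^sub>0\<^sup>\<infinity>(\<real>\<^sup>n - {0})\<close>.\<close>

definition test_functions :: "(real ^ 'n::finite \<Rightarrow> real) set" where
  "test_functions =
     {f. smooth f \<and> compact (closure {x. f x \<noteq> 0}) \<and> 0 \<notin> closure {x. f x \<noteq> 0}}"

subsection \<open>Weak derivatives on the punctured space\<close>

definition locally_integrable :: "(real ^ 'n::finite \<Rightarrow> real) \<Rightarrow> bool" where
  "locally_integrable u \<longleftrightarrow> (\<forall>K. compact K \<and> 0 \<notin> K \<longrightarrow> set_integrable lebesgue K u)"

definition has_weak_gradient ::
    "(real ^ 'n::finite \<Rightarrow> real) \<Rightarrow> (real ^ 'n \<Rightarrow> real ^ 'n) \<Rightarrow> bool" where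
  "has_weak_gradient u g \<longleftrightarrow>
     locally_integrable u \<and> (\<forall>i. locally_integrable (\<lambda>x. g x $ i)) \<and>
     (\<forall>\<phi>\<in>test_functions. \<forall>i.
        (LINT x|lebesgue. u x * partial i \<phi> x) = - (LINT x|lebesgue. g x $ i * \<phi> x))"

definition has_weak_laplacian ::
    "(real ^ 'n::finite \<Rightarrow> real) \<Rightarrow> (real ^ 'n \<Rightarrow> real) \<Rightarrow> bool" where
  "has_weak_laplacian u w \<longleftrightarrow>
     locally_integrable u \<and> locally_integrable w \<and>
     (\<forall>\<phi>\<in>test_functions.
        (LINT x|lebesgue. u x * laplacian \<phi> x) = (LINT x|lebesgue. w x * \<phi> x))"

text \<open>
  Weak derivatives are unique almost everywhere, so integrals do not depend on the
  representative that is chosen. Every element of the space \<open>D22\<close> below has both.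
\<close>

definition weak_gradient :: "(real ^ 'n::finite \<Rightarrow> real) \<Rightarrow> real ^ 'n \<Rightarrow> real ^ 'n" where
  "weak_gradient u = (SOME g. has_weak_gradient u g)"

definition weak_laplacian :: "(real ^ 'n::finite \<Rightarrow> real) \<Rightarrow> real ^ 'n \<Rightarrow> real" where
  "weak_laplacian u = (SOME w. has_weak_laplacian u w)"

subsection \<open>The space \<open>D\<^sup>2\<^sup>,\<^sup>2(\<real>\<^sup>n, \<alpha>)\<close>\<close>

definition D22_norm :: "real \<Rightarrow> (real ^ 'n::finite \<Rightarrow> real) \<Rightarrow> real" where
  "D22_norm \<alpha> \<phi> = sqrt (LINT x|lebesgue. norm x powr (- \<alpha>) * \<bar>laplacian \<phi> x\<bar>\<^sup>2)"

text \<open>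
  The completion of the test functions, realised as a space of functions: by the weighted Rellich
  inequality, valid for \<open>- n < \<alpha> < n - 4\<close>, a Cauchy sequence of test functions converges in
  \<open>L\<^sup>1\<close> on every compact set avoiding the origin, and its limit vanishes almost everywhere only
  if the sequence tends to \<open>0\<close> in norm. Functions that agree almost everywhere represent the
  same element.
\<close>

definition D22 :: "real \<Rightarrow> (real ^ 'n::finite \<Rightarrow> real) set" where
  "D22 \<alpha> = {u. u \<in> borel_measurable lebesgue \<and>
     (\<exists>\<phi>. (\<forall>k::nat. \<phi> k \<in> test_functions) \<and>
          (\<forall>e>0. \<exists>N. \<forall>j\<ge>N. \<forall>k\<ge>N. D22_norm \<alpha> (\<lambda>x. \<phi> j x - \<phi> k x) < e) \<and>
          (\<forall>K. compact K \<and> 0 \<notin> K \<longrightarrow>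
             (\<lambda>k. \<integral>\<^sup>+x\<in>K. ennreal \<bar>\<phi> k x - u x\<bar> \<partial>lebesgue) \<longlonglongrightarrow> 0))}"

definition radial :: "(real ^ 'n::finite \<Rightarrow> real) \<Rightarrow> bool" where
  "radial u \<longleftrightarrow> (\<exists>f. AE x in lebesgue. u x = f (norm x))"

definition D22_rad :: "real \<Rightarrow> (real ^ 'n::finite \<Rightarrow> real) set" where
  "D22_rad \<alpha> = {u \<in> D22 \<alpha>. radial u}"

definition null_functions :: "(real ^ 'n::finite \<Rightarrow> real) set" where
  "null_functions = {u. AE x in lebesgue. u x = 0}"

subsection \<open>The Rayleigh quotient and its infima\<close>

definition weight_exponent :: "real \<Rightarrow> real \<Rightarrow> real \<Rightarrow> real" where
  "weight_exponent n \<alpha> p = (THE \<beta>. (n + \<alpha>) / 2 + (n + \<beta>) / (p + 1) = n - 2)"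

lemma weight_exponent_eq:
  assumes "p > 1"
  shows "weight_exponent n \<alpha> p = (p + 1) * (n - 4 - \<alpha>) / 2 - n"
  unfolding weight_exponent_def
  by (rule the_equality) (use assms in \<open>simp_all add: field_simps\<close>)

definition quotient ::
    "real \<Rightarrow> real \<Rightarrow> real \<Rightarrow> real \<Rightarrow> (real ^ 'n::finite \<Rightarrow> real) \<Rightarrow> real" where
  "quotient \<alpha> p lam mu u =
     (LINT x|lebesgue.
        norm x powr (- \<alpha>) * \<bar>weak_laplacian u x\<bar>\<^sup>2
        - lam * norm x powr (- \<alpha> - 2) * (norm (weak_gradient u x))\<^sup>2
        + mu * norm x powr (- \<alpha> - 4) * (u x)\<^sup>2) /
     (LINT x|lebesgue.
        norm x powr weight_exponent CARD('n) \<alpha> p * \<bar>u x\<bar> powr (p + 1)) powr (2 / (p + 1))"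

text \<open>
  The infima are taken in the extended reals, so that they are also meaningful when the quotient
  is unbounded below. The first argument carries the dimension.
\<close>

definition S_inf :: "'n::finite itself \<Rightarrow> real \<Rightarrow> real \<Rightarrow> real \<Rightarrow> real \<Rightarrow> ereal" where
  "S_inf _ \<alpha> p lam mu =
     (INF u \<in> (D22 \<alpha> :: (real ^ 'n \<Rightarrow> real) set) - null_functions. ereal (quotient \<alpha> p lam mu u))"

definition S_rad :: "'n::finite itself \<Rightarrow> real \<Rightarrow> real \<Rightarrow> real \<Rightarrow> real \<Rightarrow> ereal" where
  "S_rad _ \<alpha> p lam mu =
     (INF u \<in> (D22_rad \<alpha> :: (real ^ 'n \<Rightarrow> real) set) - null_functions. ereal (quotient \<alpha> p lam mu u))"

definition critical_exponent :: "real \<Rightarrow> real" where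
  "critical_exponent n = 2 * n / (n - 4)"

end

theory Submission
  imports Defs
begin

text \<open>
  Write a radial function as \<open>u(x) = |x| powr (- m) * w (- ln |x|)\<close> with \<open>m = (n - 4 - \<alpha>)/2\<close>. The three
  integrals of the numerator become multiples of \<open>W\<^sub>2 + A W\<^sub>1 + \<gamma>\<^sup>2 W\<^sub>0\<close>, \<open>W\<^sub>1 + m\<^sup>2 W\<^sub>0\<close> and \<open>W\<^sub>0\<close>, where
  \<open>W\<^sub>j = \<integral> (w\<^bsup>(j)\<^esup>)\<^sup>2\<close>, and the denominator becomes a multiple of a norm of \<open>w\<close>. Since \<open>\<lambda> < 0\<close> and
  \<open>\<mu> > m\<^sup>2 \<lambda>\<close>, the lower order terms contribute at least \<open>|\<lambda>| W\<^sub>1\<close>. This raises the infimum strictly and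
  uniformly for \<open>(\<alpha>, p)\<close> near \<open>(0, 2** - 1)\<close>: either \<open>W\<^sub>1\<close> is comparable to the energy, or the norm of \<open>w\<close> is
  small. For the upper bound take a radial test function that is nearly optimal for \<open>\<alpha> = \<lambda> = \<mu> = 0\<close> and the
  exponent \<open>2** - 1\<close>, and translate it far away from the origin. There the lower order terms are negligible,
  and for this fixed test function the quotient is upper semicontinuous in \<open>(\<alpha>, p)\<close>.

  An element of \<open>D\<^sup>2\<^sup>,\<^sup>2\<close> is a limit of test functions that need not be radial. Their spherical means are
  radial test functions, converge to the same limit if it is radial, and have smaller integrals of
  \<open>|\<Delta>u|\<^sup>2\<close> and \<open>|\<nabla>u|\<^sup>2\<close>, because \<open>\<phi>\<close> minus its spherical mean is orthogonal to all radial functions.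
\<close>

section \<open>Smooth functions of one variable\<close>

text \<open>The point \<open>(0, critical_exponent n)\<close> for \<open>(\<alpha>, p + 1)\<close>
  is singled out because there both weights, \<open>\<alpha>\<close> and the exponent
  \<open>\<beta>\<close>, vanish at once: without \<lambda> and \<mu> the quotient is then invariant
  under all translations, not only under the symmetries that fix the origin. The inequality must be
  strict at this point and survive a perturbation. No minimiser is used, neither its existence nor
  an explicit formula; the gap comes from the quantitative estimate \<open>energy_gain\<close>, and
  a number \<kappa> is placed inside it.

  Both sides of \<kappa> are then followed by expressions that are continuous in
  \<open>(\<alpha>, p + 1)\<close>. Above, a single test function suffices. Below, all profiles have
  to be treated at once: a change of the exponent is handled by interpolation with the integral of
  \<open>w\<close> squared, a change of the coefficients by shrinking the whole energy by a factor
  close to 1. The thresholds come from one neighbourhood in which all these conditions hold; \<mu>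
  enters it only through the position of the translated test function. Since only small \<alpha>
  matter, the elementary Hardy-Rellich inequality for \<open>\<alpha> > - 2\<close> is enough to
  handle the completion.\<close>

definition smooth1 :: "(real \<Rightarrow> real) \<Rightarrow> bool" where
  "smooth1 f \<longleftrightarrow> (\<forall>k x. (deriv ^^ k) f differentiable (at x))"

lemma smooth1_DERIV: "smooth1 f \<Longrightarrow> (f has_real_derivative deriv f x) (at x)"
  unfolding smooth1_def by (metis DERIV_deriv_iff_real_differentiable funpow_0)

lemma smooth1_deriv: "smooth1 f \<Longrightarrow> smooth1 (deriv f)"
  unfolding smooth1_def by (metis funpow_Suc_right o_apply)

lemma smooth1_continuous_on: "smooth1 f \<Longrightarrow> continuous_on A f"
  using smooth1_DERIV DERIV_continuous_on by (metis has_field_derivative_at_within)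

text \<open>An invariant set replaces formulas for higher derivatives: if all members are
  differentiable and the set is closed under \<open>deriv\<close>, every iterate stays inside. All
  smoothness proofs below choose such a set.\<close>

lemma smooth1_coinduct:
  assumes "f \<in> A" "\<And>f x. f \<in> A \<Longrightarrow> f differentiable (at x)" "\<And>f. f \<in> A \<Longrightarrow> deriv f \<in> A"
  shows "smooth1 f"
proof -
  have "(deriv ^^ k) f \<in> A" for k
    by (induction k) (use assms in auto)
  then show ?thesis using assms(2) by (auto simp: smooth1_def)
qed

text \<open>Sums, products and compositions cannot be treated separately, since the chain rule
  produces products and the product rule produces sums. The common closure is invariant. In
  \<open>comp\<close> only the inner function ranges over the closure; the outer one is smooth, and
  so is its derivative.\<close>

inductive_set smooth1_alg :: "(real \<Rightarrow> real) set" where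
  base: "smooth1 f \<Longrightarrow> f \<in> smooth1_alg"
| comp: "smooth1 f \<Longrightarrow> g \<in> smooth1_alg \<Longrightarrow> (\<lambda>x. f (g x)) \<in> smooth1_alg"
| add: "f \<in> smooth1_alg \<Longrightarrow> g \<in> smooth1_alg \<Longrightarrow> (\<lambda>x. f x + g x) \<in> smooth1_alg"
| mult: "f \<in> smooth1_alg \<Longrightarrow> g \<in> smooth1_alg \<Longrightarrow> (\<lambda>x. f x * g x) \<in> smooth1_alg"

lemma smooth1_alg_deriv:
  "f \<in> smooth1_alg \<Longrightarrow> \<exists>f'\<in>smooth1_alg. \<forall>x. (f has_real_derivative f' x) (at x)"
proof (induction rule: smooth1_alg.induct)
  case (base f)
  then show ?case using smooth1_DERIV smooth1_deriv smooth1_alg.base by blast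
next
  case (comp f g)
  then obtain g' where g: "g' \<in> smooth1_alg" "\<And>x. (g has_real_derivative g' x) (at x)" by blast
  show ?case
  proof (rule bexI[of _ "\<lambda>x. deriv f (g x) * g' x"])
    show "(\<lambda>x. deriv f (g x) * g' x) \<in> smooth1_alg"
      by (intro smooth1_alg.mult smooth1_alg.comp[of "deriv f" g] smooth1_deriv comp.hyps g(1))
    show "\<forall>x. ((\<lambda>x. f (g x)) has_real_derivative deriv f (g x) * g' x) (at x)"
      using DERIV_chain2[OF smooth1_DERIV[OF comp.hyps(1)] g(2)] by blast
  qed
next
  case (add f g)
  then obtain f' g' where g: "f' \<in> smooth1_alg" "\<And>x. (f has_real_derivative f' x) (at x)"
     "g' \<in> smooth1_alg" "\<And>x. (g has_real_derivative g' x) (at x)" by blast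
  show ?case
    by (rule bexI[of _ "\<lambda>x. f' x + g' x"]) (use g in \<open>auto intro: smooth1_alg.intros DERIV_add\<close>)
next
  case (mult f g)
  then obtain f' g' where g: "f' \<in> smooth1_alg" "\<And>x. (f has_real_derivative f' x) (at x)"
     "g' \<in> smooth1_alg" "\<And>x. (g has_real_derivative g' x) (at x)" by blast
  show ?case
    by (rule bexI[of _ "\<lambda>x. f' x * g x + g' x * f x"])
      (use g mult in \<open>auto intro: smooth1_alg.intros DERIV_mult\<close>)
qed

lemma smooth1_algD: assumes "f \<in> smooth1_alg" shows "smooth1 f"
proof (rule smooth1_coinduct[OF assms])
  fix g :: "real \<Rightarrow> real" and x assume "g \<in> smooth1_alg"
  then obtain g' where g: "g' \<in> smooth1_alg" "\<And>x. (g has_real_derivative g' x) (at x)"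
    using smooth1_alg_deriv by blast
  then show "g differentiable (at x)" using real_differentiable_def by blast
  have "deriv g = g'" using g(2) by (auto simp: DERIV_imp_deriv)
  with g show "deriv g \<in> smooth1_alg" by simp
qed

lemma smooth1_add: "smooth1 f \<Longrightarrow> smooth1 g \<Longrightarrow> smooth1 (\<lambda>x. f x + g x)"
  by (rule smooth1_algD, rule smooth1_alg.add; rule smooth1_alg.base)
lemma smooth1_mult: "smooth1 f \<Longrightarrow> smooth1 g \<Longrightarrow> smooth1 (\<lambda>x. f x * g x)"
  by (rule smooth1_algD, rule smooth1_alg.mult; rule smooth1_alg.base)
lemma smooth1_comp: "smooth1 f \<Longrightarrow> smooth1 g \<Longrightarrow> smooth1 (\<lambda>x. f (g x))"
  by (rule smooth1_algD, rule smooth1_alg.comp, assumption, rule smooth1_alg.base)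

lemma smooth1_const: "smooth1 (\<lambda>x. c)"
proof (rule smooth1_coinduct[of _ "{f. \<exists>c. f = (\<lambda>x. c)}"])
  fix f :: "real \<Rightarrow> real" assume "f \<in> {f. \<exists>c. f = (\<lambda>x. c)}"
  then obtain c where f: "f = (\<lambda>x. c)" by blast
  have "deriv f = (\<lambda>x. 0)" unfolding f by (intro ext DERIV_imp_deriv) simp
  then show "deriv f \<in> {f. \<exists>c. f = (\<lambda>x. c)}" by blast
  show "f differentiable (at x)" for x unfolding f by simp
qed blast

lemma smooth1_id: "smooth1 (\<lambda>x. x)"
proof -
  have d: "deriv (\<lambda>x. x) = (\<lambda>x::real. 1)" by (intro ext DERIV_imp_deriv) simp
  show ?thesis
  proof (rule smooth1_coinduct[of _ "insert (\<lambda>x. x) {f. smooth1 f}"])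
    fix f :: "real \<Rightarrow> real" assume f: "f \<in> insert (\<lambda>x. x) {f. smooth1 f}"
    then show "deriv f \<in> insert (\<lambda>x. x) {f. smooth1 f}"
      using d smooth1_const[of 1] smooth1_deriv[of f] by auto
    show "f differentiable (at x)" for x
      using f smooth1_DERIV[of f x] real_differentiable_def by (metis differentiable_ident insert_iff mem_Collect_eq)
  qed simp
qed

lemma smooth1_cmult: "smooth1 f \<Longrightarrow> smooth1 (\<lambda>x. c * f x)"
  by (intro smooth1_mult smooth1_const)

lemma
  assumes "smooth1 f" "smooth1 g"
  shows deriv_mult_smooth1: "deriv (\<lambda>x. f x * g x) = (\<lambda>x. deriv f x * g x + deriv g x * f x)"
    and deriv_cmult_smooth1: "deriv (\<lambda>x. c * f x) = (\<lambda>x. c * deriv f x)"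
  using assms[THEN smooth1_DERIV]
  by (auto intro!: ext DERIV_imp_deriv DERIV_mult DERIV_cmult)

text \<open>The parameter \<open>c\<close> makes mollification unnecessary: as \<open>c\<close>
  tends to 0 the cutoff tends pointwise to the indicator of the positive half-line, staying between
  0 and 1.\<close>

definition exp_cutoff :: "real \<Rightarrow> real \<Rightarrow> real" where
  "exp_cutoff c t = (if t > 0 then exp (- c / t) else 0)"

text \<open>The span of the functions \<open>(1/t) ^ k * exp (- c/t)\<close>, extended by \<open>0\<close>, is closed under
  differentiation.\<close>

lemma exp_cutoff_power_tendsto:
  assumes "c > 0"
  shows "((\<lambda>t. (1 / t) ^ k * exp (- c / t)) \<longlongrightarrow> 0) (at_right (0::real))"
proof -
  have "((\<lambda>x. x ^ k / exp x) \<longlongrightarrow> (0::real)) at_top" by (rule tendsto_power_div_exp_0)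
  moreover have "filterlim (\<lambda>t. c / t) at_top (at_right (0::real))"
    using filterlim_tendsto_pos_mult_at_top[OF tendsto_const assms filterlim_inverse_at_top_right]
    by (simp add: field_simps)
  ultimately have "((\<lambda>t. (c / t) ^ k / exp (c / t)) \<longlongrightarrow> 0) (at_right 0)"
    by (rule filterlim_compose)
  then have "((\<lambda>t. (1 / c ^ k) * ((c / t) ^ k / exp (c / t))) \<longlongrightarrow> (1 / c ^ k) * 0) (at_right 0)"
    by (intro tendsto_intros)
  then show ?thesis
    using assms by (simp add: exp_minus field_simps power_divide)
qed

lemma exp_cutoff_power_DERIV:
  fixes c :: real assumes "c > 0"
  defines "h \<equiv> \<lambda>k t. if t > 0 then (1 / t) ^ k * exp (- c / t) else 0"
  shows "(h k has_real_derivative c * h (k + 2) x - of_nat k * h (k + 1) x) (at x)"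
proof (rule linorder_cases[of x 0])
  assume x: "x < 0"
  have "((\<lambda>t. 0) has_real_derivative 0) (at x)" by simp
  then have "(h k has_real_derivative 0) (at x)"
    by (rule has_field_derivative_transform_within_open[where S="{..<0}"]) (use x in \<open>auto simp: h_def\<close>)
  then show ?thesis using x by (simp add: h_def)
next
  assume x: "x > 0"
  have i: "((\<lambda>t. 1 / t) has_real_derivative - (1 / x)\<^sup>2) (at x)"
    using x by (auto intro!: derivative_eq_intros simp: field_simps power2_eq_square)
  have p: "((\<lambda>t. (1 / t) ^ k) has_real_derivative - of_nat k * (1 / x) ^ (k + 1)) (at x)"
  proof (cases k)
    case (Suc j)
    show ?thesis unfolding Suc
      by (rule DERIV_cong[OF DERIV_power_Suc[OF i]]) (use x in \<open>simp add: power2_eq_square field_simps\<close>)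
  qed simp
  have e: "((\<lambda>t. exp (- c / t)) has_real_derivative c * (1 / x)\<^sup>2 * exp (- c / x)) (at x)"
    using x by (auto intro!: derivative_eq_intros simp: field_simps power2_eq_square)
  have "((\<lambda>t. (1 / t) ^ k * exp (- c / t)) has_real_derivative
      c * h (k + 2) x - of_nat k * h (k + 1) x) (at x)"
    by (rule DERIV_cong[OF DERIV_mult[OF p e]])
      (use x in \<open>simp add: h_def power2_eq_square power_add algebra_simps\<close>)
  then show ?thesis
    by (rule has_field_derivative_transform_within_open[where S="{0<..}"]) (use x in \<open>auto simp: h_def\<close>)
next
  assume x: "x = 0"
  have "((\<lambda>y. (h k y - h k 0) / (y - 0)) \<longlongrightarrow> 0) (at_left 0)"
    by (rule tendsto_eventually) (auto simp: eventually_at_left_field h_def intro!: exI[of _ "-1"])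
  \<comment> \<open>From the right the difference quotient of \<open>h k\<close> at 0 is
    \<open>h (k + 1)\<close>, since dividing by \<open>t\<close> raises the power of
    \<open>1 / t\<close> by one.\<close>
  moreover have "((\<lambda>y. (h k y - h k 0) / (y - 0)) \<longlongrightarrow> 0) (at_right 0)"
    by (rule Lim_transform_eventually[OF exp_cutoff_power_tendsto[OF assms(1), of "k+1"]])
      (auto simp: eventually_at_right_field h_def intro!: exI[of _ "1"])
  ultimately have "((\<lambda>y. (h k y - h k 0) / (y - 0)) \<longlongrightarrow> 0) (at 0)"
    by (simp add: filterlim_split_at)
  then show ?thesis using x by (simp add: has_field_derivative_iff h_def)
qed

lemma smooth1_exp_cutoff:
  assumes "c > 0" shows "smooth1 (exp_cutoff c)"
proof -
  define h where "h \<equiv> \<lambda>k t. if t > 0 then (1 / t) ^ k * exp (- c / t) else (0::real)"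
  have D: "(h k has_real_derivative c * h (k + 2) x - of_nat k * h (k + 1) x) (at x)" for k x
    unfolding h_def by (rule exp_cutoff_power_DERIV[OF assms])
  define A where "A = {\<lambda>t. \<Sum>k\<in>K. a k * h k t | K a. finite (K :: nat set)}"
  have A_add: "(\<lambda>t. f t + g t) \<in> A" if "f \<in> A" "g \<in> A" for f g
  proof -
    from that obtain K a L b where K: "finite K" "finite L" "f = (\<lambda>t. \<Sum>k\<in>K. a k * h k t)"
      "g = (\<lambda>t. \<Sum>k\<in>L. b k * h k t)" unfolding A_def by blast
    have 1: "(\<Sum>k\<in>K. a k * h k t) = (\<Sum>k\<in>K\<union>L. (if k \<in> K then a k else 0) * h k t)" for t
      using K by (intro sum.mono_neutral_cong_left) auto
    have 2: "(\<Sum>k\<in>L. b k * h k t) = (\<Sum>k\<in>K\<union>L. (if k \<in> L then b k else 0) * h k t)" for t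
      using K by (intro sum.mono_neutral_cong_left) auto
    have "(\<lambda>t. f t + g t) = (\<lambda>t. \<Sum>k\<in>K\<union>L. ((if k \<in> K then a k else 0) + (if k \<in> L then b k else 0)) * h k t)"
      unfolding K 1 2 distrib_right sum.distrib ..
    then show ?thesis unfolding A_def using K(1,2)
      by (intro CollectI exI[of _ "K \<union> L"] exI[of _ "\<lambda>k. (if k \<in> K then a k else 0) + (if k \<in> L then b k else 0)"]) simp
  qed
  have A_single: "(\<lambda>t. a * h k t) \<in> A" for a k
    unfolding A_def by (rule CollectI, rule exI[of _ "{k}"], rule exI[of _ "\<lambda>_. a"]) auto
  have A_sum: "finite K \<Longrightarrow> (\<And>k. k \<in> K \<Longrightarrow> f k \<in> A) \<Longrightarrow> (\<lambda>t. \<Sum>k\<in>K. f k t) \<in> A" for K :: "nat set" and f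
  proof (induction rule: finite_induct)
    case empty then show ?case using A_single[of 0 0] by simp
  next
    case (insert x F) then show ?case by (simp add: A_add)
  qed
  have *: "\<exists>f'\<in>A. \<forall>x. (f has_real_derivative f' x) (at x)" if "f \<in> A" for f
  proof -
    from that obtain K a where K: "finite K" "f = (\<lambda>t. \<Sum>k\<in>K. a k * h k t)" unfolding A_def by blast
    have "(f has_real_derivative (\<Sum>k\<in>K. a k * (c * h (k + 2) x - of_nat k * h (k + 1) x))) (at x)" for x
      unfolding K(2) by (intro DERIV_sum DERIV_cmult D)
    moreover have "(\<lambda>t. \<Sum>k\<in>K. a k * (c * h (k + 2) t - of_nat k * h (k + 1) t)) \<in> A"
    proof (rule A_sum[OF K(1)])
      fix k
      have "(\<lambda>t. (a k * c) * h (k + 2) t + (- a k * of_nat k) * h (k + 1) t) \<in> A"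
        by (intro A_add A_single)
      then show "(\<lambda>t. a k * (c * h (k + 2) t - of_nat k * h (k + 1) t)) \<in> A"
        by (simp add: algebra_simps)
    qed
    ultimately show ?thesis
      by (intro bexI[of _ "\<lambda>t. \<Sum>k\<in>K. a k * (c * h (k + 2) t - of_nat k * h (k + 1) t)"]) auto
  qed
  show ?thesis
  proof (rule smooth1_coinduct[of _ A])
    have "exp_cutoff c = (\<lambda>t. 1 * h 0 t)" by (auto simp: exp_cutoff_def h_def)
    then show "exp_cutoff c \<in> A" using A_single[of 1 0] by metis
  next
    fix f x assume "f \<in> A"
    then show "f differentiable (at x)" using * real_differentiable_def by blast
  next
    fix f assume "f \<in> A"
    with * obtain f' where f: "f' \<in> A" "\<And>x. (f has_real_derivative f' x) (at x)" by blast
    have "deriv f = f'" using f(2) by (auto simp: DERIV_imp_deriv)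
    with f show "deriv f \<in> A" by simp
  qed
qed

lemma exp_cutoff_bounds: "c > 0 \<Longrightarrow> 0 \<le> exp_cutoff c t \<and> exp_cutoff c t \<le> 1"
  by (auto simp: exp_cutoff_def)

text \<open>The smooth functions with compact support on the line. The support is bounded
  symmetrically in \<open>s\<close> because under \<open>s = - ln (norm x)\<close> the condition
  \<open>\<bar>s\<bar> \<le> R\<close> describes an annulus around the origin.\<close>

definition tests1 :: "(real \<Rightarrow> real) set" where
  "tests1 = {w. smooth1 w \<and> (\<exists>R. \<forall>s. \<bar>s\<bar> > R \<longrightarrow> w s = 0)}"

lemma tests1_smooth1: "w \<in> tests1 \<Longrightarrow> smooth1 w" by (simp add: tests1_def)

lemma tests1_mult: "smooth1 f \<Longrightarrow> w \<in> tests1 \<Longrightarrow> (\<lambda>s. f s * w s) \<in> tests1"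
  by (fastforce simp: tests1_def smooth1_mult)

lemma tests1_cmult: "w \<in> tests1 \<Longrightarrow> (\<lambda>s. c * w s) \<in> tests1"
  by (rule tests1_mult[OF smooth1_const])

lemma tests1_add: assumes "v \<in> tests1" "w \<in> tests1" shows "(\<lambda>s. v s + w s) \<in> tests1"
proof -
  from assms obtain R R' where "\<forall>s. \<bar>s\<bar> > R \<longrightarrow> v s = 0" "\<forall>s. \<bar>s\<bar> > R' \<longrightarrow> w s = 0"
    by (auto simp: tests1_def)
  then have "\<forall>s. \<bar>s\<bar> > max R R' \<longrightarrow> v s + w s = 0" by auto
  moreover have "smooth1 (\<lambda>s. v s + w s)" using assms by (intro smooth1_add tests1_smooth1)
  ultimately show ?thesis unfolding tests1_def by blast
qed

lemma tests1_diff: "v \<in> tests1 \<Longrightarrow> w \<in> tests1 \<Longrightarrow> (\<lambda>s. v s - w s) \<in> tests1"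
  using tests1_add[OF _ tests1_cmult[of w "-1"], of v] by simp

lemma tests1_deriv: assumes "w \<in> tests1" shows "deriv w \<in> tests1"
proof -
  from assms obtain R where R: "\<forall>s. \<bar>s\<bar> > R \<longrightarrow> w s = 0" by (auto simp: tests1_def)
  have "deriv w s = 0" if "\<bar>s\<bar> > R" for s
  proof -
    have "((\<lambda>t. 0) has_real_derivative 0) (at s)" by simp
    then have "(w has_real_derivative 0) (at s)"
      by (rule has_field_derivative_transform_within_open[where S="{t. \<bar>t\<bar> > R}"])
        (use R that in \<open>auto intro!: open_Collect_less continuous_intros\<close>)
    then show ?thesis by (rule DERIV_imp_deriv)
  qed
  then show ?thesis using assms by (auto simp: tests1_def smooth1_deriv)
qed

lemma ex_tests1_nonzero: "\<exists>w\<in>tests1. \<exists>s. w s \<noteq> 0"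
proof -
  let ?w = "\<lambda>s. exp_cutoff 1 (1 + (- 1) * (s * s))"
  have "smooth1 ?w"
    by (intro smooth1_comp[OF smooth1_exp_cutoff] smooth1_add smooth1_cmult smooth1_mult smooth1_const smooth1_id) simp
  moreover have "?w s = 0" if "\<bar>s\<bar> > 1" for s
    using that abs_le_square_iff[of 1 s] by (auto simp: exp_cutoff_def power2_eq_square)
  ultimately have "?w \<in> tests1" by (auto simp: tests1_def intro!: exI[of _ 1])
  moreover have "?w 0 \<noteq> 0" by (simp add: exp_cutoff_def)
  ultimately show ?thesis by (intro bexI[of _ ?w] exI[of _ 0])
qed

lemma tests1_bounded: assumes "w \<in> tests1" shows "\<exists>B. \<forall>s. \<bar>w s\<bar> \<le> B"
proof -
  from assms obtain R where R: "\<forall>s. \<bar>s\<bar> > R \<longrightarrow> w s = 0" by (auto simp: tests1_def)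
  have "bounded (w ` {-R..R})"
    by (intro compact_imp_bounded compact_continuous_image smooth1_continuous_on tests1_smooth1 assms) auto
  then obtain B where "\<forall>s\<in>{-R..R}. \<bar>w s\<bar> \<le> B" by (auto simp: bounded_real)
  then have "\<bar>w s\<bar> \<le> max B 0" for s
  proof (cases "\<bar>s\<bar> \<le> R")
    case True
    then have "s \<in> {-R..R}" by (simp add: abs_le_iff)
    then show ?thesis using \<open>\<forall>s\<in>{-R..R}. \<bar>w s\<bar> \<le> B\<close> by (simp add: le_max_iff_disj)
  qed (use R in simp)
  then show ?thesis by blast
qed

lemma tests1_measurable [measurable]: "w \<in> tests1 \<Longrightarrow> w \<in> borel_measurable borel"
  by (intro borel_measurable_continuous_onI smooth1_continuous_on tests1_smooth1)

lemma integrable_bounded_support: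
  fixes f :: "real \<Rightarrow> real"
  assumes "f \<in> borel_measurable borel" "\<And>s. \<bar>s\<bar> > R \<Longrightarrow> f s = 0" "\<And>s. \<bar>f s\<bar> \<le> B"
  shows "integrable lborel f"
proof (rule Bochner_Integration.integrable_bound[of _ "\<lambda>s. B * indicator {-R..R} s"])
  show "AE x in lborel. norm (f x) \<le> norm (B * indicator {- R..R} x)"
  proof (rule AE_I2)
    fix x show "norm (f x) \<le> norm (B * indicator {- R..R} x)"
      using assms(2)[of x] assms(3)[of x] by (cases "x \<in> {-R..R}") auto
  qed
  show "integrable lborel (\<lambda>s. B * indicator {-R..R} s)"
    by (rule integrable_mult_right) (simp add: integrable_indicator_iff emeasure_lborel_Icc_eq)
qed (use assms in simp)

lemma tests1_integrable: assumes "w \<in> tests1" shows "integrable lborel w"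
proof -
  from assms obtain R where R: "\<forall>s. \<bar>s\<bar> > R \<longrightarrow> w s = 0" by (auto simp: tests1_def)
  from tests1_bounded[OF assms] obtain B where "\<forall>s. \<bar>w s\<bar> \<le> B" by blast
  with R assms show ?thesis by (intro integrable_bounded_support[of _ R B]) auto
qed

section \<open>Integrals depending on a parameter\<close>

text \<open>By the mean value theorem a bound for the derivative near \<open>t0\<close> also bounds
  the difference quotients, so dominated convergence applies along every sequence tending to
  \<open>t0\<close>.\<close>

lemma has_derivative_integral_dominated:
  fixes f :: "real \<Rightarrow> 'a \<Rightarrow> real"
  assumes int: "\<And>t. integrable M (f t)"
    and der: "\<And>t x. x \<in> space M \<Longrightarrow> ((\<lambda>t. f t x) has_real_derivative f' t x) (at t)"
    and bnd: "\<And>t x. x \<in> space M \<Longrightarrow> \<bar>t - t0\<bar> < e \<Longrightarrow> \<bar>f' t x\<bar> \<le> g x"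
    and g: "integrable M g" and e: "e > 0"
    and meas: "f' t0 \<in> borel_measurable M"
  shows "((\<lambda>t. \<integral>x. f t x \<partial>M) has_real_derivative (\<integral>x. f' t0 x \<partial>M)) (at t0)"
  unfolding has_field_derivative_iff tendsto_at_iff_sequentially
proof (intro allI impI)
  fix X :: "nat \<Rightarrow> real" assume X: "\<forall>i. X i \<in> UNIV - {t0}" "X \<longlonglongrightarrow> t0"
  \<comment> \<open>\<open>Y\<close> replaces the terms of \<open>X\<close> that lie outside the
    neighbourhood where \<open>g\<close> dominates; eventually the two sequences agree. The default
    \<open>t0 + e / 2\<close> is inside the neighbourhood and different from
    \<open>t0\<close>.\<close>
  define Y where "Y i = (if \<bar>X i - t0\<bar> < e then X i else t0 + e / 2)" for i
  have Yne: "Y i \<noteq> t0" "\<bar>Y i - t0\<bar> < e" for i using X e by (auto simp: Y_def)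
  have ev: "\<forall>\<^sub>F i in sequentially. X i = Y i"
    using tendstoD[OF X(2) e] by eventually_elim (auto simp: Y_def dist_real_def)
  have Y: "Y \<longlonglongrightarrow> t0" by (rule Lim_transform_eventually[OF X(2) ev])
  have "(\<lambda>i. \<integral>x. (f (Y i) x - f t0 x) / (Y i - t0) \<partial>M) \<longlonglongrightarrow> (\<integral>x. f' t0 x \<partial>M)"
  proof (rule integral_dominated_convergence[where w=g])
    show "(\<lambda>x. (f (Y i) x - f t0 x) / (Y i - t0)) \<in> borel_measurable M" for i
      using int[THEN borel_measurable_integrable] by measurable
    show "AE x in M. (\<lambda>i. (f (Y i) x - f t0 x) / (Y i - t0)) \<longlonglongrightarrow> f' t0 x"
    proof (rule AE_I2)
      fix x assume x: "x \<in> space M"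
      from der[OF x, of t0] Y Yne show "(\<lambda>i. (f (Y i) x - f t0 x) / (Y i - t0)) \<longlonglongrightarrow> f' t0 x"
        unfolding has_field_derivative_iff tendsto_at_iff_sequentially by (auto simp: o_def)
    qed
    show "AE x in M. norm ((f (Y i) x - f t0 x) / (Y i - t0)) \<le> g x" for i
    proof (rule AE_I2)
      fix x assume x: "x \<in> space M"
      have "\<exists>z. \<bar>z - t0\<bar> < e \<and> f (Y i) x - f t0 x = (Y i - t0) * f' z x"
      proof (cases "Y i > t0")
        case True
        from MVT2[OF this der[OF x]] obtain z where "t0 < z" "z < Y i"
          "f (Y i) x - f t0 x = (Y i - t0) * f' z x" by blast
        then show ?thesis using Yne(2)[of i] by (intro exI[of _ z]) auto
      next
        case False
        then have "Y i < t0" using Yne[of i] by simp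
        from MVT2[OF this der[OF x]] obtain z where "Y i < z" "z < t0"
          "f t0 x - f (Y i) x = (t0 - Y i) * f' z x" by blast
        then show ?thesis using Yne(2)[of i] by (intro exI[of _ z]) (auto simp: algebra_simps)
      qed
      then show "norm ((f (Y i) x - f t0 x) / (Y i - t0)) \<le> g x"
        using Yne[of i] bnd[OF x] by (auto simp: abs_mult)
    qed
  qed (use g meas in auto)
  moreover have "(\<integral>x. (f (Y i) x - f t0 x) / (Y i - t0) \<partial>M) = ((\<integral>x. f (Y i) x \<partial>M) - (\<integral>x. f t0 x \<partial>M)) / (Y i - t0)" for i
    using int by simp
  ultimately have "(\<lambda>i. ((\<integral>x. f (Y i) x \<partial>M) - (\<integral>x. f t0 x \<partial>M)) / (Y i - t0)) \<longlonglongrightarrow> (\<integral>x. f' t0 x \<partial>M)"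
    by (simp only:)
  then show "((\<lambda>y. ((\<integral>x. f y x \<partial>M) - (\<integral>x. f t0 x \<partial>M)) / (y - t0)) \<circ> X) \<longlonglongrightarrow> (\<integral>x. f' t0 x \<partial>M)"
    by (rule Lim_transform_eventually) (use ev in eventually_elim, auto)
qed

lemma tests1_integral_deriv: assumes w: "w \<in> tests1" shows "(LINT s|lborel. deriv w s) = 0"
proof -
  from w obtain R where R: "\<And>s. \<bar>s\<bar> > R \<Longrightarrow> w s = 0" by (auto simp: tests1_def)
  have "((\<lambda>s. deriv w s) has_integral w (\<bar>R\<bar>+1) - w (-\<bar>R\<bar>-1)) {-\<bar>R\<bar>-1..\<bar>R\<bar>+1}"
    by (rule fundamental_theorem_of_calculus)
      (use smooth1_DERIV[OF tests1_smooth1[OF w]] in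
        \<open>auto simp: has_real_derivative_iff_has_vector_derivative[symmetric] intro: has_field_derivative_at_within\<close>)
  then have "((\<lambda>s. deriv w s) has_integral 0) {-\<bar>R\<bar>-1..\<bar>R\<bar>+1}" using R by simp
  then have "((\<lambda>s. deriv w s) has_integral 0) UNIV"
  proof (rule has_integral_on_superset)
    fix s assume "s \<notin> {-\<bar>R\<bar>-1..\<bar>R\<bar>+1}"
    then have s: "\<bar>s\<bar> > R" by auto
    have "((\<lambda>t. 0) has_real_derivative 0) (at s)" by simp
    then have "(w has_real_derivative 0) (at s)"
      by (rule has_field_derivative_transform_within_open[where S="{t. \<bar>t\<bar> > R}"])
        (use R s in \<open>auto intro!: open_Collect_less continuous_intros\<close>)
    then show "deriv w s = 0" by (rule DERIV_imp_deriv)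
  qed auto
  moreover have "((\<lambda>s. deriv w s) has_integral (LINT s|lborel. deriv w s)) UNIV"
    by (rule has_integral_integral_lborel[OF tests1_integrable[OF tests1_deriv[OF w]]])
  ultimately show ?thesis using has_integral_unique by blast
qed

section \<open>Smooth functions and test functions of several variables\<close>

lemma partialI: "(f has_derivative f') (at x) \<Longrightarrow> partial i f x = f' (axis i 1)"
  unfolding partial_def using frechet_derivative_at by metis

lemma has_derivative_partial:
  fixes f :: "real ^ 'n::finite \<Rightarrow> real"
  assumes "f differentiable (at x)"
  shows "(f has_derivative (\<lambda>h. \<Sum>i\<in>UNIV. h $ i * partial i f x)) (at x)"
proof -
  let ?D = "frechet_derivative f (at x)"
  have D: "(f has_derivative ?D) (at x)" using assms frechet_derivative_works by blast
  then interpret linear ?D by (rule has_derivative_linear)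
  have "?D h = (\<Sum>i\<in>UNIV. h $ i * partial i f x)" for h
  proof -
    have "?D h = ?D (\<Sum>i\<in>UNIV. h $ i *\<^sub>R axis i 1)"
      using basis_expansion[of h] by (simp add: scalar_mult_eq_scaleR)
    then show ?thesis by (simp add: sum scale partial_def)
  qed
  then have "?D = (\<lambda>h. \<Sum>i\<in>UNIV. h $ i * partial i f x)" by (rule ext)
  with D show ?thesis by simp
qed

lemma smooth_differentiable: "smooth f \<Longrightarrow> f differentiable (at x)"
  unfolding smooth_def by (metis foldr.simps(1) id_apply)

lemma smooth_partial: "smooth f \<Longrightarrow> smooth (partial i f)"
  unfolding smooth_def
proof (intro allI)
  fix "is" x assume "\<forall>is x. foldr partial is f differentiable at x"
  then have "foldr partial (is @ [i]) f differentiable at x" by blast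
  then show "foldr partial is (partial i f) differentiable at x" by simp
qed

lemma smooth_has_derivative:
  "smooth f \<Longrightarrow> (f has_derivative (\<lambda>h. \<Sum>i\<in>UNIV. h $ i * partial i f x)) (at x)"
  by (intro has_derivative_partial smooth_differentiable)

lemma smooth_continuous_on: "smooth f \<Longrightarrow> continuous_on A f"
  by (simp add: differentiable_imp_continuous_on differentiable_at_imp_differentiable_on smooth_differentiable)

lemma smooth_coinduct:
  assumes "f \<in> A" "\<And>f x. f \<in> A \<Longrightarrow> f differentiable (at x)" "\<And>f i. f \<in> A \<Longrightarrow> partial i f \<in> A"
  shows "smooth f"
proof -
  have "foldr partial is f \<in> A" for "is"
    by (induction "is") (use assms in auto)
  then show ?thesis using assms(2) by (auto simp: smooth_def)
qed

text \<open>The analogue of \<open>smooth1_alg\<close>, with a set \<open>G\<close> of further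
  generators. It serves functions whose smoothness is still to be shown but whose partial
  derivatives are visibly built from functions of the same kind, such as power weights times test
  functions.\<close>

inductive_set smooth_alg :: "(real ^ 'n::finite \<Rightarrow> real) set \<Rightarrow> (real ^ 'n \<Rightarrow> real) set" for G where
  base: "smooth f \<Longrightarrow> f \<in> smooth_alg G"
| gen: "f \<in> G \<Longrightarrow> f \<in> smooth_alg G"
| comp: "smooth1 f \<Longrightarrow> g \<in> smooth_alg G \<Longrightarrow> (\<lambda>x. f (g x)) \<in> smooth_alg G"
| add: "f \<in> smooth_alg G \<Longrightarrow> g \<in> smooth_alg G \<Longrightarrow> (\<lambda>x. f x + g x) \<in> smooth_alg G"
| mult: "f \<in> smooth_alg G \<Longrightarrow> g \<in> smooth_alg G \<Longrightarrow> (\<lambda>x. f x * g x) \<in> smooth_alg G"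

lemma smooth_algD:
  assumes f: "f \<in> smooth_alg G"
    and G: "\<And>g x. g \<in> G \<Longrightarrow> g differentiable (at x)" "\<And>g i. g \<in> G \<Longrightarrow> partial i g \<in> smooth_alg G"
  shows "smooth f"
proof -
  have *: "(\<forall>x. g differentiable (at x)) \<and> (\<forall>i. partial i g \<in> smooth_alg G)" if "g \<in> smooth_alg G" for g
    using that
  proof induction
    case (base f)
    then show ?case by (auto intro: smooth_differentiable smooth_alg.base smooth_partial)
  next
    case (gen f)
    then show ?case using G by blast
  next
    case (comp f g)
    have D: "((\<lambda>x. f (g x)) has_derivative (\<lambda>h. deriv f (g x) * (\<Sum>i\<in>UNIV. h $ i * partial i g x))) (at x)" for x
    proof -
      have g: "(g has_derivative (\<lambda>h. \<Sum>i\<in>UNIV. h $ i * partial i g x)) (at x)"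
        using comp.IH by (intro has_derivative_partial) blast
      have "(f has_derivative (*) (deriv f (g x))) (at (g x))"
        using smooth1_DERIV[OF comp.hyps(1), of "g x"] by (simp add: has_field_derivative_def)
      from diff_chain_at[OF g this] show ?thesis by (simp add: o_def)
    qed
    have "partial i (\<lambda>x. f (g x)) = (\<lambda>x. deriv f (g x) * partial i g x)" for i
      by (rule ext, subst partialI[OF D]) (simp add: axis_def if_distrib[of "\<lambda>z. z * _"] cong: if_cong)
    moreover have "(\<lambda>x. deriv f (g x) * partial i g x) \<in> smooth_alg G" for i
      by (intro smooth_alg.mult smooth_alg.comp[of "deriv f" g] smooth1_deriv comp.hyps) (use comp.IH in blast)
    ultimately show ?case using differentiableI[OF D] by simp
  next
    case (add f g)
    have D: "((\<lambda>x. f x + g x) has_derivative (\<lambda>h. (\<Sum>i\<in>UNIV. h $ i * partial i f x) + (\<Sum>i\<in>UNIV. h $ i * partial i g x))) (at x)" for x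
      by (intro has_derivative_add has_derivative_partial) (use add.IH in blast)+
    have "partial i (\<lambda>x. f x + g x) = (\<lambda>x. partial i f x + partial i g x)" for i
      by (rule ext, subst partialI[OF D]) (simp add: axis_def if_distrib[of "\<lambda>z. z * _"] cong: if_cong)
    moreover have "(\<lambda>x. partial i f x + partial i g x) \<in> smooth_alg G" for i
      by (rule smooth_alg.add) (use add.IH in blast)+
    ultimately show ?case using differentiableI[OF D] by simp
  next
    case (mult f g)
    have D: "((\<lambda>x. f x * g x) has_derivative (\<lambda>h. f x * (\<Sum>i\<in>UNIV. h $ i * partial i g x) + (\<Sum>i\<in>UNIV. h $ i * partial i f x) * g x)) (at x)" for x
      by (intro has_derivative_mult has_derivative_partial) (use mult.IH in blast)+
    have "partial i (\<lambda>x. f x * g x) = (\<lambda>x. f x * partial i g x + partial i f x * g x)" for i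
      by (rule ext, subst partialI[OF D]) (simp add: axis_def if_distrib[of "\<lambda>z. z * _"] cong: if_cong)
    moreover have "(\<lambda>x. f x * partial i g x + partial i f x * g x) \<in> smooth_alg G" for i
      by (rule smooth_alg.add; rule smooth_alg.mult) (use mult in blast)+
    ultimately show ?case using differentiableI[OF D] by simp
  qed
  show ?thesis
    by (rule smooth_coinduct[OF f]) (use * in blast)+
qed

lemma smooth_const: "smooth (\<lambda>x. c)"
proof (rule smooth_coinduct[of _ "{f. \<exists>c. f = (\<lambda>x. c)}"])
  fix f :: "real ^ 'n \<Rightarrow> real" assume "f \<in> {f. \<exists>c. f = (\<lambda>x. c)}"
  then obtain c where f: "f = (\<lambda>x. c)" by blast
  show "f differentiable (at x)" for x unfolding f by simp
  have "partial i f = (\<lambda>x. 0)" for i unfolding f by (rule ext, subst partialI[OF has_derivative_const]) simp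
  then show "partial i f \<in> {f. \<exists>c. f = (\<lambda>x. c)}" for i by blast
qed blast

lemma
  fixes f g :: "real ^ 'n::finite \<Rightarrow> real"
  assumes "smooth f" "smooth g"
  shows smooth_add: "smooth (\<lambda>x. f x + g x)"
    and smooth_mult: "smooth (\<lambda>x. f x * g x)"
  by (rule smooth_algD[where G="{}"], rule smooth_alg.add smooth_alg.mult,
      (rule smooth_alg.base, rule assms)+, simp, simp)+

lemma smooth_comp1:
  assumes "smooth1 f" "smooth g" shows "smooth (\<lambda>x. f (g x))"
  by (rule smooth_algD[where G="{}"], rule smooth_alg.comp,
      rule assms, rule smooth_alg.base, rule assms, simp, simp)

lemma smooth_cmult: "smooth f \<Longrightarrow> smooth (\<lambda>x. c * f x)"
  by (rule smooth_mult[OF smooth_const])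

lemma smooth_sum: "(\<And>i. i \<in> I \<Longrightarrow> smooth (f i)) \<Longrightarrow> smooth (\<lambda>x. \<Sum>i\<in>I. f i x)"
  by (induction I rule: infinite_finite_induct) (auto simp: smooth_const smooth_add)

lemma smooth_prod: "(\<And>i. i \<in> I \<Longrightarrow> smooth (f i)) \<Longrightarrow> smooth (\<lambda>x. \<Prod>i\<in>I. f i x)"
  by (induction I rule: infinite_finite_induct) (auto simp: smooth_const smooth_mult)

lemma has_derivative_coord: "((\<lambda>x::real ^ 'n::finite. x $ j) has_derivative (\<lambda>h. h $ j)) (at x)"
  by (rule bounded_linear_imp_has_derivative[OF bounded_linear_vec_nth])

lemma partial_coord: "partial i (\<lambda>x::real ^ 'n::finite. x $ j) = (\<lambda>x. if i = j then 1 else 0)"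
  by (rule ext, subst partialI[OF has_derivative_coord]) (auto simp: axis_def)

lemma smooth_coord: "smooth (\<lambda>x::real ^ 'n::finite. x $ j)"
proof (rule smooth_algD[where G="{\<lambda>x. x $ j}"])
  fix g :: "real ^ 'n \<Rightarrow> real" and i x assume "g \<in> {\<lambda>x. x $ j}"
  then have g: "g = (\<lambda>x. x $ j)" by simp
  show "g differentiable (at x)" unfolding g using has_derivative_coord differentiable_def by blast
  show "partial i g \<in> smooth_alg {\<lambda>x. x $ j}" unfolding g partial_coord
    by (rule smooth_alg.base, rule smooth_const)
qed (rule smooth_alg.gen, simp)

lemma
  fixes f g :: "real ^ 'n::finite \<Rightarrow> real"
  assumes "smooth f" "smooth g"
  shows partial_diff: "partial i (\<lambda>x. f x - g x) = (\<lambda>x. partial i f x - partial i g x)"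
    and partial_mult: "partial i (\<lambda>x. f x * g x) = (\<lambda>x. f x * partial i g x + partial i f x * g x)"
proof -
  note D = assms[THEN smooth_has_derivative]
  note s = axis_def if_distrib[of "\<lambda>z. z * _"]
  show "partial i (\<lambda>x. f x - g x) = (\<lambda>x. partial i f x - partial i g x)"
    by (rule ext, subst partialI[OF has_derivative_diff[OF D]]) (simp add: s cong: if_cong)
  show "partial i (\<lambda>x. f x * g x) = (\<lambda>x. f x * partial i g x + partial i f x * g x)"
    by (rule ext, subst partialI[OF has_derivative_mult[OF D]]) (simp add: s cong: if_cong)
qed

lemma smooth_diff: "smooth f \<Longrightarrow> smooth g \<Longrightarrow> smooth (\<lambda>x. f x - g x)"
  using smooth_add[OF _ smooth_cmult[of g "-1"], of f] by simp

lemma partial_translate: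
  fixes f :: "real ^ 'n::finite \<Rightarrow> real"
  assumes "smooth f" shows "partial i (\<lambda>x. f (x - y)) = (\<lambda>x. partial i f (x - y))"
proof
  fix x
  have "((\<lambda>x. x - y) has_derivative (\<lambda>h. h)) (at x)" by (auto intro!: derivative_eq_intros)
  from diff_chain_at[OF this smooth_has_derivative[OF assms]]
  have D: "((\<lambda>x. f (x - y)) has_derivative (\<lambda>h. \<Sum>i\<in>UNIV. h $ i * partial i f (x - y))) (at x)"
    by (simp add: o_def)
  show "partial i (\<lambda>x. f (x - y)) x = partial i f (x - y)"
    by (subst partialI[OF D]) (simp add: axis_def if_distrib[of "\<lambda>z. z * _"] cong: if_cong)
qed

lemma differentiable_translate:
  fixes f :: "real ^ 'n::finite \<Rightarrow> real"
  assumes "smooth f" shows "(\<lambda>x. f (x - y)) differentiable (at x)"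
proof -
  have "((\<lambda>x. x - y) has_derivative (\<lambda>h. h)) (at x)" by (auto intro!: derivative_eq_intros)
  from diff_chain_at[OF this smooth_has_derivative[OF assms]]
  show ?thesis unfolding differentiable_def o_def by blast
qed

lemma smooth_translate:
  fixes f :: "real ^ 'n::finite \<Rightarrow> real"
  assumes "smooth f" shows "smooth (\<lambda>x. f (x - y))"
proof (rule smooth_coinduct[of _ "{g. \<exists>f. smooth f \<and> g = (\<lambda>x. f (x - y))}"])
  fix g :: "real ^ 'n \<Rightarrow> real" assume "g \<in> {g. \<exists>f. smooth f \<and> g = (\<lambda>x. f (x - y))}"
  then obtain f where f: "smooth f" "g = (\<lambda>x. f (x - y))" by blast
  show "g differentiable (at x)" for x unfolding f(2) by (rule differentiable_translate[OF f(1)])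
  show "partial i g \<in> {g. \<exists>f. smooth f \<and> g = (\<lambda>x. f (x - y))}" for i
    unfolding f(2) partial_translate[OF f(1)] using smooth_partial[OF f(1)] by blast
qed (use assms in blast)

lemma laplacian_translate:
  "smooth f \<Longrightarrow> laplacian (\<lambda>x. f (x - y)) = (\<lambda>x. laplacian f (x - y))"
  unfolding laplacian_def by (simp add: partial_translate smooth_partial)

lemma laplacian_diff:
  "smooth f \<Longrightarrow> smooth g \<Longrightarrow> laplacian (\<lambda>x. f x - g x) = (\<lambda>x. laplacian f x - laplacian g x)"
  unfolding laplacian_def by (simp add: partial_diff smooth_partial sum_subtractf)

section \<open>Test functions on the punctured space\<close>

lemma test_functions_iff:
  "f \<in> test_functions \<longleftrightarrow> smooth f \<and> (\<exists>r>0. \<exists>R. \<forall>x. f x \<noteq> 0 \<longrightarrow> r \<le> norm x \<and> norm x \<le> R)"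
proof (intro iffI conjI)
  assume f: "f \<in> test_functions"
  then show "smooth f" by (simp add: test_functions_def)
  let ?C = "closure {x. f x \<noteq> 0}"
  from f have "compact ?C" "0 \<notin> ?C" by (auto simp: test_functions_def)
  then obtain R where R: "\<forall>x\<in>?C. norm x \<le> R" using compact_imp_bounded bounded_iff by blast
  have "open (- ?C)" "0 \<in> - ?C" using \<open>0 \<notin> ?C\<close> by auto
  then obtain r where r: "r > 0" "ball 0 r \<subseteq> - ?C" using open_contains_ball by blast
  have "r \<le> norm x \<and> norm x \<le> R" if "f x \<noteq> 0" for x
  proof -
    have "x \<in> ?C" by (rule subsetD[OF closure_subset]) (simp add: that)
    then have "x \<notin> ball 0 r" "norm x \<le> R" using r R by auto
    then show ?thesis by (simp add: dist_norm)
  qed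
  with r(1) show "\<exists>r>0. \<exists>R. \<forall>x. f x \<noteq> 0 \<longrightarrow> r \<le> norm x \<and> norm x \<le> R" by blast
next
  assume "smooth f \<and> (\<exists>r>0. \<exists>R. \<forall>x. f x \<noteq> 0 \<longrightarrow> r \<le> norm x \<and> norm x \<le> R)"
  then obtain r R where f: "smooth f" and r: "r > 0" and R: "\<And>x. f x \<noteq> 0 \<Longrightarrow> r \<le> norm x \<and> norm x \<le> R" by blast
  have "closed {x::real ^ 'a. r \<le> norm x}" by (intro closed_Collect_le continuous_intros)
  then have cl: "closure {x. f x \<noteq> 0} \<subseteq> {x. r \<le> norm x}" by (intro closure_minimal) (use R in auto)
  have "{x. f x \<noteq> 0} \<subseteq> cball 0 R" using R by (auto simp: dist_norm)
  then have "bounded {x. f x \<noteq> 0}" using bounded_subset bounded_cball by blast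
  with f cl r show "f \<in> test_functions" by (auto simp: test_functions_def)
qed

lemma test_functions_smooth: "f \<in> test_functions \<Longrightarrow> smooth f" by (simp add: test_functions_def)

lemma test_functionsE:
  assumes "f \<in> test_functions"
  obtains r R where "r > 0" "\<And>x. f x \<noteq> 0 \<Longrightarrow> r \<le> norm x \<and> norm x \<le> R"
  using assms test_functions_iff by metis

text \<open>The radii are kept explicit so that one annulus serves a function together with all its
  derivatives; \<open>quotient_test_le\<close> relies on this.\<close>

lemma partial_eq_0_outside:
  assumes f: "\<And>x. f x \<noteq> 0 \<Longrightarrow> r \<le> norm x \<and> norm x \<le> R" and "partial i f x \<noteq> 0"
  shows "r \<le> norm x \<and> norm x \<le> R"
proof (rule ccontr)
  assume "\<not> ?thesis"
  then have x: "x \<in> {x. norm x < r} \<union> {x. R < norm x}" (is "x \<in> ?S") by auto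
  have "open ?S" by (intro open_Un open_Collect_less continuous_intros)
  have "((\<lambda>x. 0) has_derivative (\<lambda>h. 0)) (at x)" by simp
  then have "(f has_derivative (\<lambda>h. 0)) (at x)"
    by (rule has_derivative_transform_within_open[OF _ \<open>open ?S\<close> x]) (use f in force)
  from partialI[OF this] assms(2) show False by simp
qed

lemma test_partial: assumes "f \<in> test_functions" shows "partial i f \<in> test_functions"
proof -
  from assms obtain r R where r: "r > 0" "\<And>x. f x \<noteq> 0 \<Longrightarrow> r \<le> norm x \<and> norm x \<le> R" by (rule test_functionsE) blast
  have "\<forall>x. partial i f x \<noteq> 0 \<longrightarrow> r \<le> norm x \<and> norm x \<le> R" using partial_eq_0_outside r(2) by blast
  with r(1) smooth_partial[OF test_functions_smooth[OF assms]] show ?thesis unfolding test_functions_iff by blast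
qed

lemma test_mult: assumes "smooth g" "f \<in> test_functions" shows "(\<lambda>x. g x * f x) \<in> test_functions"
proof -
  from assms(2) obtain r R where r: "r > 0" "\<And>x. f x \<noteq> 0 \<Longrightarrow> r \<le> norm x \<and> norm x \<le> R" by (rule test_functionsE) blast
  then have "\<forall>x. g x * f x \<noteq> 0 \<longrightarrow> r \<le> norm x \<and> norm x \<le> R" by auto
  with r(1) smooth_mult[OF assms(1) test_functions_smooth[OF assms(2)]] show ?thesis unfolding test_functions_iff by blast
qed

lemma test_cmult: "f \<in> test_functions \<Longrightarrow> (\<lambda>x. c * f x) \<in> test_functions"
  by (rule test_mult[OF smooth_const])

lemma test_add:
  assumes "f \<in> test_functions" "g \<in> test_functions" shows "(\<lambda>x. f x + g x) \<in> test_functions"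
proof -
  from assms(1) obtain r R where r: "r > 0" "\<And>x. f x \<noteq> 0 \<Longrightarrow> r \<le> norm x \<and> norm x \<le> R" by (rule test_functionsE) blast
  from assms(2) obtain r' R' where r': "r' > 0" "\<And>x. g x \<noteq> 0 \<Longrightarrow> r' \<le> norm x \<and> norm x \<le> R'" by (rule test_functionsE) blast
  have "\<forall>x. f x + g x \<noteq> 0 \<longrightarrow> min r r' \<le> norm x \<and> norm x \<le> max R R'"
    using r(2) r'(2) by (metis add_0 le_max_iff_disj min_le_iff_disj)
  moreover have "min r r' > 0" using r r' by simp
  ultimately show ?thesis unfolding test_functions_iff
    using smooth_add[OF assms[THEN test_functions_smooth]] by blast
qed

lemma test_diff: "f \<in> test_functions \<Longrightarrow> g \<in> test_functions \<Longrightarrow> (\<lambda>x. f x - g x) \<in> test_functions"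
  using test_add[OF _ test_cmult[of g "-1"], of f] by simp

lemma test_zero: "(\<lambda>x. 0) \<in> test_functions"
  by (auto simp: test_functions_iff smooth_const intro!: exI[of _ 1])

lemma test_sum: "(\<And>i. i \<in> I \<Longrightarrow> f i \<in> test_functions) \<Longrightarrow> (\<lambda>x. \<Sum>i\<in>I. f i x) \<in> test_functions"
  by (induction I rule: infinite_finite_induct) (auto simp: test_zero test_add)

lemma test_laplacian: "f \<in> test_functions \<Longrightarrow> laplacian f \<in> test_functions"
  unfolding laplacian_def by (intro test_sum test_partial)

lemma test_continuous_on: "f \<in> test_functions \<Longrightarrow> continuous_on A f"
  by (intro smooth_continuous_on test_functions_smooth)

lemma test_measurable [measurable]: "f \<in> test_functions \<Longrightarrow> f \<in> borel_measurable borel"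
  by (intro borel_measurable_continuous_onI test_continuous_on)

lemma test_measurable_lebesgue: "f \<in> test_functions \<Longrightarrow> f \<in> borel_measurable lebesgue"
  by (rule measurable_completion) simp

lemma test_bounded: assumes "f \<in> test_functions" shows "\<exists>B. \<forall>x. \<bar>f x\<bar> \<le> B"
proof -
  from assms obtain r R where r: "r > 0" "\<And>x. f x \<noteq> 0 \<Longrightarrow> r \<le> norm x \<and> norm x \<le> R" by (rule test_functionsE) blast
  have "bounded (f ` cball 0 R)"
    by (intro compact_imp_bounded compact_continuous_image test_continuous_on assms) auto
  then obtain B where B: "\<forall>x\<in>cball 0 R. \<bar>f x\<bar> \<le> B" by (auto simp: bounded_real)
  have "\<bar>f x\<bar> \<le> max B 0" for x
  proof (cases "f x = 0")
    case False
    then have "x \<in> cball 0 R" using r(2) by (auto simp: dist_norm)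
    then show ?thesis using B by (simp add: le_max_iff_disj)
  qed simp
  then show ?thesis by blast
qed

lemma integrable_bounded_supportN:
  fixes f :: "real ^ 'n::finite \<Rightarrow> real"
  assumes "f \<in> borel_measurable borel" "\<And>x. norm x > R \<Longrightarrow> f x = 0" "\<And>x. \<bar>f x\<bar> \<le> B"
  shows "integrable lborel f"
proof (rule Bochner_Integration.integrable_bound[of _ "\<lambda>x. B * indicator (cball 0 R) x"])
  show "AE x in lborel. norm (f x) \<le> norm (B * indicator (cball 0 R) x)"
  proof (rule AE_I2)
    fix x show "norm (f x) \<le> norm (B * indicator (cball 0 R) x)"
      using assms(2)[of x] assms(3)[of x] by (cases "x \<in> cball 0 R") auto
  qed
  show "integrable lborel (\<lambda>x::real ^ 'n. B * indicator (cball 0 R) x)"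
    using emeasure_lborel_cball_finite[of "0 :: real ^ 'n" R]
    by (intro integrable_mult_right integrable_real_indicator) simp_all
qed (use assms in simp)

lemma test_integrable: assumes "f \<in> test_functions" shows "integrable lborel f"
proof -
  from assms obtain r R where r: "r > 0" "\<And>x. f x \<noteq> 0 \<Longrightarrow> r \<le> norm x \<and> norm x \<le> R" by (rule test_functionsE) blast
  from test_bounded[OF assms] obtain B where "\<forall>x. \<bar>f x\<bar> \<le> B" by blast
  with r assms show ?thesis by (intro integrable_bounded_supportN[of _ R B]) force+
qed

lemma test_integral_lebesgue:
  assumes "f \<in> test_functions"
  shows "integrable lebesgue f" "(LINT x|lebesgue. f x) = (LINT x|lborel. f x)"
  using test_integrable[OF assms] assms
  by (simp_all add: integrable_completion integral_completion)

section \<open>Power weights on test functions\<close>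

lemma has_derivative_norm_powr:
  fixes x :: "real ^ 'n::finite"
  assumes "x \<noteq> 0"
  shows "((\<lambda>x. norm x powr a) has_derivative (\<lambda>h. a * norm x powr (a - 2) * (x \<bullet> h))) (at x)"
proof -
  have "((\<lambda>r. r powr a) has_derivative (*) (a * norm x powr (a - 1))) (at (norm x))"
    using has_real_derivative_powr[of "norm x" a] assms by (simp add: has_field_derivative_def)
  from diff_chain_at[OF has_derivative_norm[OF assms] this]
  have "((\<lambda>x. norm x powr a) has_derivative (\<lambda>h. a * norm x powr (a - 1) * (h \<bullet> sgn x))) (at x)"
    by (simp add: o_def)
  moreover have "norm x powr (a - 1) * (h \<bullet> sgn x) = norm x powr (a - 2) * (x \<bullet> h)" for h
    using assms powr_diff[of "norm x" "a - 1" 1]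
    by (simp add: sgn_div_norm inner_commute divide_inverse)
  ultimately show ?thesis by (simp add: mult.assoc)
qed

lemma has_derivative_vanish_near_0:
  fixes f :: "real ^ 'n::finite \<Rightarrow> real"
  assumes "\<And>x. norm x < r \<Longrightarrow> f x = 0" "norm x < r"
  shows "(f has_derivative (\<lambda>h. 0)) (at x)"
proof -
  have "open {x::real ^ 'n. norm x < r}" by (intro open_Collect_less continuous_intros)
  moreover have "((\<lambda>x. 0) has_derivative (\<lambda>h. 0)) (at x)" by simp
  ultimately show ?thesis
    by (rule_tac has_derivative_transform_within_open[where s="{x. norm x < r}" and f="\<lambda>x. 0"]) (use assms in auto)
qed

lemma has_derivative_powr_test:
  fixes \<phi> :: "real ^ 'n::finite \<Rightarrow> real"
  assumes "\<phi> \<in> test_functions"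
  shows "((\<lambda>x. norm x powr a * \<phi> x) has_derivative
    (\<lambda>h. norm x powr a * (\<Sum>i\<in>UNIV. h $ i * partial i \<phi> x) + a * norm x powr (a - 2) * (x \<bullet> h) * \<phi> x)) (at x)"
proof (cases "x = 0")
  case False
  show ?thesis
    by (rule has_derivative_mult[OF has_derivative_norm_powr[OF False] smooth_has_derivative[OF test_functions_smooth[OF assms]]])
next
  \<comment> \<open>At the origin the function vanishes in a neighbourhood, and the formula also
    gives 0 because \<open>0 powr a = 0\<close>.\<close>
  case True
  from assms obtain r R where r: "r > 0" "\<And>x. \<phi> x \<noteq> 0 \<Longrightarrow> r \<le> norm x \<and> norm x \<le> R" by (rule test_functionsE) blast
  have "((\<lambda>x. norm x powr a * \<phi> x) has_derivative (\<lambda>h. 0)) (at x)"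
    by (rule has_derivative_vanish_near_0[of r]) (use r True in force)+
  then show ?thesis using True by simp
qed

lemma partial_powr_test:
  assumes "\<phi> \<in> test_functions"
  shows "partial i (\<lambda>x. norm x powr a * \<phi> x) =
    (\<lambda>x. norm x powr a * partial i \<phi> x + norm x powr (a - 2) * (a * x $ i * \<phi> x))"
  by (rule ext, subst partialI[OF has_derivative_powr_test[OF assms]])
    (simp add: axis_def if_distrib[of "\<lambda>z. z * _"] inner_axis[unfolded axis_def] cong: if_cong)

text \<open>The weight is singular only where the test function vanishes identically.
  Differentiation gives two terms of the same form with exponents \<open>a\<close> and
  \<open>a - 2\<close>, so these products are an invariant set. Consequently all weighted integrals
  of test functions below are integrals of test functions and need no estimate for
  integrability.\<close>

lemma test_powr:
  fixes \<phi> :: "real ^ 'n::finite \<Rightarrow> real"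
  assumes "\<phi> \<in> test_functions" shows "(\<lambda>x. norm x powr a * \<phi> x) \<in> test_functions"
proof -
  define G where "G = {f. \<exists>a \<phi>. \<phi> \<in> test_functions \<and> f = (\<lambda>x::real ^ 'n. norm x powr a * \<phi> x)}"
  have G: "(\<lambda>x. norm x powr a * \<phi> x) \<in> G" if "\<phi> \<in> test_functions" for a \<phi>
    unfolding G_def using that by blast
  have "smooth (\<lambda>x. norm x powr a * \<phi> x)"
  proof (rule smooth_algD[of _ G])
    show "(\<lambda>x. norm x powr a * \<phi> x) \<in> smooth_alg G" by (intro smooth_alg.gen G assms)
  next
    fix g :: "real ^ 'n \<Rightarrow> real" and x i assume "g \<in> G"
    then obtain a \<phi> where g: "\<phi> \<in> test_functions" "g = (\<lambda>x. norm x powr a * \<phi> x)" unfolding G_def by blast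
    show "g differentiable (at x)" unfolding g(2) by (rule differentiableI[OF has_derivative_powr_test[OF g(1)]])
    show "partial i g \<in> smooth_alg G" unfolding g(2) partial_powr_test[OF g(1)]
      by (intro smooth_alg.add smooth_alg.gen G test_mult[OF _ g(1)] test_partial[OF g(1)] smooth_mult smooth_const smooth_coord)
  qed
  moreover from assms obtain r R where r: "r > 0" "\<And>x. \<phi> x \<noteq> 0 \<Longrightarrow> r \<le> norm x \<and> norm x \<le> R" by (rule test_functionsE) blast
  from r(2) have "\<forall>x. norm x powr a * \<phi> x \<noteq> 0 \<longrightarrow> r \<le> norm x \<and> norm x \<le> R" by simp
  with r(1) calculation show ?thesis unfolding test_functions_iff by blast
qed

section \<open>Radial test functions\<close>

text \<open>The inverse of the Emden-Fowler transformation. The exponent is a free parameter because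
  differentiation raises it by 2 when a factor \<open>x $ i\<close> is split off, and weights lower
  it.\<close>

definition rad :: "real \<Rightarrow> (real \<Rightarrow> real) \<Rightarrow> real ^ 'n::finite \<Rightarrow> real" where
  "rad a w = (\<lambda>x. norm x powr (- a) * w (- ln (norm x)))"

lemma rad_support:
  assumes w: "\<And>s. \<bar>s\<bar> > R \<Longrightarrow> w s = 0" and x: "rad a w x \<noteq> 0"
  shows "exp (- R) \<le> norm x \<and> norm x \<le> exp R"
proof -
  from x have "x \<noteq> 0" and nz: "w (- ln (norm x)) \<noteq> 0" by (auto simp: rad_def)
  have "\<not> R < \<bar>- ln (norm x)\<bar>" using w nz by blast
  with \<open>x \<noteq> 0\<close> have "norm x > 0" "- R \<le> ln (norm x)" "ln (norm x) \<le> R" by simp_all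
  then have "exp (- R) \<le> exp (ln (norm x))" "exp (ln (norm x)) \<le> exp R" by (simp_all only: exp_le_cancel_iff)
  then show ?thesis unfolding exp_ln[OF \<open>norm x > 0\<close>] by blast
qed

lemma norm_powr_mult_sq: "norm (x::real ^ 'n::finite) powr a * (norm x)\<^sup>2 = norm x powr (a + 2)"
  by (cases "x = 0") (simp_all add: powr_add)

lemma rad_mult_sq: "(norm x)\<^sup>2 * rad (a + 2) w x = rad a w x"
  using norm_powr_mult_sq[of x "- (a + 2)"] by (simp add: rad_def mult_ac)

lemma has_derivative_rad:
  fixes x :: "real ^ 'n::finite"
  assumes "w \<in> tests1"
  shows "(rad a w has_derivative (\<lambda>h. (x \<bullet> h) * rad (a + 2) (\<lambda>s. - (a * w s + deriv w s)) x)) (at x)"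
proof (cases "x = 0")
  case False
  have "((\<lambda>r. w (- ln r)) has_real_derivative deriv w (- ln (norm x)) * (- (1 / norm x))) (at (norm x))"
    by (rule DERIV_chain2[OF smooth1_DERIV[OF tests1_smooth1[OF assms]]])
      (use False in \<open>auto intro!: derivative_eq_intros\<close>)
  then have "((\<lambda>r. w (- ln r)) has_derivative (*) (deriv w (- ln (norm x)) * (- (1 / norm x)))) (at (norm x))"
    by (simp add: has_field_derivative_def)
  from diff_chain_at[OF has_derivative_norm[OF False] this]
  have "((\<lambda>x. w (- ln (norm x))) has_derivative (\<lambda>h. deriv w (- ln (norm x)) * (- (1 / norm x)) * (h \<bullet> sgn x))) (at x)"
    by (simp add: o_def)
  from has_derivative_mult[OF has_derivative_norm_powr[OF False, of "- a"] this]
  have "(rad a w has_derivative (\<lambda>h. norm x powr - a * (deriv w (- ln (norm x)) * - (1 / norm x) * (h \<bullet> sgn x)) +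
       - a * norm x powr (- a - 2) * (x \<bullet> h) * w (- ln (norm x)))) (at x)"
    by (simp add: rad_def)
  moreover have "norm x powr - a * (deriv w (- ln (norm x)) * - (1 / norm x) * (h \<bullet> sgn x)) +
       - a * norm x powr (- a - 2) * (x \<bullet> h) * w (- ln (norm x))
     = (x \<bullet> h) * rad (a + 2) (\<lambda>s. - (a * w s + deriv w s)) x" for h
  proof -
    have e1: "norm x powr (- a) = norm x powr (- a - 2) * (norm x)\<^sup>2"
      using norm_powr_mult_sq[of x "- a - 2"] by simp
    have e2: "h \<bullet> sgn x = (x \<bullet> h) / norm x"
      by (simp add: sgn_div_norm inner_commute divide_inverse)
    have e3: "rad (a + 2) (\<lambda>s. - (a * w s + deriv w s)) x =
       - (norm x powr (- a - 2) * (a * w (- ln (norm x)) + deriv w (- ln (norm x))))"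
      by (simp add: rad_def algebra_simps)
    show ?thesis unfolding e1 e2 e3 using False by (simp add: field_simps power2_eq_square)
  qed
  ultimately show ?thesis by simp
next
  case True
  from assms obtain R where R: "\<And>s. \<bar>s\<bar> > R \<Longrightarrow> w s = 0" by (auto simp: tests1_def)
  have "rad a w y = 0" if "norm y < exp (- R)" for y :: "real ^ 'n"
    using rad_support[of R w a y, OF R] that by fastforce
  then have "(rad a w has_derivative (\<lambda>h. 0)) (at x)"
    by (rule has_derivative_vanish_near_0[of "exp (- R)"]) (use True in simp_all)
  then show ?thesis using True by simp
qed

lemma partial_rad:
  fixes w :: "real \<Rightarrow> real"
  assumes "w \<in> tests1"
  shows "partial i (rad a w :: real ^ 'n::finite \<Rightarrow> real) =
    (\<lambda>x. x $ i * rad (a + 2) (\<lambda>s. - (a * w s + deriv w s)) x)"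
  by (rule ext, subst partialI[OF has_derivative_rad[OF assms]]) (simp add: inner_axis)

lemma tests1_neg_deriv: "w \<in> tests1 \<Longrightarrow> (\<lambda>s. - (a * w s + deriv w s)) \<in> tests1"
  using tests1_cmult[OF tests1_add[OF tests1_cmult tests1_deriv], of w w "-1" a] by simp

lemma test_rad:
  assumes "w \<in> tests1" shows "(rad a w :: real ^ 'n::finite \<Rightarrow> real) \<in> test_functions"
proof -
  define G where "G = {f. \<exists>a w. w \<in> tests1 \<and> f = (rad a w :: real ^ 'n \<Rightarrow> real)}"
  have G: "(rad a w :: real ^ 'n \<Rightarrow> real) \<in> G" if "w \<in> tests1" for a w
    unfolding G_def using that by blast
  have "smooth (rad a w :: real ^ 'n \<Rightarrow> real)"
  proof (rule smooth_algD[of _ G])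
    show "rad a w \<in> smooth_alg G" by (intro smooth_alg.gen G assms)
  next
    fix g :: "real ^ 'n \<Rightarrow> real" and x i assume "g \<in> G"
    then obtain a w where g: "w \<in> tests1" "g = rad a w" unfolding G_def by blast
    show "g differentiable (at x)" unfolding g(2) by (rule differentiableI[OF has_derivative_rad[OF g(1)]])
    show "partial i g \<in> smooth_alg G" unfolding g(2) partial_rad[OF g(1)]
      by (rule smooth_alg.mult[OF smooth_alg.base[OF smooth_coord] smooth_alg.gen[OF G[OF tests1_neg_deriv[OF g(1)]]]])
  qed
  moreover from assms obtain R where R: "\<And>s. \<bar>s\<bar> > R \<Longrightarrow> w s = 0" by (auto simp: tests1_def)
  have "\<forall>x. rad a w (x::real ^ 'n) \<noteq> 0 \<longrightarrow> exp (- R) \<le> norm x \<and> norm x \<le> exp R"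
    using rad_support[of R w a, OF R] by blast
  moreover have "exp (- R) > 0" by simp
  ultimately show ?thesis unfolding test_functions_iff by blast
qed

lemma sum_coord_sq: "(\<Sum>i\<in>UNIV. x $ i * x $ i) = (norm (x::real ^ 'n::finite))\<^sup>2"
  by (simp add: power2_norm_eq_inner inner_vec_def)

text \<open>The gradient of a radial function is a field of this form, so this single computation
  yields both the radial Laplacian and the cross term in the comparison of Dirichlet
  integrals.\<close>

lemma divergence_rad:
  assumes "v \<in> tests1"
  shows "(\<Sum>i\<in>UNIV. partial i (\<lambda>x. x $ i * rad b v x) x) =
    rad b (\<lambda>s. (real CARD('n) - b) * v s - deriv v s) (x :: real ^ 'n::finite)"
proof -
  have "(\<Sum>i\<in>UNIV. partial i (\<lambda>x::real ^ 'n. x $ i * rad b v x) x) =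
    (\<Sum>i\<in>UNIV. (x $ i * x $ i) * rad (b + 2) (\<lambda>s. - (b * v s + deriv v s)) x + rad b v x)"
    by (simp add: partial_mult[OF smooth_coord test_functions_smooth[OF test_rad[OF assms]]]
        partial_coord partial_rad[OF assms] mult.assoc)
  also have "\<dots> = (norm x)\<^sup>2 * rad (b + 2) (\<lambda>s. - (b * v s + deriv v s)) x + real CARD('n) * rad b v x"
    by (simp only: sum.distrib sum_distrib_right[symmetric] sum_coord_sq) simp
  also have "\<dots> = rad b (\<lambda>s. (real CARD('n) - b) * v s - deriv v s) x"
    unfolding rad_mult_sq by (simp add: rad_def algebra_simps)
  finally show ?thesis .
qed

text \<open>The operator \<open>u'' + (n - 1) / r * u'\<close> applied to
  \<open>r powr (- a) * w (- ln r)\<close>, with the factor \<open>r powr (- a - 2)\<close> removed.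
  It has constant coefficients in \<open>s\<close>.\<close>

definition radial_laplacian :: "real \<Rightarrow> real \<Rightarrow> (real \<Rightarrow> real) \<Rightarrow> real \<Rightarrow> real" where
  "radial_laplacian n a w = (\<lambda>s. deriv (deriv w) s + (2 * a - n + 2) * deriv w s - a * (n - 2 - a) * w s)"

lemma tests1_radial_laplacian: "w \<in> tests1 \<Longrightarrow> radial_laplacian n a w \<in> tests1"
  unfolding radial_laplacian_def
  by (rule tests1_diff[OF tests1_add[OF tests1_deriv[OF tests1_deriv] tests1_cmult[OF tests1_deriv]] tests1_cmult])

lemma laplacian_rad:
  assumes w: "w \<in> tests1"
  shows "laplacian (rad a w) = (rad (a + 2) (radial_laplacian CARD('n) a w) :: real ^ 'n::finite \<Rightarrow> real)"
proof
  fix x :: "real ^ 'n"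
  let ?v = "\<lambda>s. - (a * w s + deriv w s)"
  have "deriv ?v s = - (a * deriv w s + deriv (deriv w) s)" for s
    by (rule DERIV_imp_deriv) (intro DERIV_minus DERIV_add DERIV_cmult smooth1_DERIV tests1_smooth1 tests1_deriv w)
  then have "(\<lambda>s. (real CARD('n) - (a + 2)) * ?v s - deriv ?v s) = radial_laplacian CARD('n) a w"
    by (auto simp: radial_laplacian_def algebra_simps)
  then show "laplacian (rad a w) x = rad (a + 2) (radial_laplacian CARD('n) a w) x"
    unfolding laplacian_def partial_rad[OF w] divergence_rad[OF tests1_neg_deriv[OF w]] by simp
qed

section \<open>Integration by parts\<close>

lemma lborel_integral_translate:
  fixes f :: "real ^ 'n::finite \<Rightarrow> real"
  assumes "f \<in> borel_measurable borel"
  shows "(LINT x|lborel. f (x + c)) = (LINT x|lborel. f x)"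
    and "integrable lborel (\<lambda>x. f (x + c)) \<longleftrightarrow> integrable lborel f"
proof -
  have d: "distr lborel borel (\<lambda>x. x + c) = (lborel :: (real ^ 'n) measure)"
  proof -
    have "(\<lambda>x. x + c) = (+) c" by (auto simp: add.commute)
    then show ?thesis using lborel_distr_plus[of c] by simp
  qed
  have m: "(\<lambda>x. x + c) \<in> measurable lborel (borel :: (real ^ 'n) measure)" by simp
  show "(LINT x|lborel. f (x + c)) = (LINT x|lborel. f x)"
    using integral_distr[OF m assms] unfolding d by simp
  show "integrable lborel (\<lambda>x. f (x + c)) \<longleftrightarrow> integrable lborel f"
    using integrable_distr_eq[OF m assms] unfolding d by simp
qed

text \<open>The integral of a translate does not depend on the translation. Differentiating this
  constant at \<open>t = 0\<close> along a coordinate axis gives the claim without slicing the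
  space. For \<open>\<bar>t\<bar> < 1\<close> the supports stay in the ball of radius
  \<open>R + 1\<close>, which provides the dominating function.\<close>

lemma test_integral_partial:
  fixes \<phi> :: "real ^ 'n::finite \<Rightarrow> real"
  assumes "\<phi> \<in> test_functions" shows "(LINT x|lborel. partial i \<phi> x) = 0"
proof -
  let ?e = "axis i 1 :: real ^ 'n"
  have tp: "partial i \<phi> \<in> test_functions" by (rule test_partial[OF assms])
  then obtain r R where R: "r > 0" "\<And>x. partial i \<phi> x \<noteq> 0 \<Longrightarrow> r \<le> norm x \<and> norm x \<le> R" by (rule test_functionsE) blast
  obtain B where B: "\<forall>x. \<bar>partial i \<phi> x\<bar> \<le> B" using test_bounded[OF tp] by blast
  have "((\<lambda>t. LINT x|lborel. \<phi> (x + t *\<^sub>R ?e)) has_real_derivative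
      (LINT x|lborel. partial i \<phi> (x + 0 *\<^sub>R ?e))) (at 0)"
  proof (rule has_derivative_integral_dominated[where e=1 and g="\<lambda>x. B * indicator (cball 0 (R+1)) x"])
    show "integrable lborel (\<lambda>x. \<phi> (x + t *\<^sub>R ?e))" for t
      by (subst lborel_integral_translate(2)) (use assms test_integrable in auto)
    show "((\<lambda>t. \<phi> (x + t *\<^sub>R ?e)) has_real_derivative partial i \<phi> (x + t *\<^sub>R ?e)) (at t)" for t x
    proof -
      have "((\<lambda>t. x + t *\<^sub>R ?e) has_derivative (\<lambda>h. h *\<^sub>R ?e)) (at t)" by (auto intro!: derivative_eq_intros)
      from diff_chain_at[OF this smooth_has_derivative[OF test_functions_smooth[OF assms]]]
      have D: "((\<lambda>t. \<phi> (x + t *\<^sub>R ?e)) has_derivative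
          (\<lambda>h. \<Sum>j\<in>UNIV. (h *\<^sub>R ?e) $ j * partial j \<phi> (x + t *\<^sub>R ?e))) (at t)"
        by (simp add: o_def)
      have "(\<lambda>h. \<Sum>j\<in>UNIV. (h *\<^sub>R ?e) $ j * partial j \<phi> y) = (*) (partial i \<phi> y)" for y
        by (rule ext) (simp add: axis_def if_distrib[of "\<lambda>z. z * _"] if_distrib[of "\<lambda>z. _ * z"] mult.commute cong: if_cong)
      with D show ?thesis by (simp only: has_field_derivative_def)
    qed
    show "\<bar>partial i \<phi> (x + t *\<^sub>R ?e)\<bar> \<le> B * indicator (cball 0 (R+1)) x" if "\<bar>t - 0\<bar> < 1" for t x
    proof (cases "partial i \<phi> (x + t *\<^sub>R ?e) = 0")
      case False
      have "norm x \<le> norm (x + t *\<^sub>R ?e) + norm (t *\<^sub>R ?e)" by (metis add_diff_cancel norm_triangle_ineq4)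
      moreover have "norm (t *\<^sub>R ?e) < 1" using that by simp
      ultimately have "x \<in> cball 0 (R+1)" using R(2)[OF False] by (auto simp: dist_norm)
      then show ?thesis using B by simp
    next
      case True
      have "B \<ge> 0" using B abs_ge_zero order_trans by blast
      with True show ?thesis by simp
    qed
    show "integrable lborel (\<lambda>x::real ^ 'n. B * indicator (cball 0 (R+1)) x)"
      using emeasure_lborel_cball_finite[of "0 :: real ^ 'n" "R+1"]
      by (intro integrable_mult_right integrable_real_indicator) simp_all
    show "(\<lambda>x. partial i \<phi> (x + 0 *\<^sub>R ?e)) \<in> borel_measurable lborel" using tp by simp
  qed simp
  moreover have "((\<lambda>t. LINT x|lborel. \<phi> (x + t *\<^sub>R ?e)) has_real_derivative 0) (at 0)"
    using assms by (simp add: lborel_integral_translate)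
  ultimately show ?thesis using DERIV_unique by fastforce
qed

lemma test_mult_integrable:
  "smooth g \<Longrightarrow> \<phi> \<in> test_functions \<Longrightarrow> integrable lborel (\<lambda>x. g x * \<phi> x)"
  "smooth g \<Longrightarrow> \<phi> \<in> test_functions \<Longrightarrow> integrable lborel (\<lambda>x. \<phi> x * g x)"
  using test_integrable[OF test_mult, of g \<phi>] by (simp_all add: mult.commute)

lemma test_parts:
  assumes g: "smooth g" and \<phi>: "\<phi> \<in> test_functions"
  shows "(LINT x|lborel. g x * partial i \<phi> x) = - (LINT x|lborel. partial i g x * \<phi> x)"
proof -
  have "0 = (LINT x|lborel. g x * partial i \<phi> x + partial i g x * \<phi> x)"
    using test_integral_partial[OF test_mult[OF g \<phi>], of i] partial_mult[OF g test_functions_smooth[OF \<phi>], of i] by simp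
  also have "\<dots> = (LINT x|lborel. g x * partial i \<phi> x) + (LINT x|lborel. partial i g x * \<phi> x)"
    by (intro Bochner_Integration.integral_add test_mult_integrable g smooth_partial[OF g] \<phi> test_partial[OF \<phi>])
  finally show ?thesis by simp
qed

lemma test_green:
  assumes \<phi>: "\<phi> \<in> test_functions" and \<psi>: "\<psi> \<in> test_functions"
  shows "(LINT x|lborel. \<phi> x * laplacian \<psi> x) = (LINT x|lborel. laplacian \<phi> x * \<psi> x)"
proof -
  note s = test_functions_smooth[OF \<phi>] test_functions_smooth[OF \<psi>]
  have "(LINT x|lborel. \<phi> x * laplacian \<psi> x) = (\<Sum>i\<in>UNIV. LINT x|lborel. \<phi> x * partial i (partial i \<psi>) x)"
    unfolding laplacian_def sum_distrib_left
    by (intro Bochner_Integration.integral_sum test_mult_integrable s test_partial \<psi>)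
  also have "\<dots> = (\<Sum>i\<in>UNIV. - (LINT x|lborel. partial i \<phi> x * partial i \<psi> x))"
    by (intro sum.cong refl test_parts s test_partial \<psi>)
  also have "\<dots> = (\<Sum>i\<in>UNIV. LINT x|lborel. partial i (partial i \<phi>) x * \<psi> x)"
    by (intro sum.cong refl) (simp add: test_parts[OF smooth_partial[OF s(1)] \<psi>])
  also have "\<dots> = (LINT x|lborel. laplacian \<phi> x * \<psi> x)"
    unfolding laplacian_def sum_distrib_right
    by (intro Bochner_Integration.integral_sum[symmetric] test_mult_integrable(1) smooth_partial s \<psi>)
  finally show ?thesis .
qed

definition gradsq :: "(real ^ 'n::finite \<Rightarrow> real) \<Rightarrow> real ^ 'n \<Rightarrow> real" where
  "gradsq \<phi> x = (\<Sum>i\<in>UNIV. (partial i \<phi> x)\<^sup>2)"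

lemma test_sq: "\<phi> \<in> test_functions \<Longrightarrow> (\<lambda>x. (\<phi> x)\<^sup>2) \<in> test_functions"
  unfolding power2_eq_square by (rule test_mult[OF test_functions_smooth])

lemma test_gradsq: "\<phi> \<in> test_functions \<Longrightarrow> gradsq \<phi> \<in> test_functions"
  unfolding gradsq_def by (intro test_sum test_sq test_partial)

section \<open>A Hardy-Rellich inequality\<close>

text \<open>Multiplying \<open>\<Delta>\<phi>\<close> by \<open>|x| powr (- \<alpha> - 2) * \<phi>\<close> and integrating by parts already gives a
  Hardy-Rellich inequality, with a constant that is not sharp but is positive for \<open>-2 < \<alpha> < n - 4\<close>.\<close>

lemma hardy_rellich_identity:
  fixes \<phi> :: "real ^ 'n::finite \<Rightarrow> real"
  assumes \<phi>: "\<phi> \<in> test_functions"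
  shows "(LINT x|lborel. norm x powr (- \<alpha> - 2) * gradsq \<phi> x
      + (\<alpha> + 2) * (real CARD('n) - 4 - \<alpha>) / 2 * (norm x powr (- \<alpha> - 4) * (\<phi> x)\<^sup>2)
      + norm x powr (- \<alpha> - 2) * (\<phi> x * laplacian \<phi> x)) = 0"
proof -
  note s = test_functions_smooth[OF \<phi>]
  let ?E = "\<lambda>x. \<Sum>i\<in>UNIV. x $ i * partial i \<phi> x"
  let ?F = "\<lambda>i x. norm x powr (- \<alpha> - 2) * (\<phi> x * partial i \<phi> x)"
  let ?H = "\<lambda>i x. norm x powr (- \<alpha> - 4) * (x $ i * (\<phi> x * \<phi> x))"
  have tF: "(\<lambda>x. \<phi> x * partial i \<phi> x) \<in> test_functions" for i by (rule test_mult[OF s test_partial[OF \<phi>]])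
  have tP: "(\<lambda>x. \<phi> x * \<phi> x) \<in> test_functions" by (rule test_mult[OF s \<phi>])
  have tH: "(\<lambda>x. x $ i * (\<phi> x * \<phi> x)) \<in> test_functions" for i by (rule test_mult[OF smooth_coord tP])
  have test: "partial i (?F i) \<in> test_functions" "partial i (?H i) \<in> test_functions" for i
    by (intro test_partial test_powr tF tH)+
  have 1: "(\<Sum>i\<in>UNIV. partial i (?F i) x) = norm x powr (- \<alpha> - 2) * gradsq \<phi> x
      + norm x powr (- \<alpha> - 2) * (\<phi> x * laplacian \<phi> x) - (\<alpha> + 2) * (norm x powr (- \<alpha> - 4) * \<phi> x * ?E x)" for x
  proof -
    have "(\<Sum>i\<in>UNIV. partial i (?F i) x) = (\<Sum>i\<in>UNIV. norm x powr (- \<alpha> - 2) * (partial i \<phi> x)\<^sup>2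
      + norm x powr (- \<alpha> - 2) * \<phi> x * partial i (partial i \<phi>) x - (\<alpha> + 2) * norm x powr (- \<alpha> - 4) * \<phi> x * (x $ i * partial i \<phi> x))"
      unfolding partial_powr_test[OF tF] partial_mult[OF s smooth_partial[OF s]]
      by (intro sum.cong refl) (simp add: algebra_simps power2_eq_square)
    then show ?thesis
      by (simp add: sum.distrib sum_subtractf sum_distrib_left[symmetric] gradsq_def laplacian_def mult.assoc)
  qed
  have 2: "(\<Sum>i\<in>UNIV. partial i (?H i) x) = (real CARD('n) - 4 - \<alpha>) * (norm x powr (- \<alpha> - 4) * (\<phi> x)\<^sup>2)
      + 2 * (norm x powr (- \<alpha> - 4) * \<phi> x * ?E x)" for x
  proof -
    have p: "partial i (?H i) x = norm x powr (- \<alpha> - 4) * (\<phi> x)\<^sup>2 + 2 * (norm x powr (- \<alpha> - 4) * \<phi> x) * (x $ i * partial i \<phi> x)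
       + (- \<alpha> - 4) * norm x powr (- \<alpha> - 6) * (\<phi> x)\<^sup>2 * (x $ i * x $ i)" for i
      unfolding partial_powr_test[OF tH] partial_mult[OF smooth_coord test_functions_smooth[OF tP]]
        partial_mult[OF s s] partial_coord
      by (simp add: power2_eq_square algebra_simps)
    have a: "(\<Sum>i\<in>UNIV. partial i (?H i) x) = real CARD('n) * (norm x powr (- \<alpha> - 4) * (\<phi> x)\<^sup>2)
        + 2 * (norm x powr (- \<alpha> - 4) * \<phi> x) * ?E x
       + (- \<alpha> - 4) * norm x powr (- \<alpha> - 6) * (\<phi> x)\<^sup>2 * (norm x)\<^sup>2"
      unfolding p by (simp only: sum.distrib sum_distrib_left[symmetric] sum_coord_sq) simp
    have b: "norm x powr (- \<alpha> - 6) * (norm x)\<^sup>2 = norm x powr (- \<alpha> - 4)"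
      by (subst norm_powr_mult_sq) (simp add: algebra_simps)
    have c: "(- \<alpha> - 4) * norm x powr (- \<alpha> - 6) * (\<phi> x)\<^sup>2 * (norm x)\<^sup>2
        = (- \<alpha> - 4) * (\<phi> x)\<^sup>2 * norm x powr (- \<alpha> - 4)"
      by (simp only: b[symmetric] mult_ac)
    show ?thesis unfolding a c by (simp add: algebra_simps)
  qed
  \<comment> \<open>The factor \<open>(\<alpha> + 2) / 2\<close> is chosen so that the first order
    terms \<open>?E\<close> in the two divergences cancel.\<close>
  have "(LINT x|lborel. (\<Sum>i\<in>UNIV. partial i (?F i) x) + (\<alpha> + 2) / 2 * (\<Sum>i\<in>UNIV. partial i (?H i) x)) = 0"
  proof -
    have "(LINT x|lborel. (\<Sum>i\<in>UNIV. partial i (?F i) x)) = 0" "(LINT x|lborel. (\<Sum>i\<in>UNIV. partial i (?H i) x)) = 0"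
      by (simp_all add: test_integrable[OF test(1)] test_integrable[OF test(2)]
          test_integral_partial[OF test_powr[OF tF]] test_integral_partial[OF test_powr[OF tH]])
    moreover have "integrable lborel (\<lambda>x. \<Sum>i\<in>UNIV. partial i (?F i) x)" "integrable lborel (\<lambda>x. \<Sum>i\<in>UNIV. partial i (?H i) x)"
      by (intro test_integrable test_sum test)+
    ultimately show ?thesis by simp
  qed
  moreover have "g + X - (\<alpha> + 2) * e + (\<alpha> + 2) / 2 * ((real CARD('n) - 4 - \<alpha>) * z + 2 * e) =
      g + (\<alpha> + 2) * (real CARD('n) - 4 - \<alpha>) / 2 * z + X" for g X e z :: real
    by (simp add: field_simps)
  ultimately show ?thesis unfolding 1 2 by (simp only:)
qed

text \<open>The indefinite term of the identity is absorbed by completing a square. The weights are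
  distributed evenly over the factors \<open>A\<close> and \<open>B\<close>, and the square of
  \<open>c * A + B\<close> uses up only half of the Hardy term; the other half and the gradient term
  are both retained, because each is needed to control Cauchy sequences.\<close>

lemma hardy_rellich:
  fixes \<phi> :: "real ^ 'n::finite \<Rightarrow> real"
  assumes \<phi>: "\<phi> \<in> test_functions"
    and c: "c = (\<alpha> + 2) * (real CARD('n) - 4 - \<alpha>) / 2" "c > 0"
  shows "(LINT x|lborel. norm x powr (- \<alpha> - 2) * gradsq \<phi> x) + c / 2 * (LINT x|lborel. norm x powr (- \<alpha> - 4) * (\<phi> x)\<^sup>2)
     \<le> 1 / (2 * c) * (LINT x|lborel. norm x powr (- \<alpha>) * (laplacian \<phi> x)\<^sup>2)"
proof -
  let ?G = "\<lambda>x. norm x powr (- \<alpha> - 2) * gradsq \<phi> x"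
  let ?Z = "\<lambda>x. norm x powr (- \<alpha> - 4) * (\<phi> x)\<^sup>2"
  let ?X = "\<lambda>x. norm x powr (- \<alpha> - 2) * (\<phi> x * laplacian \<phi> x)"
  let ?L = "\<lambda>x. norm x powr (- \<alpha>) * (laplacian \<phi> x)\<^sup>2"
  have G: "integrable lborel ?G" by (intro test_integrable test_powr test_gradsq \<phi>)
  have Z: "integrable lborel ?Z" by (intro test_integrable test_powr test_sq \<phi>)
  have X: "integrable lborel ?X" by (intro test_integrable test_powr test_mult[OF test_functions_smooth[OF \<phi>]] test_laplacian \<phi>)
  have L: "integrable lborel ?L" by (intro test_integrable test_powr test_sq test_laplacian \<phi>)
  have "(LINT x|lborel. ?G x + c / 2 * ?Z x - 1 / (2 * c) * ?L x) \<le> (LINT x|lborel. ?G x + c * ?Z x + ?X x)"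
  proof (rule integral_mono)
    fix x :: "real ^ 'n"
    define A where "A = norm x powr (- \<alpha> / 2 - 2) * \<phi> x"
    define B where "B = norm x powr (- \<alpha> / 2) * laplacian \<phi> x"
    have e: "?X x = A * B" "?Z x = A\<^sup>2" "?L x = B\<^sup>2"
    proof -
      have "norm x powr (- \<alpha> - 2) = norm x powr (- \<alpha> / 2 - 2) * norm x powr (- \<alpha> / 2)"
        "norm x powr (- \<alpha> - 4) = norm x powr (- \<alpha> / 2 - 2) * norm x powr (- \<alpha> / 2 - 2)"
        "norm x powr (- \<alpha>) = norm x powr (- \<alpha> / 2) * norm x powr (- \<alpha> / 2)"
        by (simp_all add: powr_add[symmetric])
      then show "?X x = A * B" "?Z x = A\<^sup>2" "?L x = B\<^sup>2"
        by (simp_all add: A_def B_def power2_eq_square mult_ac)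
    qed
    have "0 \<le> (c * A + B)\<^sup>2 / (2 * c)" using c by simp
    also have "(c * A + B)\<^sup>2 / (2 * c) = c / 2 * A\<^sup>2 + A * B + 1 / (2 * c) * B\<^sup>2"
      using c(2) by (simp add: power2_eq_square field_simps)
    finally show "?G x + c / 2 * ?Z x - 1 / (2 * c) * ?L x \<le> ?G x + c * ?Z x + ?X x"
      unfolding e by simp
  qed (use G Z X L in simp_all)
  also have "\<dots> = 0" using hardy_rellich_identity[OF \<phi>, of \<alpha>] unfolding c(1) .
  finally show ?thesis using G Z L by simp
qed

section \<open>Polar coordinates\<close>

lemma cball_borel [measurable]: "cball (c :: real ^ 'n::finite) r \<in> sets borel"
  by (intro borel_closed closed_cball)

text \<open>Polar coordinates are \<open>x = exp (- s) *\<^sub>R \<omega>\<close>, so that \<open>s = - ln (norm x)\<close>. Instead of a measure on the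
  unit sphere we use \<open>n\<close> times the Lebesgue measure of the unit ball and take \<open>\<omega> = sgn x\<close>, which induces
  the surface measure.\<close>

definition cone_measure :: "(real ^ 'n::finite) measure" where
  "cone_measure = density lborel (\<lambda>x. ennreal (real CARD('n)) * indicator (cball 0 1) x)"

lemma sets_cone_measure [measurable_cong, simp]: "sets cone_measure = sets borel"
  and space_cone_measure [simp]: "space cone_measure = UNIV"
  by (simp_all add: cone_measure_def)

definition sphere_area :: "'n::finite itself \<Rightarrow> real" where
  "sphere_area _ = measure (cone_measure :: (real ^ 'n) measure) UNIV"

lemma emeasure_cone_measure:
  "emeasure (cone_measure :: (real ^ 'n::finite) measure) UNIV
     = ennreal (real CARD('n)) * emeasure lborel (cball 0 1 :: (real ^ 'n) set)"
  unfolding cone_measure_def by (subst emeasure_density) (simp_all add: nn_integral_cmult)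

lemma finite_cone_measure: "finite_measure (cone_measure :: (real ^ 'n::finite) measure)"
proof (rule finite_measureI)
  show "emeasure (cone_measure :: (real ^ 'n) measure) (space cone_measure) \<noteq> \<infinity>"
    using emeasure_lborel_cball_finite[of "0 :: real ^ 'n" 1]
    by (simp add: emeasure_cone_measure ennreal_mult_eq_top_iff less_top[symmetric])
qed

interpretation cone: finite_measure "cone_measure :: (real ^ 'n::finite) measure"
  by (rule finite_cone_measure)

lemma sphere_area_pos: "sphere_area TYPE('n::finite) > 0"
proof -
  have "emeasure lborel (cball 0 1 :: (real ^ 'n) set) \<noteq> 0"
    using content_cball_pos[of 1 "0 :: real ^ 'n"] by (auto simp: measure_def)
  then have "emeasure (cone_measure :: (real ^ 'n) measure) UNIV \<noteq> 0"
    by (simp add: emeasure_cone_measure)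
  then show ?thesis unfolding sphere_area_def
    by (simp add: cone.emeasure_eq_measure zero_less_measure_iff)
qed

lemma emeasure_cone_UNIV: "emeasure (cone_measure :: (real ^ 'n::finite) measure) UNIV = ennreal (sphere_area TYPE('n))"
  unfolding sphere_area_def by (rule cone.emeasure_eq_measure)

lemma AE_cone_nonzero: "AE x in (cone_measure :: (real ^ 'n::finite) measure). x \<noteq> 0"
proof -
  have "AE x in (lborel :: (real ^ 'n) measure). x \<noteq> 0"
    by (rule AE_lborel_singleton)
  then show ?thesis unfolding cone_measure_def
    by (subst AE_density) auto
qed

lemma nn_integral_lborel_scale:
  fixes f :: "real ^ 'n::finite \<Rightarrow> ennreal"
  assumes [measurable]: "f \<in> borel_measurable borel" and c: "c > 0"
  shows "(\<integral>\<^sup>+x. f x \<partial>lborel) = ennreal (c ^ CARD('n)) * (\<integral>\<^sup>+x. f (c *\<^sub>R x) \<partial>lborel)"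
proof -
  have "lborel = density (distr lborel borel (\<lambda>x::real ^ 'n. 0 + c *\<^sub>R x)) (\<lambda>_. ennreal (\<bar>c\<bar> ^ DIM(real ^ 'n)))"
    by (rule lborel_affine) (use c in simp)
  then have "(\<integral>\<^sup>+x. f x \<partial>lborel) = (\<integral>\<^sup>+x. f x \<partial>density (distr lborel borel (\<lambda>x::real ^ 'n. 0 + c *\<^sub>R x)) (\<lambda>_. ennreal (\<bar>c\<bar> ^ DIM(real ^ 'n))))"
    by simp
  also have "\<dots> = ennreal (c ^ CARD('n)) * (\<integral>\<^sup>+x. f (c *\<^sub>R x) \<partial>lborel)"
    using c by (simp add: nn_integral_density nn_integral_distr nn_integral_cmult)
  finally show ?thesis .
qed

lemma nn_integral_exp_Iic:
  assumes n: "n > (0::real)"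
  shows "(\<integral>\<^sup>+t. ennreal (exp (n * t)) * indicator {..T} t \<partial>lborel) = ennreal (exp (n * T) / n)"
proof -
  have "(\<integral>\<^sup>+t. ennreal (exp (n * t)) * indicator {..T} t \<partial>lborel) =
    (\<integral>\<^sup>+t. ennreal (exp (- n * t)) * indicator {- T..} t \<partial>lborel)"
    by (subst nn_integral_real_affine[where c="-1" and t=0])
      (auto intro!: nn_integral_cong simp: indicator_def)
  also have "\<dots> = ennreal (0 - (- (exp (- n * (- T)) / n)))"
  proof (rule nn_integral_FTC_atLeast)
    show "((\<lambda>t. - (exp (- n * t) / n)) has_real_derivative exp (- n * x)) (at x)" for x
      using n by (auto intro!: derivative_eq_intros)
    have "((\<lambda>t. - (exp (- (n * t)) / n)) \<longlongrightarrow> - (0 / n)) at_top"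
      by (intro tendsto_intros filterlim_compose[OF exp_at_bot] filterlim_compose[OF filterlim_uminus_at_bot_at_top]
          filterlim_tendsto_pos_mult_at_top[OF tendsto_const n filterlim_ident]) (use n in simp)
    then show "((\<lambda>t. - (exp (- n * t) / n)) \<longlongrightarrow> 0) at_top" by simp
  qed auto
  finally show ?thesis by simp
qed

lemma borel_measurable_sgn_vec [measurable]: "sgn \<in> borel_measurable (borel :: (real ^ 'n::finite) measure)"
proof -
  have "(\<lambda>x::real ^ 'n. sgn x) \<in> borel_measurable borel" unfolding sgn_div_norm by measurable
  then show ?thesis by simp
qed

text \<open>For fixed \<open>x\<close> the shift of \<open>s\<close> by \<open>ln (norm x)\<close>
  turns \<open>sgn x\<close> into \<open>x\<close>. For fixed \<open>s\<close> the scaling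
  \<open>x = exp s *\<^sub>R y\<close> then removes the factor \<open>exp (- s)\<close> inside
  \<open>F\<close> and turns the condition that \<open>x\<close> is in the unit ball into
  \<open>s \<le> - ln (norm y)\<close>. What is left in \<open>s\<close> is the integral of
  \<open>n * exp (n * s)\<close> over this half-line, which cancels
  \<open>norm y ^ n\<close>.\<close>

lemma polar_nn_integral:
  fixes F :: "real ^ 'n::finite \<Rightarrow> ennreal"
  assumes [measurable]: "F \<in> borel_measurable borel"
  shows "(\<integral>\<^sup>+x. F x \<partial>lborel) =
    (\<integral>\<^sup>+s. \<integral>\<^sup>+x. ennreal (exp (- real CARD('n) * s)) * F (exp (- s) *\<^sub>R sgn x) \<partial>cone_measure \<partial>lborel)"
proof -
  define n where "n = real CARD('n)"
  have n: "n > 0" by (simp add: n_def)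
  let ?I = "indicator (cball 0 1) :: real ^ 'n \<Rightarrow> ennreal"
  have pw: "exp (n * t) = exp t ^ CARD('n)" for t by (simp add: n_def exp_of_nat_mult)
  have "(\<integral>\<^sup>+s. \<integral>\<^sup>+x. ennreal (exp (- n * s)) * F (exp (- s) *\<^sub>R sgn x) \<partial>cone_measure \<partial>lborel)
    = (\<integral>\<^sup>+s. \<integral>\<^sup>+x. ennreal n * ?I x * (ennreal (exp (- n * s)) * F (exp (- s) *\<^sub>R sgn x)) \<partial>lborel \<partial>lborel)"
    unfolding cone_measure_def n_def by (subst nn_integral_density) measurable
  also have "\<dots> = (\<integral>\<^sup>+x. \<integral>\<^sup>+s. ennreal n * ?I x * (ennreal (exp (- n * s)) * F (exp (- s) *\<^sub>R sgn x)) \<partial>lborel \<partial>lborel)"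
    by (rule lborel_pair.Fubini') measurable
  also have "\<dots> = (\<integral>\<^sup>+x. \<integral>\<^sup>+s. ennreal n * ?I x * (ennreal (exp (- n * s) * norm x ^ CARD('n)) * F (exp (- s) *\<^sub>R x)) \<partial>lborel \<partial>lborel)"
  proof (rule nn_integral_cong_AE, rule AE_mp[OF AE_lborel_singleton[of 0]], rule AE_I2, rule impI)
    fix x :: "real ^ 'n" assume x: "x \<noteq> 0"
    have "exp (- n * (s - ln (norm x))) = exp (- n * s) * norm x ^ CARD('n)" for s
    proof -
      have "exp (- n * (s - ln (norm x))) = exp (- n * s) * exp (n * ln (norm x))"
        by (simp add: exp_add[symmetric] algebra_simps)
      then show ?thesis unfolding pw using x by simp
    qed
    moreover have "exp (- (s - ln (norm x))) *\<^sub>R sgn x = exp (- s) *\<^sub>R x" for s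
      using x by (simp add: exp_diff exp_minus sgn_div_norm field_simps)
    ultimately show "(\<integral>\<^sup>+s. ennreal n * ?I x * (ennreal (exp (- n * s)) * F (exp (- s) *\<^sub>R sgn x)) \<partial>lborel)
      = (\<integral>\<^sup>+s. ennreal n * ?I x * (ennreal (exp (- n * s) * norm x ^ CARD('n)) * F (exp (- s) *\<^sub>R x)) \<partial>lborel)"
      by (subst nn_integral_real_affine[where c=1 and t="- ln (norm x)"]) simp_all
  qed
  also have "\<dots> = (\<integral>\<^sup>+s. \<integral>\<^sup>+x. ennreal n * ?I x * (ennreal (exp (- n * s) * norm x ^ CARD('n)) * F (exp (- s) *\<^sub>R x)) \<partial>lborel \<partial>lborel)"
    by (rule lborel_pair.Fubini'[symmetric]) measurable
  also have "\<dots> = (\<integral>\<^sup>+s. \<integral>\<^sup>+y. ennreal (exp (n * s)) * (ennreal n * indicator {..- ln (norm y)} s * (ennreal (norm y ^ CARD('n)) * F y)) \<partial>lborel \<partial>lborel)"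
  proof (rule nn_integral_cong)
    fix s :: real
    let ?g = "\<lambda>x::real ^ 'n. ennreal n * ?I x * (ennreal (exp (- n * s) * norm x ^ CARD('n)) * F (exp (- s) *\<^sub>R x))"
    have "(\<integral>\<^sup>+x. ?g x \<partial>lborel) = ennreal (exp s ^ CARD('n)) * (\<integral>\<^sup>+x. ?g (exp s *\<^sub>R x) \<partial>lborel)"
      by (rule nn_integral_lborel_scale) simp_all
    also have "\<dots> = (\<integral>\<^sup>+x. ennreal (exp (n * s)) * ?g (exp s *\<^sub>R x) \<partial>lborel)"
      unfolding pw by (simp add: nn_integral_cmult)
    also have "\<dots> = (\<integral>\<^sup>+y. ennreal (exp (n * s)) * (ennreal n * indicator {..- ln (norm y)} s * (ennreal (norm y ^ CARD('n)) * F y)) \<partial>lborel)"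
    proof (rule nn_integral_cong_AE, rule AE_mp[OF AE_lborel_singleton[of 0]], rule AE_I2, rule impI)
      fix y :: "real ^ 'n" assume y: "y \<noteq> 0"
      have 1: "?I (exp s *\<^sub>R y) = indicator {..- ln (norm y)} s"
      proof -
        have "exp s * norm y \<le> 1 \<longleftrightarrow> exp (s + ln (norm y)) \<le> exp 0" using y by (simp add: exp_add)
        also have "\<dots> \<longleftrightarrow> s \<le> - ln (norm y)" unfolding exp_le_cancel_iff by linarith
        finally show ?thesis by (simp add: indicator_def)
      qed
      have 2: "exp (- n * s) * norm (exp s *\<^sub>R y) ^ CARD('n) = norm y ^ CARD('n)"
        using pw[of "-s"] by (simp add: power_mult_distrib[symmetric] exp_minus mult.assoc[symmetric])
      have 3: "exp (- s) *\<^sub>R exp s *\<^sub>R y = y" by (simp add: exp_minus)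
      show "ennreal (exp (n * s)) * ?g (exp s *\<^sub>R y) =
        ennreal (exp (n * s)) * (ennreal n * indicator {..- ln (norm y)} s * (ennreal (norm y ^ CARD('n)) * F y))"
        unfolding 1 2 3 ..
    qed
    finally show "(\<integral>\<^sup>+x. ?g x \<partial>lborel) = (\<integral>\<^sup>+y. ennreal (exp (n * s)) * (ennreal n * indicator {..- ln (norm y)} s * (ennreal (norm y ^ CARD('n)) * F y)) \<partial>lborel)" .
  qed
  also have "\<dots> = (\<integral>\<^sup>+y. \<integral>\<^sup>+s. ennreal (exp (n * s)) * (ennreal n * indicator {..- ln (norm y)} s * (ennreal (norm y ^ CARD('n)) * F y)) \<partial>lborel \<partial>lborel)"
    by (rule lborel_pair.Fubini') (auto simp: indicator_def atMost_def)
  also have "\<dots> = (\<integral>\<^sup>+y. F y \<partial>lborel)"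
  proof (rule nn_integral_cong_AE, rule AE_mp[OF AE_lborel_singleton[of 0]], rule AE_I2, rule impI)
    fix y :: "real ^ 'n" assume y: "y \<noteq> 0"
    have "(\<integral>\<^sup>+s. ennreal (exp (n * s)) * (ennreal n * indicator {..- ln (norm y)} s * (ennreal (norm y ^ CARD('n)) * F y)) \<partial>lborel)
      = (\<integral>\<^sup>+s. (ennreal n * (ennreal (norm y ^ CARD('n)) * F y)) * (ennreal (exp (n * s)) * indicator {..- ln (norm y)} s) \<partial>lborel)"
      by (simp add: mult_ac)
    also have "\<dots> = (ennreal n * (ennreal (norm y ^ CARD('n)) * F y)) * ennreal (exp (n * (- ln (norm y))) / n)"
      by (simp add: nn_integral_cmult nn_integral_exp_Iic[OF n])
    also have "exp (n * (- ln (norm y))) / n = 1 / (n * norm y ^ CARD('n))"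
      unfolding pw using y by (simp add: exp_minus field_simps)
    also have "(ennreal n * (ennreal (norm y ^ CARD('n)) * F y)) * ennreal (1 / (n * norm y ^ CARD('n))) =
      ennreal (n * norm y ^ CARD('n) * (1 / (n * norm y ^ CARD('n)))) * F y"
    proof -
      have "ennreal (a * b * c) * d = ennreal a * (ennreal b * d) * ennreal c"
        if "a \<ge> 0" "b \<ge> 0" "c \<ge> 0" for a b c d
        using that by (simp add: ennreal_mult mult_ac)
      from this[of n "norm y ^ CARD('n)" "1 / (n * norm y ^ CARD('n))" "F y"] n show ?thesis by simp
    qed
    also have "n * norm y ^ CARD('n) * (1 / (n * norm y ^ CARD('n))) = 1" using n y by simp
    finally show "(\<integral>\<^sup>+s. ennreal (exp (n * s)) * (ennreal n * indicator {..- ln (norm y)} s * (ennreal (norm y ^ CARD('n)) * F y)) \<partial>lborel) = F y"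
      by simp
  qed
  finally show ?thesis by (simp add: n_def)
qed

text \<open>With Lebesgue measure written as an image measure, the formula for nonnegative functions
  extends to signed integrals and to null sets by general transfer rules.\<close>

definition polar_measure :: "(real \<times> (real ^ 'n::finite)) measure" where
  "polar_measure = density (lborel \<Otimes>\<^sub>M cone_measure) (\<lambda>p. ennreal (exp (- real CARD('n) * fst p)))"

definition polar_map :: "real \<times> (real ^ 'n::finite) \<Rightarrow> real ^ 'n" where
  "polar_map p = exp (- fst p) *\<^sub>R sgn (snd p)"

lemma polar_map_measurable [measurable]: "polar_map \<in> borel_measurable (lborel \<Otimes>\<^sub>M cone_measure)"
  unfolding polar_map_def by measurable

lemma lborel_eq_polar: "lborel = distr (polar_measure :: (real \<times> (real ^ 'n::finite)) measure) borel polar_map"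
proof (rule measure_eqI)
  fix A :: "(real ^ 'n) set" assume "A \<in> sets lborel"
  then have [measurable]: "A \<in> sets borel" by simp
  have m: "polar_map \<in> borel_measurable (polar_measure :: (real \<times> (real ^ 'n)) measure)"
    unfolding polar_measure_def by simp
  have "emeasure (distr polar_measure borel polar_map) A = (\<integral>\<^sup>+x. indicator A x \<partial>distr (polar_measure :: (real \<times> (real ^ 'n)) measure) borel polar_map)"
    by simp
  also have "\<dots> = (\<integral>\<^sup>+p. indicator A (polar_map p) \<partial>(polar_measure :: (real \<times> (real ^ 'n)) measure))"
    by (rule nn_integral_distr[OF m]) simp
  also have "\<dots> = (\<integral>\<^sup>+p. ennreal (exp (- real CARD('n) * fst p)) * indicator A (polar_map p) \<partial>(lborel \<Otimes>\<^sub>M (cone_measure :: (real ^ 'n) measure)))"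
    unfolding polar_measure_def by (rule nn_integral_density) measurable
  also have "\<dots> = (\<integral>\<^sup>+s. \<integral>\<^sup>+x. ennreal (exp (- real CARD('n) * s)) * indicator A (exp (- s) *\<^sub>R sgn x) \<partial>(cone_measure :: (real ^ 'n) measure) \<partial>lborel)"
    by (subst cone.nn_integral_fst[symmetric]) (simp_all add: polar_map_def)
  also have "\<dots> = (\<integral>\<^sup>+x. indicator A x \<partial>lborel)"
    by (rule polar_nn_integral[symmetric]) simp
  finally show "emeasure lborel A = emeasure (distr (polar_measure :: (real \<times> (real ^ 'n)) measure) borel polar_map) A" by simp
qed simp

lemma polar_integral:
  fixes F :: "real ^ 'n::finite \<Rightarrow> real"
  assumes F: "integrable lborel F"
  shows "(LINT x|lborel. F x) = (LINT s|lborel. exp (- real CARD('n) * s) * (LINT x|cone_measure. F (exp (- s) *\<^sub>R sgn x)))"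
proof -
  interpret pair_sigma_finite "lborel :: real measure" "cone_measure :: (real ^ 'n) measure" ..
  have [measurable]: "F \<in> borel_measurable borel" using F by simp
  let ?d = "\<lambda>p::real \<times> (real ^ 'n). exp (- real CARD('n) * fst p)"
  have m: "polar_map \<in> measurable (polar_measure :: (real \<times> (real ^ 'n)) measure) borel"
    unfolding polar_measure_def by simp
  have "integrable (polar_measure :: (real \<times> (real ^ 'n)) measure) (\<lambda>p. F (polar_map p))"
    using F unfolding lborel_eq_polar by (subst (asm) integrable_distr_eq[OF m]) simp_all
  then have i: "integrable (lborel \<Otimes>\<^sub>M (cone_measure :: (real ^ 'n) measure)) (\<lambda>p. ?d p * F (polar_map p))"
    unfolding polar_measure_def by (subst (asm) integrable_density) simp_all
  have "(LINT x|lborel. F x) = (LINT p|(polar_measure :: (real \<times> (real ^ 'n)) measure). F (polar_map p))"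
    unfolding lborel_eq_polar by (rule integral_distr[OF m]) simp
  also have "\<dots> = (LINT p|(lborel \<Otimes>\<^sub>M (cone_measure :: (real ^ 'n) measure)). ?d p * F (polar_map p))"
    unfolding polar_measure_def by (subst integral_density) simp_all
  also have "\<dots> = (LINT s|lborel. (LINT x|cone_measure. ?d (s, x) * F (polar_map (s, x))))"
    using integral_fst'[OF i] by simp
  finally show ?thesis by (simp add: polar_map_def)
qed

text \<open>The order of the quantifiers matters: almost every direction comes first, so that a
  single good ray can be selected later. This is why the product measure is swapped in the
  proof.\<close>

lemma polar_AE:
  fixes P :: "real ^ 'n::finite \<Rightarrow> bool"
  assumes P: "AE x in lborel. P x"
  shows "AE x in cone_measure. AE s in lborel. P (exp (- s) *\<^sub>R sgn x)"
proof -
  interpret pair_sigma_finite "lborel :: real measure" "cone_measure :: (real ^ 'n) measure" ..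
  interpret Q: pair_sigma_finite "cone_measure :: (real ^ 'n) measure" "lborel :: real measure" ..
  obtain N where N: "N \<in> sets lborel" "emeasure lborel N = 0" "{x. \<not> P x} \<subseteq> N"
    using P by (auto elim!: AE_E)
  have [measurable]: "N \<in> sets borel" using N by simp
  have m: "polar_map \<in> measurable (polar_measure :: (real \<times> (real ^ 'n)) measure) borel"
    unfolding polar_measure_def by simp
  have S: "{p \<in> space (lborel \<Otimes>\<^sub>M (cone_measure :: (real ^ 'n) measure)). polar_map p \<notin> N}
      \<in> sets (lborel \<Otimes>\<^sub>M (cone_measure :: (real ^ 'n) measure))"
  proof -
    have "polar_map -` (- N) \<inter> space (lborel \<Otimes>\<^sub>M (cone_measure :: (real ^ 'n) measure))
      \<in> sets (lborel \<Otimes>\<^sub>M (cone_measure :: (real ^ 'n) measure))"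
      by (rule measurable_sets[OF polar_map_measurable]) simp
    moreover have "polar_map -` (- N) \<inter> space (lborel \<Otimes>\<^sub>M (cone_measure :: (real ^ 'n) measure))
      = {p \<in> space (lborel \<Otimes>\<^sub>M (cone_measure :: (real ^ 'n) measure)). polar_map p \<notin> N}" by blast
    ultimately show ?thesis by (simp only:)
  qed
  have "AE x in distr (polar_measure :: (real \<times> (real ^ 'n)) measure) borel polar_map. x \<notin> N"
    unfolding lborel_eq_polar[symmetric] using N by (intro AE_not_in) (simp add: null_sets_def)
  then have "AE p in (polar_measure :: (real \<times> (real ^ 'n)) measure). polar_map p \<notin> N"
    by (subst (asm) AE_distr_iff[OF m]) simp_all
  then have "AE p in (lborel \<Otimes>\<^sub>M (cone_measure :: (real ^ 'n) measure)). polar_map p \<notin> N"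
    unfolding polar_measure_def by (subst (asm) AE_density) simp_all
  then have "AE p in distr (cone_measure \<Otimes>\<^sub>M lborel) (lborel \<Otimes>\<^sub>M (cone_measure :: (real ^ 'n) measure)) (\<lambda>(x, y). (y, x)). polar_map p \<notin> N"
    unfolding distr_pair_swap[symmetric] .
  then have "AE p in ((cone_measure :: (real ^ 'n) measure) \<Otimes>\<^sub>M lborel). polar_map (snd p, fst p) \<notin> N"
    by (subst (asm) AE_distr_iff) (use S in \<open>simp_all add: case_prod_beta'\<close>)
  then have "AE x in (cone_measure :: (real ^ 'n) measure). AE s in lborel. polar_map (s, x) \<notin> N"
    using Q.AE_pair by fastforce
  then show ?thesis
  proof eventually_elim
    case (elim x)
    then show ?case by (rule eventually_mono) (use N(3) in \<open>auto simp: polar_map_def\<close>)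
  qed
qed

lemma norm_polar:
  fixes x :: "real ^ 'n::finite"
  assumes "x \<noteq> 0" shows "norm (exp (- s) *\<^sub>R sgn x) = exp (- s)" "- ln (norm (exp (- s) *\<^sub>R sgn x)) = s"
  using assms by (simp_all add: norm_sgn)

lemma AE_radial:
  assumes P: "AE s in lborel. P s"
  shows "AE x in (lborel :: (real ^ 'n::finite) measure). P (- ln (norm x))"
proof -
  obtain N where N: "N \<in> sets lborel" "emeasure lborel N = 0" "{x. \<not> P x} \<subseteq> N"
    using P by (auto elim!: AE_E)
  have [measurable]: "N \<in> sets borel" using N by simp
  have "(\<integral>\<^sup>+x. indicator N (- ln (norm x)) \<partial>(lborel :: (real ^ 'n) measure)) =
    (\<integral>\<^sup>+s. \<integral>\<^sup>+x. ennreal (exp (- real CARD('n) * s)) * indicator N (- ln (norm (exp (- s) *\<^sub>R sgn x))) \<partial>(cone_measure :: (real ^ 'n) measure) \<partial>lborel)"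
    by (rule polar_nn_integral) simp
  also have "\<dots> = (\<integral>\<^sup>+s. \<integral>\<^sup>+x. ennreal (exp (- real CARD('n) * s)) * indicator N s \<partial>(cone_measure :: (real ^ 'n) measure) \<partial>lborel)"
    by (rule nn_integral_cong, rule nn_integral_cong_AE, rule AE_mp[OF AE_cone_nonzero], rule AE_I2)
      (simp add: norm_sgn)
  also have "\<dots> = (\<integral>\<^sup>+s. 0 \<partial>(lborel :: real measure))"
  proof (rule nn_integral_cong_AE)
    have "AE s in lborel. s \<notin> N" using N by (intro AE_not_in) (simp add: null_sets_def)
    then show "AE s in lborel. (\<integral>\<^sup>+x. ennreal (exp (- real CARD('n) * s)) * indicator N s \<partial>(cone_measure :: (real ^ 'n) measure)) = 0"
      by eventually_elim simp
  qed
  also have "\<dots> = 0" by simp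
  finally have "AE x in (lborel :: (real ^ 'n) measure). indicator N (- ln (norm x)) = (0::ennreal)"
    by (subst (asm) nn_integral_0_iff_AE) simp_all
  then show ?thesis
    by eventually_elim (use N(3) in \<open>auto simp: indicator_def split: if_splits\<close>)
qed

section \<open>Spherical means\<close>

definition spherical_mean :: "(real ^ 'n::finite \<Rightarrow> real) \<Rightarrow> real \<Rightarrow> real" where
  "spherical_mean \<phi> s = (LINT x|cone_measure. \<phi> (exp (- s) *\<^sub>R sgn x)) / sphere_area TYPE('n)"

text \<open>The derivative of a function along rays: \<open>- euler \<phi>\<close> is the derivative
  of \<open>\<phi> (exp (- s) *\<^sub>R sgn x)\<close> with respect to \<open>s\<close>, evaluated
  at that point.\<close>

definition euler :: "(real ^ 'n::finite \<Rightarrow> real) \<Rightarrow> real ^ 'n \<Rightarrow> real" where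
  "euler \<phi> x = (\<Sum>i\<in>UNIV. x $ i * partial i \<phi> x)"

lemma test_euler: "\<phi> \<in> test_functions \<Longrightarrow> euler \<phi> \<in> test_functions"
  unfolding euler_def by (intro test_sum test_mult test_partial smooth_coord)

lemma test_cone_integrable:
  assumes "\<phi> \<in> test_functions"
  shows "integrable cone_measure (\<lambda>x. \<phi> (c *\<^sub>R sgn x))"
proof -
  obtain B where B: "\<forall>x. \<bar>\<phi> x\<bar> \<le> B" using test_bounded[OF assms] by blast
  have "\<phi> \<in> borel_measurable borel" using assms by simp
  then have "(\<lambda>x. \<phi> (c *\<^sub>R sgn x)) \<in> borel_measurable borel" by simp
  then show ?thesis by (intro cone.integrable_const_bound[of _ B]) (use B in simp_all)
qed

lemma spherical_mean_DERIV:
  fixes \<phi> :: "real ^ 'n::finite \<Rightarrow> real"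
  assumes \<phi>: "\<phi> \<in> test_functions"
  shows "(spherical_mean \<phi> has_real_derivative spherical_mean (\<lambda>x. - euler \<phi> x) s) (at s)"
proof -
  have te: "euler \<phi> \<in> test_functions" by (rule test_euler[OF \<phi>])
  obtain B where B: "\<forall>x. \<bar>euler \<phi> x\<bar> \<le> B" using test_bounded[OF te] by blast
  have "((\<lambda>s. LINT x|cone_measure. \<phi> (exp (- s) *\<^sub>R sgn x)) has_real_derivative
      (LINT x|cone_measure. - euler \<phi> (exp (- s) *\<^sub>R sgn x))) (at s)"
  proof (rule has_derivative_integral_dominated[where e=1 and g="\<lambda>x. B"])
    show "integrable cone_measure (\<lambda>x. \<phi> (exp (- t) *\<^sub>R sgn x))" for t by (rule test_cone_integrable[OF \<phi>])
    show "((\<lambda>t. \<phi> (exp (- t) *\<^sub>R sgn x)) has_real_derivative - euler \<phi> (exp (- t) *\<^sub>R sgn x)) (at t)" for t x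
    proof -
      have "((\<lambda>t. exp (- t) *\<^sub>R sgn x) has_derivative (\<lambda>h. (- h * exp (- t)) *\<^sub>R sgn x)) (at t)"
        by (auto intro!: derivative_eq_intros)
      from diff_chain_at[OF this smooth_has_derivative[OF test_functions_smooth[OF \<phi>]]]
      have D: "((\<lambda>t. \<phi> (exp (- t) *\<^sub>R sgn x)) has_derivative
        (\<lambda>h. \<Sum>i\<in>UNIV. ((- h * exp (- t)) *\<^sub>R sgn x) $ i * partial i \<phi> (exp (- t) *\<^sub>R sgn x))) (at t)"
        by (simp add: o_def)
      have "(\<lambda>h. \<Sum>i\<in>UNIV. ((- h * exp (- t)) *\<^sub>R sgn x) $ i * partial i \<phi> (exp (- t) *\<^sub>R sgn x))
         = (*) (- euler \<phi> (exp (- t) *\<^sub>R sgn x))"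
        by (rule ext) (simp add: euler_def sum_distrib_left sum_distrib_right sum_negf mult_ac)
      with D show ?thesis by (simp only: has_field_derivative_def)
    qed
    show "\<bar>- euler \<phi> (exp (- t) *\<^sub>R sgn x)\<bar> \<le> B" for t x using B by simp
    show "(\<lambda>x. - euler \<phi> (exp (- s) *\<^sub>R sgn x)) \<in> borel_measurable cone_measure"
      using test_cone_integrable[OF te, of "exp (- s)"] by simp
  qed simp_all
  from DERIV_cdivide[OF this, of "sphere_area TYPE('n)"] show ?thesis unfolding spherical_mean_def .
qed

text \<open>The set of all spherical means of test functions is invariant under differentiation,
  because the derivative is the mean of \<open>- euler \<phi>\<close>, again a test
  function.\<close>

lemma tests1_spherical_mean:
  fixes \<phi> :: "real ^ 'n::finite \<Rightarrow> real"
  assumes \<phi>: "\<phi> \<in> test_functions"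
  shows "spherical_mean \<phi> \<in> tests1"
proof -
  have "smooth1 (spherical_mean \<phi>)"
  proof (rule smooth1_coinduct[of _ "spherical_mean ` (test_functions :: (real ^ 'n \<Rightarrow> real) set)"])
    fix f x assume "f \<in> spherical_mean ` (test_functions :: (real ^ 'n \<Rightarrow> real) set)"
    then obtain \<psi> :: "real ^ 'n \<Rightarrow> real" where \<psi>: "\<psi> \<in> test_functions" "f = spherical_mean \<psi>" by blast
    note D = spherical_mean_DERIV[OF \<psi>(1)]
    show "f differentiable (at x)" unfolding \<psi>(2) real_differentiable_def using D by blast
    have "deriv f = spherical_mean (\<lambda>x. - euler \<psi> x)" unfolding \<psi>(2) by (rule ext, rule DERIV_imp_deriv, rule D)
    moreover have "(\<lambda>x. - euler \<psi> x) \<in> test_functions" using test_cmult[OF test_euler[OF \<psi>(1)], of "-1"] by simp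
    ultimately show "deriv f \<in> spherical_mean ` (test_functions :: (real ^ 'n \<Rightarrow> real) set)" by blast
  qed (use \<phi> in blast)
  moreover have "\<exists>R. \<forall>s. \<bar>s\<bar> > R \<longrightarrow> spherical_mean \<phi> s = 0"
  proof -
    obtain r R where r: "r > 0" "\<And>x. \<phi> x \<noteq> 0 \<Longrightarrow> r \<le> norm x \<and> norm x \<le> R" using \<phi> by (rule test_functionsE) blast
    \<comment> \<open>The bound \<open>R\<close> may fail to be positive when \<open>\<phi>\<close>
      vanishes, so \<open>max R 1\<close> is used inside the logarithm.\<close>
    have "spherical_mean \<phi> s = 0" if s: "\<bar>s\<bar> > max \<bar>ln r\<bar> \<bar>ln (max R 1)\<bar>" for s
    proof -
      have "\<phi> (exp (- s) *\<^sub>R sgn x) = 0" for x :: "real ^ 'n"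
      proof (rule ccontr)
        assume nz: "\<phi> (exp (- s) *\<^sub>R sgn x) \<noteq> 0"
        then have "r \<le> norm (exp (- s) *\<^sub>R sgn x)" "norm (exp (- s) *\<^sub>R sgn x) \<le> R" using r(2)[OF nz] by blast+
        moreover have "x \<noteq> 0" using calculation r(1) by auto
        ultimately have "r \<le> exp (- s)" "exp (- s) \<le> max R 1" by (simp_all add: norm_sgn)
        then have "ln r \<le> - s" "- s \<le> ln (max R 1)" using r(1)
          by (metis exp_gt_zero ln_exp ln_mono)+
        with s show False by linarith
      qed
      then show ?thesis by (simp add: spherical_mean_def)
    qed
    then show ?thesis by blast
  qed
  ultimately show ?thesis by (simp add: tests1_def)
qed

section \<open>Integration against radial functions and the radial part\<close>

lemma cone_integral_radial:
  fixes f :: "real ^ 'n::finite \<Rightarrow> real"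
  assumes "\<And>x. x \<noteq> 0 \<Longrightarrow> f x = c" "f \<in> borel_measurable borel"
  shows "(LINT x|cone_measure. f x) = sphere_area TYPE('n) * c"
proof -
  have "(LINT x|cone_measure. f x) = (LINT x|(cone_measure :: (real ^ 'n) measure). c)"
    by (rule integral_cong_AE, use assms(2) in simp, simp, rule AE_mp[OF AE_cone_nonzero], rule AE_I2)
      (use assms(1) in simp)
  then show ?thesis by (simp add: sphere_area_def)
qed

lemma integral_mult_radial:
  fixes \<phi> :: "real ^ 'n::finite \<Rightarrow> real"
  assumes \<phi>: "\<phi> \<in> test_functions" and F[measurable]: "F \<in> borel_measurable borel"
    and int: "integrable lborel (\<lambda>x. \<phi> x * F (- ln (norm x)))"
  shows "(LINT x|lborel. \<phi> x * F (- ln (norm x))) =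
    sphere_area TYPE('n) * (LINT s|lborel. exp (- real CARD('n) * s) * (F s * spherical_mean \<phi> s))"
proof -
  have [measurable]: "\<phi> \<in> borel_measurable borel" using \<phi> by simp
  have a: "(LINT x|cone_measure. \<phi> (exp (- s) *\<^sub>R sgn x) * F (- ln (norm (exp (- s) *\<^sub>R sgn x))))
     = (LINT x|cone_measure. \<phi> (exp (- s) *\<^sub>R sgn x) * F s)" for s
    by (rule integral_cong_AE, measurable, rule AE_mp[OF AE_cone_nonzero], rule AE_I2) (simp add: norm_sgn)
  have b: "(LINT x|cone_measure. \<phi> (exp (- s) *\<^sub>R sgn x) * F s) = sphere_area TYPE('n) * (F s * spherical_mean \<phi> s)" for s
    using sphere_area_pos[where 'n='n] by (simp add: spherical_mean_def)
  show ?thesis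
    unfolding polar_integral[OF int] a b mult.left_commute[of _ "sphere_area _"] by simp
qed

lemma rad_polar: "x \<noteq> 0 \<Longrightarrow> rad a w (exp (- s) *\<^sub>R sgn x) = exp (a * s) * w s"
  unfolding rad_def norm_polar(1) by (simp add: powr_def)

lemma spherical_mean_rad:
  assumes w: "w \<in> tests1"
  shows "spherical_mean (rad a w :: real ^ 'n::finite \<Rightarrow> real) s = exp (a * s) * w s"
proof -
  have [measurable]: "(rad a w :: real ^ 'n \<Rightarrow> real) \<in> borel_measurable borel"
    by (rule test_measurable[OF test_rad[OF w]])
  have "(LINT x|(cone_measure :: (real ^ 'n) measure). rad a w (exp (- s) *\<^sub>R sgn x)) = sphere_area TYPE('n) * (exp (a * s) * w s)"
    by (rule cone_integral_radial, rule rad_polar, simp, measurable)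
  then show ?thesis using sphere_area_pos[where 'n='n] by (simp add: spherical_mean_def)
qed

text \<open>The weight is placed inside the mean, so that membership in \<open>tests1\<close> is
  immediate; \<open>emden_eq\<close> moves it outside. The function
  \<open>radial_part m \<phi>\<close> does not depend on \<open>m\<close> away from the origin,
  since the two powers cancel; \<open>m\<close> only fixes how its profile is written.\<close>

definition emden :: "real \<Rightarrow> (real ^ 'n::finite \<Rightarrow> real) \<Rightarrow> real \<Rightarrow> real" where
  "emden m \<phi> = spherical_mean (\<lambda>x. norm x powr m * \<phi> x)"

lemma tests1_emden: "\<phi> \<in> test_functions \<Longrightarrow> emden m \<phi> \<in> tests1"
  unfolding emden_def by (intro tests1_spherical_mean test_powr)

lemma emden_eq:
  fixes \<phi> :: "real ^ 'n::finite \<Rightarrow> real"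
  assumes \<phi>: "\<phi> \<in> test_functions"
  shows "emden m \<phi> s = exp (- m * s) * spherical_mean \<phi> s"
proof -
  have [measurable]: "\<phi> \<in> borel_measurable borel" using \<phi> by simp
  have "(LINT x|cone_measure. norm (exp (- s) *\<^sub>R sgn x) powr m * \<phi> (exp (- s) *\<^sub>R sgn x))
     = (LINT x|cone_measure. exp (- m * s) * \<phi> (exp (- s) *\<^sub>R sgn x))"
    by (rule integral_cong_AE, measurable, rule AE_mp[OF AE_cone_nonzero], rule AE_I2) (simp add: norm_sgn powr_def)
  then show ?thesis by (simp add: emden_def spherical_mean_def)
qed

abbreviation radial_part :: "real \<Rightarrow> (real ^ 'n::finite \<Rightarrow> real) \<Rightarrow> real ^ 'n \<Rightarrow> real" where
  "radial_part m \<phi> \<equiv> rad m (emden m \<phi>)"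

lemma test_radial_part: "\<phi> \<in> test_functions \<Longrightarrow> radial_part m \<phi> \<in> test_functions"
  by (intro test_rad tests1_emden)

lemma spherical_mean_radial_part:
  "\<phi> \<in> test_functions \<Longrightarrow> spherical_mean (radial_part m \<phi>) = spherical_mean \<phi>"
  by (rule ext) (simp add: spherical_mean_rad tests1_emden emden_eq exp_add[symmetric] mult.assoc[symmetric])

lemma radial_part_orthogonal:
  fixes \<phi> :: "real ^ 'n::finite \<Rightarrow> real"
  assumes \<phi>: "\<phi> \<in> test_functions" and F: "F \<in> borel_measurable borel"
    and int: "integrable lborel (\<lambda>x. \<phi> x * F (- ln (norm x)))"
      "integrable lborel (\<lambda>x. radial_part m \<phi> x * F (- ln (norm x)))"
  shows "(LINT x|lborel. (\<phi> x - radial_part m \<phi> x) * F (- ln (norm x))) = 0"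
  using integral_mult_radial[OF \<phi> F int(1)] integral_mult_radial[OF test_radial_part[OF \<phi>] F int(2)] int
  by (simp add: left_diff_distrib spherical_mean_radial_part[OF \<phi>])

lemma test_at_0: "\<phi> \<in> test_functions \<Longrightarrow> \<phi> 0 = 0"
  by (metis norm_zero not_less test_functionsE)

lemma radial_part_orthogonal_rad:
  fixes \<phi> :: "real ^ 'n::finite \<Rightarrow> real"
  assumes \<phi>: "\<phi> \<in> test_functions" and k: "k \<in> tests1"
  shows "(LINT x|lborel. (\<phi> x - radial_part m \<phi> x) * rad c k x) = 0"
proof -
  let ?F = "\<lambda>s. exp (c * s) * k s"
  have eq: "\<psi> x * rad c k x = \<psi> x * ?F (- ln (norm x))" if "\<psi> \<in> test_functions" for \<psi> :: "real ^ 'n \<Rightarrow> real" and x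
    using test_at_0[OF that] by (cases "x = 0") (simp_all add: rad_def powr_def)
  have int: "integrable lborel (\<lambda>x. \<psi> x * ?F (- ln (norm x)))" if "\<psi> \<in> test_functions" for \<psi> :: "real ^ 'n \<Rightarrow> real"
    unfolding eq[OF that, symmetric] by (rule test_mult_integrable[OF test_functions_smooth[OF that] test_rad[OF k]])
  have "?F \<in> borel_measurable borel" using k by simp
  from radial_part_orthogonal[OF \<phi> this int[OF \<phi>] int[OF test_radial_part[OF \<phi>]]]
  show ?thesis unfolding eq[OF test_diff[OF \<phi> test_radial_part[OF \<phi>, of m]]] .
qed

lemma norm_powr_mult_rad: "norm x powr c * rad a w x = rad (a - c) w x"
  by (simp add: rad_def powr_add[symmetric] mult.assoc[symmetric])

lemma rad_mult_rad: "rad a v x * rad b w x = rad (a + b) (\<lambda>s. v s * w s) x"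
proof -
  have "norm x powr (- (a + b)) = norm x powr (- a) * norm x powr (- b)" by (simp add: powr_add[symmetric])
  then show ?thesis unfolding rad_def by (simp add: mult_ac)
qed

text \<open>Pythagoras for the weighted Laplacian. The weighted Laplacian of the radial part is a
  radial test function, and after Green's formula its Laplacian, again radial, is paired with the
  difference \<open>D\<close>, which is orthogonal to radial functions. So the cross term is
  0.\<close>

lemma radial_part_laplacian_le:
  fixes \<phi> :: "real ^ 'n::finite \<Rightarrow> real" and m :: real
  assumes \<phi>: "\<phi> \<in> test_functions"
  defines "v \<equiv> radial_part m \<phi>"
  shows "(LINT x|lborel. norm x powr (- \<alpha>) * (laplacian v x)\<^sup>2) \<le> (LINT x|lborel. norm x powr (- \<alpha>) * (laplacian \<phi> x)\<^sup>2)"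
proof -
  define w where "w = emden m \<phi>"
  have w: "w \<in> tests1" unfolding w_def by (rule tests1_emden[OF \<phi>])
  have v: "v = rad m w" "v \<in> test_functions" unfolding v_def w_def using test_radial_part[OF \<phi>] by simp_all
  define D where "D = (\<lambda>x. \<phi> x - v x)"
  have D: "D \<in> test_functions" unfolding D_def by (rule test_diff[OF \<phi> v(2)])
  define \<psi> where "\<psi> = (\<lambda>x. norm x powr (- \<alpha>) * laplacian v x)"
  have \<psi>: "\<psi> \<in> test_functions" unfolding \<psi>_def by (intro test_powr test_laplacian v)
  have k1: "radial_laplacian CARD('n) m w \<in> tests1" by (rule tests1_radial_laplacian[OF w])
  have \<psi>_rad: "\<psi> = rad (m + 2 + \<alpha>) (radial_laplacian CARD('n) m w)"
    unfolding \<psi>_def v(1) laplacian_rad[OF w] by (rule ext) (simp add: norm_powr_mult_rad)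
  have "(LINT x|lborel. \<psi> x * laplacian D x) = (LINT x|lborel. laplacian \<psi> x * D x)" by (rule test_green[OF \<psi> D])
  also have "\<dots> = 0"
    unfolding \<psi>_rad laplacian_rad[OF k1] D_def v_def
    using radial_part_orthogonal_rad[OF \<phi> tests1_radial_laplacian[OF k1]] by (simp add: mult.commute)
  finally have o: "(LINT x|lborel. \<psi> x * laplacian D x) = 0" .
  have eq: "norm x powr (- \<alpha>) * (laplacian \<phi> x)\<^sup>2 =
    norm x powr (- \<alpha>) * (laplacian v x)\<^sup>2 + 2 * (\<psi> x * laplacian D x) + norm x powr (- \<alpha>) * (laplacian D x)\<^sup>2" for x
    unfolding D_def \<psi>_def laplacian_diff[OF test_functions_smooth[OF \<phi>] test_functions_smooth[OF v(2)]]
    by (simp add: power2_eq_square algebra_simps)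
  have i: "integrable lborel (\<lambda>x. norm x powr (- \<alpha>) * (laplacian f x)\<^sup>2)" if "f \<in> test_functions" for f :: "real ^ 'n \<Rightarrow> real"
    by (intro test_integrable test_powr test_sq test_laplacian that)
  have i2: "integrable lborel (\<lambda>x. \<psi> x * laplacian D x)"
    by (rule test_mult_integrable(1)[OF test_functions_smooth[OF \<psi>] test_laplacian[OF D]])
  have "(LINT x|lborel. norm x powr (- \<alpha>) * (laplacian \<phi> x)\<^sup>2) =
    (LINT x|lborel. norm x powr (- \<alpha>) * (laplacian v x)\<^sup>2) + (LINT x|lborel. norm x powr (- \<alpha>) * (laplacian D x)\<^sup>2)"
    unfolding eq using i[OF v(2)] i[OF D] i2 o by simp
  moreover have "(LINT x|lborel. norm x powr (- \<alpha>) * (laplacian D x)\<^sup>2) \<ge> 0" by (intro integral_nonneg_AE AE_I2) simp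
  ultimately show ?thesis by simp
qed

text \<open>As for the Laplacian, but the cross term is a pairing of gradients. Integration by parts
  moves all derivatives to the weighted gradient of the radial part, whose divergence is radial by
  \<open>divergence_rad\<close>.\<close>

lemma radial_part_gradsq_le:
  fixes \<phi> :: "real ^ 'n::finite \<Rightarrow> real" and m :: real
  assumes \<phi>: "\<phi> \<in> test_functions"
  defines "v \<equiv> radial_part m \<phi>"
  shows "(LINT x|lborel. norm x powr c * gradsq v x) \<le> (LINT x|lborel. norm x powr c * gradsq \<phi> x)"
proof -
  define w where "w = emden m \<phi>"
  have w: "w \<in> tests1" unfolding w_def by (rule tests1_emden[OF \<phi>])
  have v: "v = rad m w" "v \<in> test_functions" unfolding v_def w_def using test_radial_part[OF \<phi>] by simp_all
  note s = test_functions_smooth[OF \<phi>] test_functions_smooth[OF v(2)]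
  define D where "D = (\<lambda>x. \<phi> x - v x)"
  have D: "D \<in> test_functions" unfolding D_def by (rule test_diff[OF \<phi> v(2)])
  define k where "k = (\<lambda>s. - (m * w s + deriv w s))"
  have k: "k \<in> tests1" unfolding k_def by (rule tests1_neg_deriv[OF w])
  define \<psi> where "\<psi> i = (\<lambda>x. norm x powr c * partial i v x)" for i
  have \<psi>: "\<psi> i \<in> test_functions" for i unfolding \<psi>_def by (intro test_powr test_partial v)
  have \<psi>_rad: "\<psi> i = (\<lambda>x. x $ i * rad (m + 2 - c) k x)" for i
    unfolding \<psi>_def v(1) partial_rad[OF w] k_def[symmetric]
    by (rule ext) (simp add: norm_powr_mult_rad[symmetric] mult_ac)
  have i1: "integrable lborel (\<lambda>x. \<psi> i x * partial i D x)" for i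
    by (rule test_mult_integrable(1)[OF test_functions_smooth[OF \<psi>] test_partial[OF D]])
  have i3: "integrable lborel (\<lambda>x. partial i (\<psi> i) x * D x)" for i
    by (rule test_mult_integrable(1)[OF test_functions_smooth[OF test_partial[OF \<psi>]] D])
  have "(LINT x|lborel. (\<Sum>i\<in>UNIV. \<psi> i x * partial i D x)) = (\<Sum>i\<in>UNIV. LINT x|lborel. \<psi> i x * partial i D x)"
    by (rule Bochner_Integration.integral_sum[OF i1])
  also have "\<dots> = - (\<Sum>i\<in>UNIV. LINT x|lborel. partial i (\<psi> i) x * D x)"
    by (simp add: test_parts[OF test_functions_smooth[OF \<psi>] D] sum_negf)
  also have "(\<Sum>i\<in>UNIV. LINT x|lborel. partial i (\<psi> i) x * D x) = (LINT x|lborel. (\<Sum>i\<in>UNIV. partial i (\<psi> i) x * D x))"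
    by (rule Bochner_Integration.integral_sum[OF i3, symmetric])
  also have "\<dots> = (LINT x|lborel. D x * rad (m + 2 - c) (\<lambda>s. (real CARD('n) - (m + 2 - c)) * k s - deriv k s) x)"
    unfolding sum_distrib_right[symmetric] \<psi>_rad divergence_rad[OF k] by (simp add: mult.commute)
  also have "\<dots> = 0"
    unfolding D_def v_def by (intro radial_part_orthogonal_rad \<phi> tests1_diff tests1_cmult tests1_deriv k)
  finally have o: "(LINT x|lborel. (\<Sum>i\<in>UNIV. \<psi> i x * partial i D x)) = 0" by simp
  have eq: "norm x powr c * gradsq \<phi> x =
    norm x powr c * gradsq v x + 2 * (\<Sum>i\<in>UNIV. \<psi> i x * partial i D x) + norm x powr c * gradsq D x" for x
    unfolding D_def \<psi>_def partial_diff[OF s] gradsq_def sum_distrib_left sum.distrib[symmetric]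
    by (intro sum.cong refl) (simp add: power2_eq_square algebra_simps)
  have i: "integrable lborel (\<lambda>x. norm x powr c * gradsq f x)" if "f \<in> test_functions" for f :: "real ^ 'n \<Rightarrow> real"
    by (intro test_integrable test_powr test_gradsq that)
  have i2: "integrable lborel (\<lambda>x. \<Sum>i\<in>UNIV. \<psi> i x * partial i D x)"
    by (rule Bochner_Integration.integrable_sum[OF i1])
  have "(LINT x|lborel. norm x powr c * gradsq \<phi> x) =
    (LINT x|lborel. norm x powr c * gradsq v x) + (LINT x|lborel. norm x powr c * gradsq D x)"
    unfolding eq using i[OF v(2)] i[OF D] i2 o by simp
  moreover have "(LINT x|lborel. norm x powr c * gradsq D x) \<ge> 0"
    by (intro integral_nonneg_AE AE_I2) (simp add: gradsq_def sum_nonneg)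
  ultimately show ?thesis by simp
qed

text \<open>The exponent \<open>n\<close> is the one for which the density
  \<open>exp (- n * s)\<close> of polar coordinates cancels.\<close>

lemma integral_rad:
  assumes w: "w \<in> tests1"
  shows "(LINT x|lborel. rad (real CARD('n)) w (x :: real ^ 'n::finite)) = sphere_area TYPE('n) * (LINT s|lborel. w s)"
proof -
  have [measurable]: "(rad (real CARD('n)) w :: real ^ 'n \<Rightarrow> real) \<in> borel_measurable borel"
    by (rule test_measurable[OF test_rad[OF w]])
  have "(LINT x|(cone_measure :: (real ^ 'n) measure). rad (real CARD('n)) w (exp (- s) *\<^sub>R sgn x))
     = sphere_area TYPE('n) * (exp (real CARD('n) * s) * w s)" for s
    by (rule cone_integral_radial, rule rad_polar, simp, measurable)
  then show ?thesis unfolding polar_integral[OF test_integrable[OF test_rad[OF w]]]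
    by (simp add: exp_minus field_simps)
qed

lemma nn_integral_radial:
  fixes H :: "real \<Rightarrow> ennreal"
  assumes [measurable]: "H \<in> borel_measurable borel"
  shows "(\<integral>\<^sup>+x. ennreal (norm (x :: real ^ 'n::finite) powr (- real CARD('n))) * H (- ln (norm x)) \<partial>lborel)
    = ennreal (sphere_area TYPE('n)) * (\<integral>\<^sup>+s. H s \<partial>lborel)"
proof -
  have "(\<integral>\<^sup>+x. ennreal (norm (x :: real ^ 'n) powr (- real CARD('n))) * H (- ln (norm x)) \<partial>lborel)
    = (\<integral>\<^sup>+s. \<integral>\<^sup>+x. ennreal (exp (- real CARD('n) * s)) * (ennreal (norm (exp (- s) *\<^sub>R sgn x) powr (- real CARD('n))) * H (- ln (norm (exp (- s) *\<^sub>R sgn x)))) \<partial>(cone_measure :: (real ^ 'n) measure) \<partial>lborel)"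
    by (rule polar_nn_integral) simp
  also have "\<dots> = (\<integral>\<^sup>+s. \<integral>\<^sup>+x. H s \<partial>(cone_measure :: (real ^ 'n) measure) \<partial>lborel)"
  proof (rule nn_integral_cong, rule nn_integral_cong_AE, rule AE_mp[OF AE_cone_nonzero], rule AE_I2, rule impI)
    fix s :: real and x :: "real ^ 'n" assume x: "x \<noteq> 0"
    have "ennreal (exp (- real CARD('n) * s)) * (ennreal (exp (- s) powr (- real CARD('n))) * H s) = H s"
      by (simp add: powr_def mult.assoc[symmetric] ennreal_mult[symmetric] exp_add[symmetric])
    then show "ennreal (exp (- real CARD('n) * s)) * (ennreal (norm (exp (- s) *\<^sub>R sgn x) powr (- real CARD('n))) * H (- ln (norm (exp (- s) *\<^sub>R sgn x)))) = H s"
      using x by (simp add: norm_polar del: norm_scaleR)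
  qed
  also have "\<dots> = (\<integral>\<^sup>+s. ennreal (sphere_area TYPE('n)) * H s \<partial>lborel)"
    by (simp add: emeasure_cone_UNIV mult.commute)
  finally show ?thesis by (simp add: nn_integral_cmult)
qed

section \<open>Integrals of radial functions\<close>

definition energy :: "real \<Rightarrow> real \<Rightarrow> (real \<Rightarrow> real) \<Rightarrow> real" where
  "energy a b w = (LINT s|lborel. (deriv (deriv w) s)\<^sup>2) + a * (LINT s|lborel. (deriv w s)\<^sup>2) + b * (LINT s|lborel. (w s)\<^sup>2)"

lemma tests1_sq: "w \<in> tests1 \<Longrightarrow> (\<lambda>s. (w s)\<^sup>2) \<in> tests1"
  unfolding power2_eq_square by (rule tests1_mult[OF tests1_smooth1])

lemma tests1_mult_integrable: "v \<in> tests1 \<Longrightarrow> w \<in> tests1 \<Longrightarrow> integrable lborel (\<lambda>s. v s * w s)"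
  by (intro tests1_integrable tests1_mult tests1_smooth1)

lemma tests1_parts:
  assumes v: "v \<in> tests1" and w: "w \<in> tests1"
  shows "(LINT s|lborel. deriv v s * w s) = - (LINT s|lborel. v s * deriv w s)"
proof -
  have "0 = (LINT s|lborel. deriv v s * w s + deriv w s * v s)"
    using tests1_integral_deriv[OF tests1_mult[OF tests1_smooth1[OF v] w]]
    by (simp add: deriv_mult_smooth1[OF tests1_smooth1[OF v] tests1_smooth1[OF w]])
  also have "\<dots> = (LINT s|lborel. deriv v s * w s) + (LINT s|lborel. deriv w s * v s)"
    by (intro Bochner_Integration.integral_add tests1_mult_integrable tests1_deriv v w)
  finally show ?thesis by (simp add: mult.commute)
qed

text \<open>The value of \<open>m\<close> is forced: with it all three integrands carry exactly the
  factor \<open>norm x powr (- n)\<close>, so no exponential weight in \<open>s\<close> remains.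
  Here \<open>\<gamma> = m * (n - 2 - m)\<close>. In the expanded squares the products of
  consecutive derivatives integrate to 0, and \<open>w * w''\<close> integrates to minus the
  integral of \<open>w'\<close> squared; this last term adds \<open>2 * \<gamma>\<close> to the
  coefficient of the first derivative.\<close>

lemma radial_integrals:
  assumes w: "w \<in> tests1"
    and m: "m = (real CARD('n::finite) - 4 - \<alpha>) / 2"
    and g: "\<gamma> = (real CARD('n) - 4 - \<alpha>) * (real CARD('n) + \<alpha>) / 4"
  defines "v \<equiv> (rad m w :: real ^ 'n \<Rightarrow> real)"
  shows radial_integral_sq: "(LINT x|lborel. norm x powr (- \<alpha> - 4) * (v x)\<^sup>2) = sphere_area TYPE('n) * (LINT s|lborel. (w s)\<^sup>2)"
    and radial_integral_gradsq: "(LINT x|lborel. norm x powr (- \<alpha> - 2) * gradsq v x)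
      = sphere_area TYPE('n) * ((LINT s|lborel. (deriv w s)\<^sup>2) + m\<^sup>2 * (LINT s|lborel. (w s)\<^sup>2))"
    and radial_integral_laplacian: "(LINT x|lborel. norm x powr (- \<alpha>) * (laplacian v x)\<^sup>2)
      = sphere_area TYPE('n) * energy ((\<alpha> + 2)\<^sup>2 + 2 * \<gamma>) (\<gamma>\<^sup>2) w"
proof -
  let ?n = "real CARD('n)"
  note w1 = tests1_deriv[OF w] and w2 = tests1_deriv[OF tests1_deriv[OF w]]
  note int = tests1_mult_integrable[OF w w] tests1_mult_integrable[OF w w1] tests1_mult_integrable[OF w w2]
    tests1_mult_integrable[OF w1 w1] tests1_mult_integrable[OF w1 w2] tests1_mult_integrable[OF w2 w2]
  have p01: "(LINT s|lborel. w s * deriv w s) = 0" using tests1_parts[OF w w] by (simp add: mult.commute)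
  have p12: "(LINT s|lborel. deriv w s * deriv (deriv w) s) = 0" using tests1_parts[OF w1 w1] by (simp add: mult.commute)
  have p02: "(LINT s|lborel. w s * deriv (deriv w) s) = - (LINT s|lborel. deriv w s * deriv w s)"
    using tests1_parts[OF w w1] by simp
  have sq: "norm x powr c * (rad a k x)\<^sup>2 = rad (2 * a - c) (\<lambda>s. (k s)\<^sup>2) x" for c a k and x :: "real ^ 'n"
    by (simp only: power2_eq_square rad_mult_rad norm_powr_mult_rad mult_2)
  have e: "2 * m - (- \<alpha> - 4) = ?n" "2 * (m + 2) - (- \<alpha> - 2 + 2) = ?n" "2 * (m + 2) - (- \<alpha>) = ?n"
    by (simp_all add: m field_simps)
  have "(LINT x|lborel. norm x powr (- \<alpha> - 4) * (v x)\<^sup>2) = (LINT x|lborel. rad ?n (\<lambda>s. (w s)\<^sup>2) (x :: real ^ 'n))"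
    unfolding v_def sq e ..
  then show "(LINT x|lborel. norm x powr (- \<alpha> - 4) * (v x)\<^sup>2) = sphere_area TYPE('n) * (LINT s|lborel. (w s)\<^sup>2)"
    by (simp add: integral_rad[OF tests1_sq[OF w]])
  let ?k = "\<lambda>s. - (m * w s + deriv w s)"
  have "norm x powr (- \<alpha> - 2) * gradsq v x = rad ?n (\<lambda>s. (?k s)\<^sup>2) x" for x
  proof -
    have "gradsq v x = (\<Sum>i\<in>UNIV. (x $ i * x $ i) * (rad (m + 2) ?k x)\<^sup>2)"
      unfolding gradsq_def v_def partial_rad[OF w] by (simp add: power2_eq_square mult_ac)
    also have "\<dots> = (norm x)\<^sup>2 * (rad (m + 2) ?k x)\<^sup>2" unfolding sum_distrib_right[symmetric] sum_coord_sq ..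
    finally have "norm x powr (- \<alpha> - 2) * gradsq v x = (norm x powr (- \<alpha> - 2) * (norm x)\<^sup>2) * (rad (m + 2) ?k x)\<^sup>2"
      by simp
    also have "\<dots> = rad (2 * (m + 2) - (- \<alpha> - 2 + 2)) (\<lambda>s. (?k s)\<^sup>2) x" unfolding norm_powr_mult_sq sq ..
    finally show ?thesis unfolding e .
  qed
  then have "(LINT x|lborel. norm x powr (- \<alpha> - 2) * gradsq v x) = sphere_area TYPE('n) * (LINT s|lborel. (?k s)\<^sup>2)"
    by (simp only: integral_rad[OF tests1_sq[OF tests1_neg_deriv[OF w]]])
  also have "(LINT s|lborel. (?k s)\<^sup>2) =
      (LINT s|lborel. deriv w s * deriv w s + m\<^sup>2 * (w s * w s) + 2 * m * (w s * deriv w s))"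
    by (rule Bochner_Integration.integral_cong) (simp_all add: power2_eq_square algebra_simps)
  also have "\<dots> = (LINT s|lborel. (deriv w s)\<^sup>2) + m\<^sup>2 * (LINT s|lborel. (w s)\<^sup>2)"
    using int by (simp add: p01 power2_eq_square)
  finally show "(LINT x|lborel. norm x powr (- \<alpha> - 2) * gradsq v x)
      = sphere_area TYPE('n) * ((LINT s|lborel. (deriv w s)\<^sup>2) + m\<^sup>2 * (LINT s|lborel. (w s)\<^sup>2))" .
  have k2: "radial_laplacian ?n m w = (\<lambda>s. deriv (deriv w) s - (\<alpha> + 2) * deriv w s - \<gamma> * w s)"
  proof -
    have "2 * m - ?n + 2 = - (\<alpha> + 2)" by (simp add: m field_simps)
    moreover have "m * (?n - 2 - m) = \<gamma>"
    proof -
      have "?n - 2 - m = (?n + \<alpha>) / 2" by (simp add: m field_simps)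
      show ?thesis unfolding \<open>?n - 2 - m = (?n + \<alpha>) / 2\<close> unfolding m g by simp
    qed
    ultimately show ?thesis unfolding radial_laplacian_def by (simp only:) (simp add: fun_eq_iff algebra_simps)
  qed
  have "(LINT x|lborel. norm x powr (- \<alpha>) * (laplacian v x)\<^sup>2) = (LINT x|lborel. rad ?n (\<lambda>s. (radial_laplacian ?n m w s)\<^sup>2) (x :: real ^ 'n))"
    unfolding v_def laplacian_rad[OF w] sq e ..
  also have "\<dots> = sphere_area TYPE('n) * (LINT s|lborel. (radial_laplacian ?n m w s)\<^sup>2)"
    by (rule integral_rad[OF tests1_sq[OF tests1_radial_laplacian[OF w]]])
  also have "(LINT s|lborel. (radial_laplacian ?n m w s)\<^sup>2) =
    (LINT s|lborel. deriv (deriv w) s * deriv (deriv w) s + (\<alpha> + 2)\<^sup>2 * (deriv w s * deriv w s) + \<gamma>\<^sup>2 * (w s * w s)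
       - 2 * (\<alpha> + 2) * (deriv w s * deriv (deriv w) s) - 2 * \<gamma> * (w s * deriv (deriv w) s)
       + 2 * (\<alpha> + 2) * \<gamma> * (w s * deriv w s))"
    unfolding k2 by (rule Bochner_Integration.integral_cong) (simp_all add: power2_eq_square algebra_simps)
  also have "\<dots> = energy ((\<alpha> + 2)\<^sup>2 + 2 * \<gamma>) (\<gamma>\<^sup>2) w"
    using int by (simp add: p01 p02 p12 energy_def power2_eq_square[of "deriv w _"] power2_eq_square[of "w _"]
        power2_eq_square[of "deriv (deriv w) _"] distrib_right)
  finally show "(LINT x|lborel. norm x powr (- \<alpha>) * (laplacian v x)\<^sup>2)
      = sphere_area TYPE('n) * energy ((\<alpha> + 2)\<^sup>2 + 2 * \<gamma>) (\<gamma>\<^sup>2) w" .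
qed

section \<open>Square integrable functions\<close>

lemma L2_product_integrable:
  fixes X Y :: "'a \<Rightarrow> real"
  assumes m[measurable]: "X \<in> borel_measurable M" "Y \<in> borel_measurable M"
    and X: "integrable M (\<lambda>x. (X x)\<^sup>2)" and Y: "integrable M (\<lambda>x. (Y x)\<^sup>2)"
  shows "integrable M (\<lambda>x. X x * Y x)"
proof (rule Bochner_Integration.integrable_bound)
  show "integrable M (\<lambda>x. (X x)\<^sup>2 + (Y x)\<^sup>2)" using X Y by simp
  show "AE x in M. norm (X x * Y x) \<le> norm ((X x)\<^sup>2 + (Y x)\<^sup>2)"
  proof (rule AE_I2)
    fix x
    have "2 * \<bar>X x * Y x\<bar> \<le> (X x)\<^sup>2 + (Y x)\<^sup>2"
      using sum_squares_bound[of "\<bar>X x\<bar>" "\<bar>Y x\<bar>"] by (simp add: abs_mult)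
    then show "norm (X x * Y x) \<le> norm ((X x)\<^sup>2 + (Y x)\<^sup>2)" by simp
  qed
qed measurable

lemma L2_diff_integrable:
  fixes X Y :: "'a \<Rightarrow> real"
  assumes "X \<in> borel_measurable M" "Y \<in> borel_measurable M"
    and "integrable M (\<lambda>x. (X x)\<^sup>2)" "integrable M (\<lambda>x. (Y x)\<^sup>2)"
  shows "integrable M (\<lambda>x. (X x - Y x)\<^sup>2)"
  using L2_product_integrable[OF assms] assms(3,4) by (simp add: power2_diff mult.assoc)

text \<open>Young's inequality with a free parameter \<open>d\<close> takes the place of the
  Cauchy-Schwarz inequality: first \<open>d\<close> is made small to control the part with
  \<open>Y\<close>, then \<open>k\<close> large.\<close>

lemma L2_product_tendsto_0:
  fixes X :: "nat \<Rightarrow> 'a \<Rightarrow> real"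
  assumes m[measurable]: "\<And>k. X k \<in> borel_measurable M" "Y \<in> borel_measurable M"
    and X: "\<And>k. integrable M (\<lambda>x. (X k x)\<^sup>2)" and Y: "integrable M (\<lambda>x. (Y x)\<^sup>2)"
    and lim: "(\<lambda>k. \<integral>x. (X k x)\<^sup>2 \<partial>M) \<longlonglongrightarrow> 0"
  shows "integrable M (\<lambda>x. X k x * Y x)" "(\<lambda>k. \<integral>x. \<bar>X k x * Y x\<bar> \<partial>M) \<longlonglongrightarrow> 0"
proof -
  have le: "\<bar>X k x * Y x\<bar> \<le> 1 / (2 * d) * (X k x)\<^sup>2 + d / 2 * (Y x)\<^sup>2" if "d > 0" for d k x
  proof -
    have "0 \<le> (\<bar>X k x\<bar> - d * \<bar>Y x\<bar>)\<^sup>2 / (2 * d)" using that by simp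
    also have "\<dots> = 1 / (2 * d) * (X k x)\<^sup>2 + d / 2 * (Y x)\<^sup>2 - \<bar>X k x * Y x\<bar>"
      using that by (simp add: power2_diff power_mult_distrib abs_mult field_simps power2_eq_square)
    finally show ?thesis by simp
  qed
  have int: "integrable M (\<lambda>x. X k x * Y x)" for k
    by (rule L2_product_integrable[OF m X Y])
  then show "integrable M (\<lambda>x. X k x * Y x)" .
  show "(\<lambda>k. \<integral>x. \<bar>X k x * Y x\<bar> \<partial>M) \<longlonglongrightarrow> 0"
  proof (rule LIMSEQ_I)
    fix e :: real assume e: "e > 0"
    define B where "B = (\<integral>x. (Y x)\<^sup>2 \<partial>M)"
    have B: "B \<ge> 0" unfolding B_def by (intro integral_nonneg_AE AE_I2) simp
    \<comment> \<open>The denominator \<open>B + 1\<close> instead of \<open>B\<close> covers the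
      case that \<open>Y\<close> vanishes almost everywhere.\<close>
    define d where "d = e / (B + 1)"
    have d: "d > 0" "d / 2 * B < e / 2" using e B by (simp_all add: d_def field_simps)
    have "2 * d * (e / 2) > 0" using d e by simp
    from LIMSEQ_D[OF lim this] obtain N where N: "\<And>k. k \<ge> N \<Longrightarrow> \<bar>\<integral>x. (X k x)\<^sup>2 \<partial>M\<bar> < 2 * d * (e / 2)" by auto
    show "\<exists>N. \<forall>k\<ge>N. norm ((\<integral>x. \<bar>X k x * Y x\<bar> \<partial>M) - 0) < e"
    proof (intro exI allI impI)
      fix k assume k: "k \<ge> N"
      have "(\<integral>x. \<bar>X k x * Y x\<bar> \<partial>M) \<le> (\<integral>x. 1 / (2 * d) * (X k x)\<^sup>2 + d / 2 * (Y x)\<^sup>2 \<partial>M)"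
        by (rule integral_mono) (use int X Y le[OF d(1)] in auto)
      also have "\<dots> = 1 / (2 * d) * (\<integral>x. (X k x)\<^sup>2 \<partial>M) + d / 2 * B" using X Y by (simp add: B_def)
      also have "\<dots> < e / 2 + e / 2"
      proof (rule add_strict_mono[OF _ d(2)])
        have "1 / (2 * d) * (\<integral>x. (X k x)\<^sup>2 \<partial>M) < 1 / (2 * d) * (2 * d * (e / 2))"
          by (rule mult_strict_left_mono) (use N[OF k] d(1) in auto)
        then show "1 / (2 * d) * (\<integral>x. (X k x)\<^sup>2 \<partial>M) < e / 2" using d(1) by simp
      qed
      finally have "(\<integral>x. \<bar>X k x * Y x\<bar> \<partial>M) < e" by simp
      moreover have "(\<integral>x. \<bar>X k x * Y x\<bar> \<partial>M) \<ge> 0" by (intro integral_nonneg_AE AE_I2) simp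
      ultimately show "norm ((\<integral>x. \<bar>X k x * Y x\<bar> \<partial>M) - 0) < e" by simp
    qed
  qed
qed

lemma L2_norm_tendsto:
  fixes f :: "nat \<Rightarrow> 'a \<Rightarrow> real"
  assumes m[measurable]: "\<And>k. f k \<in> borel_measurable M" "g \<in> borel_measurable M"
    and d: "\<And>k. integrable M (\<lambda>x. (f k x - g x)\<^sup>2)" and g: "integrable M (\<lambda>x. (g x)\<^sup>2)"
    and lim: "(\<lambda>k. \<integral>x. (f k x - g x)\<^sup>2 \<partial>M) \<longlonglongrightarrow> 0"
  shows "(\<lambda>k. \<integral>x. (f k x)\<^sup>2 \<partial>M) \<longlonglongrightarrow> (\<integral>x. (g x)\<^sup>2 \<partial>M)"
proof -
  have p: "integrable M (\<lambda>x. (f k x - g x) * g x)" "(\<lambda>k. \<integral>x. \<bar>(f k x - g x) * g x\<bar> \<partial>M) \<longlonglongrightarrow> 0" for k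
    by (rule L2_product_tendsto_0[OF _ _ d g lim]; measurable)+
  have "(\<lambda>k. \<integral>x. (f k x - g x) * g x \<partial>M) \<longlonglongrightarrow> 0"
    by (rule Lim_null_comparison[OF _ p(2)]) (simp add: integral_norm_bound[of M "\<lambda>x. (f _ x - g x) * g x", simplified])
  then have "(\<lambda>k. (\<integral>x. (f k x - g x)\<^sup>2 \<partial>M) + 2 * (\<integral>x. (f k x - g x) * g x \<partial>M) + (\<integral>x. (g x)\<^sup>2 \<partial>M))
      \<longlonglongrightarrow> 0 + 2 * 0 + (\<integral>x. (g x)\<^sup>2 \<partial>M)"
    by (intro tendsto_intros lim)
  moreover have "(\<integral>x. (f k x - g x)\<^sup>2 \<partial>M) + 2 * (\<integral>x. (f k x - g x) * g x \<partial>M) + (\<integral>x. (g x)\<^sup>2 \<partial>M) = (\<integral>x. (f k x)\<^sup>2 \<partial>M)" for k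
  proof -
    have "(\<integral>x. (f k x)\<^sup>2 \<partial>M) = (\<integral>x. (f k x - g x)\<^sup>2 + 2 * ((f k x - g x) * g x) + (g x)\<^sup>2 \<partial>M)"
      by (rule Bochner_Integration.integral_cong) (simp_all add: power2_eq_square algebra_simps)
    then show ?thesis using d g p(1) by simp
  qed
  ultimately show ?thesis by simp
qed

lemma L2_complete:
  fixes f :: "nat \<Rightarrow> 'a \<Rightarrow> real"
  assumes m[measurable]: "\<And>k. f k \<in> borel_measurable M" and f2: "\<And>k. integrable M (\<lambda>x. (f k x)\<^sup>2)"
    and cauchy: "\<And>e. e > 0 \<Longrightarrow> \<exists>N. \<forall>j\<ge>N. \<forall>k\<ge>N. (\<integral>x. (f j x - f k x)\<^sup>2 \<partial>M) < e"
  obtains g where "g \<in> borel_measurable M" "integrable M (\<lambda>x. (g x)\<^sup>2)"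
    "\<And>k. integrable M (\<lambda>x. (f k x - g x)\<^sup>2)" "(\<lambda>k. \<integral>x. (f k x - g x)\<^sup>2 \<partial>M) \<longlonglongrightarrow> 0"
proof -
  have df: "integrable M (\<lambda>x. (f j x - f k x)\<^sup>2)" for j k by (rule L2_diff_integrable[OF m m f2 f2])
  have "\<forall>i. \<exists>N. \<forall>j\<ge>N. \<forall>k\<ge>N. (\<integral>x. (f j x - f k x)\<^sup>2 \<partial>M) < (1/8) ^ i" using cauchy by simp
  then obtain N where N: "\<And>i j k. j \<ge> N i \<Longrightarrow> k \<ge> N i \<Longrightarrow> (\<integral>x. (f j x - f k x)\<^sup>2 \<partial>M) < (1/8) ^ i" by metis
  \<comment> \<open>A sum of the thresholds dominates each of them, which makes \<open>r k\<close> a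
    valid index for every accuracy \<open>i \<le> k\<close> although \<open>N\<close> need not be
    monotone.\<close>
  define r where "r k = (\<Sum>i\<le>k. N i)" for k
  have r: "r k \<ge> N i" if "i \<le> k" for i k unfolding r_def using that member_le_sum[of i "{..k}" N] by simp
  define d where "d k x = f (r (Suc k)) x - f (r k) x" for k x
  have [measurable]: "d k \<in> borel_measurable M" for k unfolding d_def by measurable
  have dint: "integrable M (\<lambda>x. (d k x)\<^sup>2)" for k unfolding d_def by (rule df)
  \<comment> \<open>The weight \<open>2 ^ k\<close> is affordable because the squared steps are
    below \<open>(1/8) ^ k\<close>. In return, finiteness of the sum at a point bounds
    \<open>\<bar>d k x\<bar>\<close> by a geometric sequence with ratio \<open>sqrt (1/2)\<close>,
    hence gives absolute convergence there.\<close>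
  have "(\<integral>\<^sup>+x. (\<Sum>k. ennreal (2 ^ k * (d k x)\<^sup>2)) \<partial>M) = (\<Sum>k. \<integral>\<^sup>+x. ennreal (2 ^ k * (d k x)\<^sup>2) \<partial>M)"
    by (rule nn_integral_suminf) measurable
  also have "\<dots> \<le> (\<Sum>k. ennreal ((1/4) ^ k))"
  proof (rule suminf_le)
    fix k
    have "(\<integral>\<^sup>+x. ennreal (2 ^ k * (d k x)\<^sup>2) \<partial>M) = ennreal (\<integral>x. 2 ^ k * (d k x)\<^sup>2 \<partial>M)"
      by (rule nn_integral_eq_integral) (use dint in auto)
    also have "\<dots> \<le> ennreal (2 ^ k * (1/8) ^ k)"
      using N[of k "r (Suc k)" "r k"] r[of k k] r[of k "Suc k"] by (intro ennreal_leI) (auto simp: d_def)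
    also have "(2::real) ^ k * (1/8) ^ k = (1/4) ^ k" by (simp add: power_mult_distrib[symmetric])
    finally show "(\<integral>\<^sup>+x. ennreal (2 ^ k * (d k x)\<^sup>2) \<partial>M) \<le> ennreal ((1/4) ^ k)" .
  qed auto
  also have "\<dots> < \<infinity>"
  proof -
    have "summable (\<lambda>k. (1/4::real) ^ k)" by (rule summable_geometric) simp
    then show ?thesis by (simp add: suminf_ennreal2)
  qed
  finally have fin: "(\<integral>\<^sup>+x. (\<Sum>k. ennreal (2 ^ k * (d k x)\<^sup>2)) \<partial>M) \<noteq> \<infinity>" by simp
  have "AE x in M. (\<Sum>k. ennreal (2 ^ k * (d k x)\<^sup>2)) \<noteq> \<infinity>"
    by (rule nn_integral_PInf_AE[OF _ fin]) measurable
  then have conv: "AE x in M. convergent (\<lambda>k. f (r k) x)"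
  proof eventually_elim
    case (elim x)
    then obtain C where C: "(\<Sum>k. ennreal (2 ^ k * (d k x)\<^sup>2)) = ennreal C" "C \<ge> 0"
    proof (cases "\<Sum>k. ennreal (2 ^ k * (d k x)\<^sup>2)" rule: ennreal_cases)
      case (real C)
      from that[OF real(2) real(1)] show ?thesis .
    next
      case top
      with elim show ?thesis unfolding infinity_ennreal_def by (rule notE)
    qed
    have "\<bar>d k x\<bar> \<le> sqrt C * (sqrt (1/2)) ^ k" for k
    proof -
      have "ennreal (2 ^ k * (d k x)\<^sup>2) \<le> (\<Sum>k. ennreal (2 ^ k * (d k x)\<^sup>2))"
      proof -
        have "f k \<le> suminf f" for f :: "nat \<Rightarrow> ennreal"
          using sum_le_suminf[OF summableI, of "{k}" f] by simp
        then show ?thesis .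
      qed
      then have "ennreal (2 ^ k * (d k x)\<^sup>2) \<le> ennreal C" unfolding C(1) .
      then have "2 ^ k * (d k x)\<^sup>2 \<le> C" using C(2) by (simp only: ennreal_le_iff)
      then have "(d k x)\<^sup>2 \<le> C / 2 ^ k" by (simp add: field_simps)
      also have "C / 2 ^ k = C * (1/2) ^ k" by (simp add: power_one_over)
      finally have "(d k x)\<^sup>2 \<le> C * (1/2) ^ k" .
      then have "sqrt ((d k x)\<^sup>2) \<le> sqrt (C * (1/2) ^ k)" by (rule real_sqrt_le_mono)
      then show ?thesis unfolding real_sqrt_abs real_sqrt_mult by (simp only: real_sqrt_power)
    qed
    moreover have "summable (\<lambda>k. sqrt C * (sqrt (1/2)) ^ k)"
      by (rule summable_mult, rule summable_geometric) (simp add: real_sqrt_divide)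
    ultimately have "summable (\<lambda>k. d k x)" by (rule_tac summable_comparison_test'[where N=0 and g="\<lambda>k. sqrt C * (sqrt (1/2)) ^ k"]) simp_all
    then have "convergent (\<lambda>n. \<Sum>k<n. d k x)" by (simp add: summable_iff_convergent)
    moreover have "(\<Sum>k<n. d k x) = f (r n) x - f (r 0) x" for n
      unfolding d_def by (rule sum_lessThan_telescope)
    ultimately have "convergent (\<lambda>n. f (r n) x - f (r 0) x)" by simp
    from convergent_add[OF this convergent_const[of "f (r 0) x"]] show ?case by simp
  qed
  define g where "g x = lim (\<lambda>k. f (r k) x)" for x
  have gm[measurable]: "g \<in> borel_measurable M" unfolding g_def by measurable
  have glim: "AE x in M. (\<lambda>k. f (r k) x) \<longlonglongrightarrow> g x"
    using conv by eventually_elim (simp add: g_def convergent_LIMSEQ_iff)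
  have bound: "(\<integral>\<^sup>+x. ennreal ((f j x - g x)\<^sup>2) \<partial>M) \<le> ennreal ((1/8) ^ i)" if j: "j \<ge> N i" for i j
  proof -
    have "(\<integral>\<^sup>+x. ennreal ((f j x - g x)\<^sup>2) \<partial>M) = (\<integral>\<^sup>+x. liminf (\<lambda>k. ennreal ((f j x - f (r k) x)\<^sup>2)) \<partial>M)"
    proof (rule nn_integral_cong_AE, use glim in eventually_elim)
      case (elim x)
      have "(\<lambda>k. ennreal ((f j x - f (r k) x)\<^sup>2)) \<longlonglongrightarrow> ennreal ((f j x - g x)\<^sup>2)"
        by (intro tendsto_ennrealI tendsto_intros elim)
      from lim_imp_Liminf[OF _ this] show ?case by simp
    qed
    also have "\<dots> \<le> liminf (\<lambda>k. \<integral>\<^sup>+x. ennreal ((f j x - f (r k) x)\<^sup>2) \<partial>M)"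
      by (rule nn_integral_liminf) measurable
    also have "\<dots> \<le> liminf (\<lambda>k. ennreal ((1/8) ^ i))"
    proof (rule Liminf_mono, rule eventually_sequentiallyI[of i])
      fix k assume "k \<ge> i"
      have "(\<integral>\<^sup>+x. ennreal ((f j x - f (r k) x)\<^sup>2) \<partial>M) = ennreal (\<integral>x. (f j x - f (r k) x)\<^sup>2 \<partial>M)"
        by (rule nn_integral_eq_integral[OF df]) simp
      also have "\<dots> \<le> ennreal ((1/8) ^ i)"
        using N[OF j r[OF \<open>k \<ge> i\<close>]] by (intro ennreal_leI) simp
      finally show "(\<integral>\<^sup>+x. ennreal ((f j x - f (r k) x)\<^sup>2) \<partial>M) \<le> ennreal ((1/8) ^ i)" .
    qed
    finally show ?thesis by (simp add: Liminf_const)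
  qed
  have dg: "integrable M (\<lambda>x. (f j x - g x)\<^sup>2)" if "j \<ge> N i" for i j
  proof (rule integrableI_bounded)
    have "(\<integral>\<^sup>+x. ennreal (norm ((f j x - g x)\<^sup>2)) \<partial>M) \<le> ennreal ((1/8) ^ i)" using bound[OF that] by simp
    then show "(\<integral>\<^sup>+x. ennreal (norm ((f j x - g x)\<^sup>2)) \<partial>M) < \<infinity>" using le_less_trans ennreal_less_top by fastforce
  qed measurable
  have g2: "integrable M (\<lambda>x. (g x)\<^sup>2)"
    using L2_diff_integrable[OF m _ f2[of "N 0"] dg[of 0 "N 0"]] by simp
  have fg: "integrable M (\<lambda>x. (f k x - g x)\<^sup>2)" for k
    by (rule L2_diff_integrable[OF m gm f2 g2])
  have "(\<lambda>k. \<integral>x. (f k x - g x)\<^sup>2 \<partial>M) \<longlonglongrightarrow> 0"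
  proof (rule LIMSEQ_I)
    fix e :: real assume e: "e > 0"
    obtain i where i: "(1/8::real) ^ i < e" using real_arch_pow_inv[OF e, of "1/8"] by auto
    show "\<exists>n. \<forall>k\<ge>n. norm ((\<integral>x. (f k x - g x)\<^sup>2 \<partial>M) - 0) < e"
    proof (intro exI allI impI)
      fix k assume k: "k \<ge> N i"
      have "ennreal (\<integral>x. (f k x - g x)\<^sup>2 \<partial>M) = (\<integral>\<^sup>+x. ennreal ((f k x - g x)\<^sup>2) \<partial>M)"
        by (rule nn_integral_eq_integral[OF fg, symmetric]) simp
      also have "\<dots> \<le> ennreal ((1/8) ^ i)" by (rule bound[OF k])
      finally have "(\<integral>x. (f k x - g x)\<^sup>2 \<partial>M) \<le> (1/8) ^ i" by (subst (asm) ennreal_le_iff) auto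
      moreover have "(\<integral>x. (f k x - g x)\<^sup>2 \<partial>M) \<ge> 0" by (intro integral_nonneg_AE AE_I2) simp
      ultimately show "norm ((\<integral>x. (f k x - g x)\<^sup>2 \<partial>M) - 0) < e" using i by simp
    qed
  qed
  with gm g2 fg show ?thesis by (rule that)
qed

section \<open>Uniqueness of weak derivatives\<close>

lemma norm_less_imp_mem_cube:
  fixes x :: "real ^ 'n::finite"
  assumes "norm x < r" shows "x \<in> box (\<chi> i. - r) (\<chi> i. r)"
  unfolding mem_box_cart
proof
  fix i show "(\<chi> i. - r) $ i < x $ i \<and> x $ i < (\<chi> i. r) $ i"
    using component_le_norm_cart[of x i] assms by (auto simp: abs_le_iff)
qed

text \<open>Boxes are an intersection-stable generator of the Borel sets, and the Borel sets over
  which \<open>f\<close> has integral 0 form a Dynkin class. So \<open>f\<close> and 0 have the same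
  integral over every Borel set.\<close>

lemma AE_eq_0_if_box_integrals:
  fixes f :: "real ^ 'n::finite \<Rightarrow> real"
  assumes f: "integrable lborel f" and box: "\<And>a b. (LINT x:box a b|lborel. f x) = 0"
  shows "AE x in lborel. f x = 0"
proof -
  have [measurable]: "f \<in> borel_measurable borel" using f by simp
  have si: "set_integrable lborel A f" if "A \<in> sets borel" for A
    unfolding set_integrable_def using f that by (intro integrable_mult_indicator) simp_all
  \<comment> \<open>Closure under complements needs the integral over the whole space, which is not
    a box; it is exhausted by cubes.\<close>
  have total: "(LINT x|lborel. f x) = 0"
  proof -
    let ?B = "\<lambda>k::nat. box (\<chi> i. - real k) (\<chi> i. real k) :: (real ^ 'n) set"
    have "(\<lambda>k. LINT x|lborel. indicator (?B k) x * f x) \<longlonglongrightarrow> (LINT x|lborel. f x)"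
    proof (rule integral_dominated_convergence[where w="\<lambda>x. \<bar>f x\<bar>"])
      show "AE x in lborel. (\<lambda>k. indicator (?B k) x * f x) \<longlonglongrightarrow> f x"
      proof (rule AE_I2, rule tendsto_eventually)
        fix x :: "real ^ 'n"
        obtain k0 where k0: "norm x < real k0" using reals_Archimedean2 by blast
        show "\<forall>\<^sub>F k in sequentially. indicator (?B k) x * f x = f x"
        proof (rule eventually_sequentiallyI[of k0])
          fix k assume "k \<ge> k0"
          then have "x \<in> ?B k" using k0 by (intro norm_less_imp_mem_cube) simp
          then show "indicator (?B k) x * f x = f x" by simp
        qed
      qed
    qed (use f in \<open>auto simp: indicator_def\<close>)
    then show ?thesis using box by (simp add: set_lebesgue_integral_def LIMSEQ_const_iff)
  qed
  have all: "(LINT x:A|lborel. f x) = 0" if "A \<in> sets borel" for A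
  proof -
    have "Int_stable (range (\<lambda>(a, b). box a b :: (real ^ 'n) set))"
      by (auto simp: Int_stable_def box_Int_box)
    moreover have "range (\<lambda>(a, b). box a b :: (real ^ 'n) set) \<subseteq> Pow UNIV" by simp
    moreover have "A \<in> sigma_sets UNIV (range (\<lambda>(a, b). box a b :: (real ^ 'n) set))"
      using that by (simp add: borel_eq_box sets_measure_of)
    ultimately show ?thesis
    proof (induction rule: sigma_sets_induct_disjoint)
      case (basic A)
      then show ?case using box by auto
    next
      case empty
      show ?case by (simp add: set_lebesgue_integral_def)
    next
      case (compl A)
      then have [measurable]: "A \<in> sets borel" by (simp add: borel_eq_box sets_measure_of)
      have "(LINT x|lborel. f x) = (LINT x|lborel. indicator A x * f x + indicator (UNIV - A) x * f x)"
        by (rule Bochner_Integration.integral_cong) (auto simp: indicator_def)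
      also have "\<dots> = (LINT x:A|lborel. f x) + (LINT x:UNIV - A|lborel. f x)"
        unfolding set_lebesgue_integral_def real_scaleR_def
        by (rule Bochner_Integration.integral_add)
          (use si[of A] si[of "UNIV - A"] in \<open>simp_all add: set_integrable_def\<close>)
      finally show ?case using compl total by simp
    next
      case (union A)
      have A: "A i \<in> sets borel" for i 
      proof -
        have "A i \<in> sigma_sets UNIV (range (\<lambda>(a, b). box a b))" using union(2) by blast
        then show ?thesis by (simp add: borel_eq_box sets_measure_of)
      qed
      have "(LINT x:(\<Union>i. A i)|lborel. f x) = (\<Sum>i. LINT x:A i|lborel. f x)"
        by (rule lebesgue_integral_countable_add)
          (use A union(1) si in \<open>auto simp: disjoint_family_on_def\<close>)
      then show ?case using union by simp
    qed
  qed
  show ?thesis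
    by (rule density_unique_real[OF f integrable_zero]) (use all in \<open>simp add: set_lebesgue_integral_def\<close>)
qed

text \<open>The last factor removes a ball around the origin, which the test functions require. For
  \<open>c\<close> tending to 0 the bumps increase the resolution and converge to the indicator of
  \<open>punctured_box a b \<delta>\<close>.\<close>

definition box_bump :: "real ^ 'n::finite \<Rightarrow> real ^ 'n \<Rightarrow> real \<Rightarrow> real \<Rightarrow> real ^ 'n \<Rightarrow> real" where
  "box_bump a b \<delta> c x = (\<Prod>i\<in>UNIV. exp_cutoff c (x $ i - a $ i) * exp_cutoff c (b $ i - x $ i))
     * exp_cutoff c ((\<Sum>i\<in>UNIV. x $ i * x $ i) - \<delta>)"

definition punctured_box :: "real ^ 'n::finite \<Rightarrow> real ^ 'n \<Rightarrow> real \<Rightarrow> (real ^ 'n) set" where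
  "punctured_box a b \<delta> = box a b \<inter> {x. (norm x)\<^sup>2 > \<delta>}"

lemma box_bump_eq_0: "x \<notin> punctured_box a b \<delta> \<Longrightarrow> box_bump a b \<delta> c x = 0"
proof -
  assume "x \<notin> punctured_box a b \<delta>"
  then consider i where "\<not> (a $ i < x $ i \<and> x $ i < b $ i)" | "(norm x)\<^sup>2 \<le> \<delta>"
    by (auto simp: punctured_box_def mem_box_cart)
  then show ?thesis
  proof cases
    case 1
    then have "exp_cutoff c (x $ i - a $ i) * exp_cutoff c (b $ i - x $ i) = 0"
      by (auto simp: exp_cutoff_def)
    then have "(\<Prod>i\<in>UNIV. exp_cutoff c (x $ i - a $ i) * exp_cutoff c (b $ i - x $ i)) = 0"
      by (intro prod_zero) auto
    then show ?thesis unfolding box_bump_def by simp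
  next
    case 2
    then show ?thesis unfolding box_bump_def sum_coord_sq by (simp add: exp_cutoff_def)
  qed
qed

lemma box_bump_bounds: assumes "c > 0" shows "0 \<le> box_bump a b \<delta> c x \<and> box_bump a b \<delta> c x \<le> 1"
proof -
  have "0 \<le> (\<Prod>i\<in>UNIV. exp_cutoff c (x $ i - a $ i) * exp_cutoff c (b $ i - x $ i))"
    by (intro prod_nonneg ballI mult_nonneg_nonneg) (use exp_cutoff_bounds[OF assms] in auto)
  moreover have "(\<Prod>i\<in>UNIV. exp_cutoff c (x $ i - a $ i) * exp_cutoff c (b $ i - x $ i)) \<le> 1"
    by (intro prod_le_1 conjI mult_nonneg_nonneg mult_le_one) (use exp_cutoff_bounds[OF assms] in auto)
  ultimately show ?thesis unfolding box_bump_def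
    using exp_cutoff_bounds[OF assms] by (auto intro!: mult_nonneg_nonneg mult_le_one)
qed

lemma box_bump_tendsto: "(\<lambda>k. box_bump a b \<delta> (1 / Suc k) x) \<longlonglongrightarrow> indicator (punctured_box a b \<delta>) x"
proof (cases "x \<in> punctured_box a b \<delta>")
  case True
  have e: "(\<lambda>k. exp_cutoff (1 / Suc k) t) \<longlonglongrightarrow> 1" if "t > 0" for t
  proof -
    have "(\<lambda>k. exp (- (1 / Suc k) / t)) \<longlonglongrightarrow> exp (- 0 / t)"
      using that by (intro tendsto_intros LIMSEQ_Suc[OF lim_1_over_n]) auto
    then show ?thesis using that by (simp add: exp_cutoff_def)
  qed
  have "(\<lambda>k. box_bump a b \<delta> (1 / Suc k) x) \<longlonglongrightarrow> (\<Prod>i\<in>(UNIV :: 'a set). 1 * 1) * 1"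
    unfolding box_bump_def
    by (intro tendsto_intros e) (use True in \<open>auto simp: punctured_box_def mem_box_cart sum_coord_sq\<close>)
  then show ?thesis using True by simp
qed (simp add: box_bump_eq_0)

lemma test_box_bump:
  assumes "c > 0" "\<delta> > 0" shows "box_bump a b \<delta> c \<in> test_functions"
proof -
  have lin: "smooth (\<lambda>x. x $ i - a $ i)" "smooth (\<lambda>x. b $ i - x $ i)" for i
    by (intro smooth_diff smooth_coord smooth_const)+
  have q: "smooth (\<lambda>x::real ^ 'a. (\<Sum>i\<in>UNIV. x $ i * x $ i) - \<delta>)"
    by (intro smooth_diff smooth_sum smooth_mult smooth_coord smooth_const)
  have "smooth (\<lambda>x. (\<Prod>i\<in>UNIV. exp_cutoff c (x $ i - a $ i) * exp_cutoff c (b $ i - x $ i))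
     * exp_cutoff c ((\<Sum>i\<in>UNIV. x $ i * x $ i) - \<delta>))"
    by (rule smooth_mult[OF smooth_prod[OF smooth_mult[OF smooth_comp1[OF smooth1_exp_cutoff[OF assms(1)] lin(1)]
        smooth_comp1[OF smooth1_exp_cutoff[OF assms(1)] lin(2)]]] smooth_comp1[OF smooth1_exp_cutoff[OF assms(1)] q]])
  then have "smooth (box_bump a b \<delta> c)" unfolding box_bump_def .
  moreover obtain R where R: "\<And>x. x \<in> box a b \<Longrightarrow> norm x \<le> R" using bounded_box[of a b] unfolding bounded_iff by blast
  have "sqrt \<delta> \<le> norm x \<and> norm x \<le> R" if "box_bump a b \<delta> c x \<noteq> 0" for x
  proof -
    have "x \<in> punctured_box a b \<delta>" using that box_bump_eq_0 by blast
    then have "x \<in> box a b" "\<delta> < (norm x)\<^sup>2" by (auto simp: punctured_box_def)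
    moreover have "sqrt \<delta> \<le> sqrt ((norm x)\<^sup>2)" using calculation(2) by (intro real_sqrt_le_mono) simp
    ultimately show ?thesis using R by simp
  qed
  moreover have "sqrt \<delta> > 0" using assms by simp
  ultimately show ?thesis unfolding test_functions_iff by blast
qed

section \<open>The fundamental lemma of the calculus of variations off the origin\<close>

lemma locally_integrable_diff:
  "locally_integrable u \<Longrightarrow> locally_integrable v \<Longrightarrow> locally_integrable (\<lambda>x. u x - v x)"
  unfolding locally_integrable_def by (auto intro!: set_integral_diff(1))

lemma locally_integrable_measurable:
  fixes u :: "real ^ 'n::finite \<Rightarrow> real"
  assumes u: "locally_integrable u" and \<delta>: "\<delta> > 0"
  shows "integrable lebesgue (\<lambda>x. indicator (punctured_box a b \<delta>) x * u x)"
proof -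
  let ?K = "cbox a b \<inter> {x::real ^ 'n. (norm x)\<^sup>2 \<ge> \<delta>}"
  have cl: "closed {x::real ^ 'n. (norm x)\<^sup>2 \<ge> \<delta>}" by (intro closed_Collect_le continuous_intros)
  have "compact ?K" using cl by (intro compact_Int_closed) auto
  moreover have "0 \<notin> ?K" using \<delta> by simp
  ultimately have K: "set_integrable lebesgue ?K u" using u unfolding locally_integrable_def by blast
  have op: "open {x::real ^ 'n. (norm x)\<^sup>2 > \<delta>}" by (intro open_Collect_less continuous_intros)
  have "punctured_box a b \<delta> \<in> sets borel" unfolding punctured_box_def using op by auto
  then have "punctured_box a b \<delta> \<in> sets lebesgue" by simp
  moreover have "punctured_box a b \<delta> \<subseteq> ?K" unfolding punctured_box_def using box_subset_cbox by fastforce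
  ultimately have "set_integrable lebesgue (punctured_box a b \<delta>) u" by (rule set_integrable_subset[OF K])
  then show ?thesis by (simp add: set_integrable_def)
qed

text \<open>Testing with bumps and letting \<open>c\<close> tend to 0 gives integral 0 over every
  punctured box. The intersection of a punctured box with a box is again a punctured box, so the box
  criterion applies to the restriction of \<open>u\<close> to each of them; countably many exhaust
  the space without the origin.\<close>

lemma AE_eq_0_if_test_integrals:
  fixes u :: "real ^ 'n::finite \<Rightarrow> real"
  assumes u: "locally_integrable u" and test: "\<And>\<psi>. \<psi> \<in> test_functions \<Longrightarrow> (LINT x|lebesgue. u x * \<psi> x) = 0"
  shows "AE x in lebesgue. u x = 0"
proof -
  have pb: "(LINT x|lebesgue. indicator (punctured_box a b \<delta>) x * u x) = 0" if \<delta>: "\<delta> > 0" for a b \<delta>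
  proof -
    let ?w = "\<lambda>x. indicator (punctured_box a b \<delta>) x * u x"
    have i: "integrable lebesgue ?w" by (rule locally_integrable_measurable[OF u \<delta>])
    have bm: "box_bump a b \<delta> (1 / Suc k) \<in> borel_measurable lebesgue" for k
      by (rule test_measurable_lebesgue[OF test_box_bump]) (use \<delta> in simp_all)
    have eq: "u x * box_bump a b \<delta> (1 / Suc k) x = ?w x * box_bump a b \<delta> (1 / Suc k) x" for k x
      using box_bump_eq_0[of x a b \<delta>] by (cases "x \<in> punctured_box a b \<delta>") auto
    have "(\<lambda>k. LINT x|lebesgue. ?w x * box_bump a b \<delta> (1 / Suc k) x) \<longlonglongrightarrow> (LINT x|lebesgue. ?w x)"
    proof (rule integral_dominated_convergence[where w="\<lambda>x. \<bar>?w x\<bar>"])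
      show "AE x in lebesgue. (\<lambda>k. ?w x * box_bump a b \<delta> (1 / Suc k) x) \<longlonglongrightarrow> ?w x"
      proof (rule AE_I2)
        fix x
        have "(\<lambda>k. ?w x * box_bump a b \<delta> (1 / Suc k) x) \<longlonglongrightarrow> ?w x * indicator (punctured_box a b \<delta>) x"
          by (intro tendsto_intros box_bump_tendsto)
        then show "(\<lambda>k. ?w x * box_bump a b \<delta> (1 / Suc k) x) \<longlonglongrightarrow> ?w x" by (cases "x \<in> punctured_box a b \<delta>") simp_all
      qed
      show "AE x in lebesgue. norm (?w x * box_bump a b \<delta> (1 / Suc k) x) \<le> \<bar>?w x\<bar>" for k
      proof (rule AE_I2)
        fix x
        have "0 \<le> box_bump a b \<delta> (1 / Suc k) x" "box_bump a b \<delta> (1 / Suc k) x \<le> 1"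
          using box_bump_bounds[of "1 / Suc k" a b \<delta> x] by simp_all
        then show "norm (?w x * box_bump a b \<delta> (1 / Suc k) x) \<le> \<bar>?w x\<bar>"
          unfolding real_norm_def abs_mult by (intro mult_left_le) auto
      qed
      show "(\<lambda>x. ?w x * box_bump a b \<delta> (1 / Suc k) x) \<in> borel_measurable lebesgue" for k
        by (rule borel_measurable_times[OF borel_measurable_integrable[OF i] bm])
    qed (use i in auto)
    moreover have "(LINT x|lebesgue. ?w x * box_bump a b \<delta> (1 / Suc k) x) = 0" for k
      unfolding eq[symmetric] by (rule test, rule test_box_bump) (use \<delta> in simp_all)
    ultimately show ?thesis by (simp add: LIMSEQ_const_iff)
  qed
  have part: "AE x in lebesgue. indicator (punctured_box a b \<delta>) x * u x = 0" if \<delta>: "\<delta> > 0" for a b \<delta>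
  proof -
    let ?w = "\<lambda>x. indicator (punctured_box a b \<delta>) x * u x"
    have i: "integrable lebesgue ?w" by (rule locally_integrable_measurable[OF u \<delta>])
    \<comment> \<open>The box criterion is about Borel functions and \<open>lborel\<close>, whereas
      \<open>u\<close> is only Lebesgue measurable; hence the passage to a Borel
      representative.\<close>
    obtain w where w: "w \<in> borel_measurable lborel" "AE x in lborel. ?w x = w x"
      using completion_ex_borel_measurable_real[OF borel_measurable_integrable[OF i]] by blast
    have w': "AE x in lebesgue. ?w x = w x" using w(2) by (simp add: AE_completion_iff)
    have "integrable lebesgue w"
      by (rule integrable_cong_AE_imp[OF i measurable_completion[OF w(1)] w'])
    then have wi: "integrable lborel w" using integrable_completion[OF w(1)] by simp
    have "(LINT x:box a' b'|lborel. w x) = 0" for a' b'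
    proof -
      obtain a'' b'' where b'': "box a b \<inter> box a' b' = box a'' b''" by (rule that, rule box_Int_box)
      have "(LINT x:box a' b'|lborel. w x) = (LINT x|lebesgue. indicator (box a' b') x * w x)"
        unfolding set_lebesgue_integral_def real_scaleR_def
        by (rule integral_completion[symmetric]) (use w(1) in measurable)
      also have "\<dots> = (LINT x|lebesgue. indicator (punctured_box a'' b'' \<delta>) x * u x)"
      proof (rule integral_cong_AE)
        show "(\<lambda>x. indicator (box a' b') x * w x) \<in> borel_measurable lebesgue"
          by (rule measurable_completion) (use w(1) in measurable)
        show "(\<lambda>x. indicator (punctured_box a'' b'' \<delta>) x * u x) \<in> borel_measurable lebesgue"
          by (rule borel_measurable_integrable[OF locally_integrable_measurable[OF u \<delta>]])
        show "AE x in lebesgue. indicator (box a' b') x * w x = indicator (punctured_box a'' b'' \<delta>) x * u x"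
          using w'
        proof eventually_elim
          case (elim x)
          have "punctured_box a'' b'' \<delta> = box a' b' \<inter> punctured_box a b \<delta>"
            unfolding punctured_box_def b''[symmetric] by blast
          then show ?case unfolding elim[symmetric] by (simp only: indicator_inter_arith mult.assoc)
        qed
      qed
      also have "\<dots> = 0" by (rule pb[OF \<delta>])
      finally show ?thesis .
    qed
    from AE_eq_0_if_box_integrals[OF wi this] have "AE x in lebesgue. w x = 0" by (simp add: AE_completion_iff)
    with w' show ?thesis by eventually_elim simp
  qed
  have "AE x in lebesgue. \<forall>k::nat. indicator (punctured_box (\<chi> i. - real k) (\<chi> i. real k) (1 / Suc k)) x * u x = 0"
    by (subst AE_all_countable) (rule allI, rule part, simp)
  moreover have "AE x in lebesgue. x \<noteq> (0 :: real ^ 'n)"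
    by (subst AE_completion_iff) (rule AE_lborel_singleton)
  ultimately show ?thesis
  proof eventually_elim
    case (elim x)
    obtain k0 where k0: "norm x < real k0" using reals_Archimedean2 by blast
    have "(norm x)\<^sup>2 > 0" using elim by simp
    then obtain k1 where k1: "1 / Suc k1 < (norm x)\<^sup>2" using nat_approx_posE by blast
    define k where "k = max k0 k1"
    have "x \<in> box (\<chi> i. - real k) (\<chi> i. real k)" by (rule norm_less_imp_mem_cube) (use k0 k_def in auto)
    moreover have "1 / real (Suc k) \<le> 1 / real (Suc k1)" unfolding k_def by (intro divide_left_mono) auto
    ultimately have "x \<in> punctured_box (\<chi> i. - real k) (\<chi> i. real k) (1 / Suc k)"
      using k1 by (simp add: punctured_box_def)
    moreover have "indicator (punctured_box (\<chi> i. - real k) (\<chi> i. real k) (1 / Suc k)) x * u x = 0"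
      using elim(1) by (rule spec)
    ultimately show ?case by simp
  qed
qed

section \<open>Identification of weak derivatives\<close>

lemma compact_annulus: "compact {x :: real ^ 'n::finite. r \<le> norm x \<and> norm x \<le> R}"
proof -
  have "{x :: real ^ 'n. r \<le> norm x \<and> norm x \<le> R} = cball 0 R \<inter> {x. r \<le> norm x}" by auto
  moreover have "closed {x :: real ^ 'n. r \<le> norm x}" by (intro closed_Collect_le continuous_intros)
  ultimately show ?thesis by (simp add: compact_Int_closed)
qed

lemma compact_borel: "compact (K :: (real ^ 'n::finite) set) \<Longrightarrow> K \<in> sets borel"
  by (rule borel_compact)

lemma test_compact_supportE:
  assumes "\<psi> \<in> test_functions"
  obtains K where "compact K" "0 \<notin> K" "\<And>x. \<psi> x \<noteq> 0 \<Longrightarrow> x \<in> K"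
proof -
  obtain r R where r: "r > 0" "\<And>x. \<psi> x \<noteq> 0 \<Longrightarrow> r \<le> norm x \<and> norm x \<le> R" using assms by (rule test_functionsE) blast
  show ?thesis
    by (rule that[of "{x. r \<le> norm x \<and> norm x \<le> R}"]) (use r compact_annulus in auto)
qed

lemma locally_integrable_times_test:
  assumes u: "locally_integrable u" and \<psi>: "\<psi> \<in> test_functions"
  shows "integrable lebesgue (\<lambda>x. u x * \<psi> x)"
proof -
  obtain K where K: "compact K" "0 \<notin> K" "\<And>x. \<psi> x \<noteq> 0 \<Longrightarrow> x \<in> K" using \<psi> by (rule test_compact_supportE) blast
  obtain B where B: "\<forall>x. \<bar>\<psi> x\<bar> \<le> B" using test_bounded[OF \<psi>] by blast
  have i: "integrable lebesgue (\<lambda>x. indicator K x * u x)"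
    using u K(1,2) unfolding locally_integrable_def set_integrable_def by simp
  have eq: "u x * \<psi> x = indicator K x * u x * \<psi> x" for x using K(3)[of x] by (cases "\<psi> x = 0") auto
  show ?thesis unfolding eq
  proof (rule Bochner_Integration.integrable_bound)
    show "integrable lebesgue (\<lambda>x. B * (indicator K x * u x))" by (rule integrable_mult_right) (rule i)
    show "(\<lambda>x. indicator K x * u x * \<psi> x) \<in> borel_measurable lebesgue"
      by (rule borel_measurable_times[OF borel_measurable_integrable[OF i] test_measurable_lebesgue[OF \<psi>]])
    show "AE x in lebesgue. norm (indicator K x * u x * \<psi> x) \<le> norm (B * (indicator K x * u x))"
    proof (rule AE_I2)
      fix x
      have "\<bar>\<psi> x\<bar> \<le> \<bar>B\<bar>" using B abs_ge_self order_trans by blast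
      then have "\<bar>indicator K x * u x\<bar> * \<bar>\<psi> x\<bar> \<le> \<bar>indicator K x * u x\<bar> * \<bar>B\<bar>" by (rule mult_left_mono) simp
      then show "norm (indicator K x * u x * \<psi> x) \<le> norm (B * (indicator K x * u x))"
        by (simp only: real_norm_def abs_mult mult_ac)
    qed
  qed
qed

lemma locally_integrable_unique:
  fixes u v :: "real ^ 'n::finite \<Rightarrow> real"
  assumes u: "locally_integrable u" and v: "locally_integrable v"
    and eq: "\<And>\<psi>. \<psi> \<in> test_functions \<Longrightarrow> (LINT x|lebesgue. u x * \<psi> x) = (LINT x|lebesgue. v x * \<psi> x)"
  shows "AE x in lebesgue. u x = v x"
proof -
  have "AE x in lebesgue. u x - v x = 0"
  proof (rule AE_eq_0_if_test_integrals[OF locally_integrable_diff[OF u v]])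
    fix \<psi> :: "real ^ 'n \<Rightarrow> real" assume \<psi>: "\<psi> \<in> test_functions"
    show "(LINT x|lebesgue. (u x - v x) * \<psi> x) = 0"
      using eq[OF \<psi>] locally_integrable_times_test[OF u \<psi>] locally_integrable_times_test[OF v \<psi>]
      by (simp add: left_diff_distrib)
  qed
  then show ?thesis by eventually_elim simp
qed

text \<open>This removes the choice operator: once some weak Laplacian has been exhibited, the
  chosen one agrees with it almost everywhere and can be replaced in every integral.\<close>

lemma weak_laplacian_AE:
  assumes "has_weak_laplacian u h"
  shows "AE x in lebesgue. weak_laplacian u x = h x"
proof -
  have w: "has_weak_laplacian u (weak_laplacian u)" unfolding weak_laplacian_def
    by (rule someI[of "has_weak_laplacian u", OF assms])
  show ?thesis
    by (rule locally_integrable_unique) (use w assms in \<open>simp_all add: has_weak_laplacian_def\<close>)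
qed

lemma weak_gradient_AE:
  assumes "has_weak_gradient u g"
  shows "AE x in lebesgue. weak_gradient u x = g x"
proof -
  have w: "has_weak_gradient u (weak_gradient u)" unfolding weak_gradient_def
    by (rule someI[of "has_weak_gradient u", OF assms])
  have "AE x in lebesgue. weak_gradient u x $ i = g x $ i" for i
  proof (rule locally_integrable_unique)
    fix \<psi> :: "real ^ 'a \<Rightarrow> real" assume "\<psi> \<in> test_functions"
    then have "(LINT x|lebesgue. u x * partial i \<psi> x) = - (LINT x|lebesgue. weak_gradient u x $ i * \<psi> x)"
      "(LINT x|lebesgue. u x * partial i \<psi> x) = - (LINT x|lebesgue. g x $ i * \<psi> x)"
      using w assms unfolding has_weak_gradient_def by blast+
    then show "(LINT x|lebesgue. weak_gradient u x $ i * \<psi> x) = (LINT x|lebesgue. g x $ i * \<psi> x)" by simp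
  qed (use w assms in \<open>simp_all add: has_weak_gradient_def\<close>)
  then have "AE x in lebesgue. \<forall>i\<in>UNIV. weak_gradient u x $ i = g x $ i"
    by (subst AE_ball_countable) (simp_all add: countable_finite)
  then show ?thesis by eventually_elim (simp add: vec_eq_iff)
qed

lemma locally_integrable_borel:
  assumes "h \<in> borel_measurable borel"
    and "\<And>K. compact K \<Longrightarrow> 0 \<notin> K \<Longrightarrow> integrable lborel (\<lambda>x. indicator K x * h x)"
  shows "locally_integrable h"
  unfolding locally_integrable_def
proof (intro allI impI)
  fix K :: "(real ^ 'a) set" assume K: "compact K \<and> 0 \<notin> K"
  then have [measurable]: "K \<in> sets borel" using compact_borel by blast
  have [measurable]: "h \<in> borel_measurable borel" by (rule assms(1))
  have "integrable lebesgue (\<lambda>x. indicator K x * h x)"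
    by (subst integrable_completion) (use assms(2) K in simp_all)
  then show "set_integrable lebesgue K h" by (simp add: set_integrable_def)
qed

lemma locally_integrable_test:
  assumes \<phi>: "\<phi> \<in> test_functions" shows "locally_integrable \<phi>"
proof (rule locally_integrable_borel)
  fix K :: "(real ^ 'a) set" assume "compact K"
  then have "K \<in> sets lborel" using compact_borel by simp
  from integrable_mult_indicator[OF this test_integrable[OF \<phi>]]
  show "integrable lborel (\<lambda>x. indicator K x * \<phi> x)" by simp
qed (use \<phi> in simp)

lemma LINT_completion:
  "f \<in> borel_measurable borel \<Longrightarrow> (LINT x|lebesgue. f x) = (LINT x|(lborel :: (real ^ 'n::finite) measure). f x :: real)"
  by (rule integral_completion) simp

lemma weak_derivatives_test:
  fixes \<phi> :: "real ^ 'n::finite \<Rightarrow> real"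
  assumes \<phi>: "\<phi> \<in> test_functions"
  shows "AE x in lebesgue. weak_gradient \<phi> x = (\<chi> i. partial i \<phi> x)"
    and "AE x in lebesgue. weak_laplacian \<phi> x = laplacian \<phi> x"
proof -
  note s = test_functions_smooth[OF \<phi>]
  have int: "(LINT x|lebesgue. f x * \<psi> x) = (LINT x|lborel. f x * \<psi> x)" if "smooth f" "\<psi> \<in> test_functions" for f \<psi> :: "real ^ 'n \<Rightarrow> real"
    by (rule test_integral_lebesgue(2)[OF test_mult[OF that]])
  have "has_weak_gradient \<phi> (\<lambda>x. \<chi> i. partial i \<phi> x)"
    unfolding has_weak_gradient_def
    by (simp add: locally_integrable_test \<phi> test_partial int s smooth_partial test_parts)
  then show "AE x in lebesgue. weak_gradient \<phi> x = (\<chi> i. partial i \<phi> x)" by (rule weak_gradient_AE)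
  have "has_weak_laplacian \<phi> (laplacian \<phi>)"
    unfolding has_weak_laplacian_def
    by (simp add: locally_integrable_test \<phi> test_laplacian int s test_functions_smooth[OF test_laplacian[OF \<phi>]] test_green)
  then show "AE x in lebesgue. weak_laplacian \<phi> x = laplacian \<phi> x" by (rule weak_laplacian_AE)
qed

section \<open>The space \<open>D\<^sup>2\<^sup>,\<^sup>2\<close>\<close>

text \<open>Multiplication by \<open>norm x powr (a / 2)\<close> reduces the weighted space to the
  ordinary one, where completeness is available; the limit is divided by the same factor. The last
  two conclusions connect weighted convergence with the local one used in the definition of
  \<open>D22\<close>.\<close>

lemma weighted_L2_limit:
  fixes f :: "nat \<Rightarrow> real ^ 'n::finite \<Rightarrow> real"
  assumes test: "\<And>k. f k \<in> test_functions"
    and cauchy: "\<And>e. e > 0 \<Longrightarrow> \<exists>N. \<forall>j\<ge>N. \<forall>k\<ge>N. (LINT x|lborel. norm x powr a * (f j x - f k x)\<^sup>2) < e"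
  obtains h where "h \<in> borel_measurable borel"
    "integrable lborel (\<lambda>x. norm x powr a * (h x)\<^sup>2)"
    "(\<lambda>k. LINT x|lborel. norm x powr a * (f k x)\<^sup>2) \<longlonglongrightarrow> (LINT x|lborel. norm x powr a * (h x)\<^sup>2)"
    "\<And>k. integrable lborel (\<lambda>x. norm x powr a * (f k x - h x)\<^sup>2)"
    "(\<lambda>k. LINT x|lborel. norm x powr a * (f k x - h x)\<^sup>2) \<longlonglongrightarrow> 0"
    "\<And>K. compact K \<Longrightarrow> 0 \<notin> K \<Longrightarrow> integrable lborel (\<lambda>x. indicator K x * h x)"
    "\<And>K. compact K \<Longrightarrow> 0 \<notin> K \<Longrightarrow> (\<lambda>k. LINT x|lborel. indicator K x * \<bar>f k x - h x\<bar>) \<longlonglongrightarrow> 0"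
proof -
  define F where "F k x = norm x powr (a / 2) * f k x" for k x
  have F: "F k \<in> test_functions" for k unfolding F_def by (rule test_powr[OF test])
  have [measurable]: "f k \<in> borel_measurable borel" "F k \<in> borel_measurable borel" for k using F test by simp_all
  have sq: "(norm x powr (a / 2) * y)\<^sup>2 = norm x powr a * y\<^sup>2" for x :: "real ^ 'n" and y
  proof -
    have "(norm x powr (a / 2))\<^sup>2 = norm x powr a" by (simp add: power2_eq_square powr_add[symmetric])
    then show ?thesis by (simp only: power_mult_distrib)
  qed
  have FF: "(F j x - F k x)\<^sup>2 = norm x powr a * (f j x - f k x)\<^sup>2" for j k x
    unfolding F_def right_diff_distrib[symmetric] sq ..
  have F2: "integrable lborel (\<lambda>x. (F k x)\<^sup>2)" for k by (rule test_integrable[OF test_sq[OF F]])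
  obtain g where g: "g \<in> borel_measurable lborel" "integrable lborel (\<lambda>x. (g x)\<^sup>2)"
    "\<And>k. integrable lborel (\<lambda>x. (F k x - g x)\<^sup>2)" "(\<lambda>k. LINT x|lborel. (F k x - g x)\<^sup>2) \<longlonglongrightarrow> 0"
    by (rule L2_complete[of F lborel]) (use F2 cauchy in \<open>simp_all add: FF\<close>)
  have [measurable]: "g \<in> borel_measurable borel" using g(1) by simp
  define h where "h x = norm x powr (- a / 2) * g x" for x
  have h[measurable]: "h \<in> borel_measurable borel" unfolding h_def by measurable
  have gh: "norm x powr (a / 2) * h x = g x" if "x \<noteq> 0" for x
    unfolding h_def using that by (simp add: mult.assoc[symmetric] powr_add[symmetric])
  have ae0: "AE x in lborel. x \<noteq> (0 :: real ^ 'n)" by (rule AE_lborel_singleton)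
  have e1: "AE x in lborel. (g x)\<^sup>2 = norm x powr a * (h x)\<^sup>2"
    using ae0
  proof eventually_elim
    case (elim x)
    show ?case unfolding gh[OF elim, symmetric] sq ..
  qed
  have e2: "AE x in lborel. (F k x - g x)\<^sup>2 = norm x powr a * (f k x - h x)\<^sup>2" for k
    using ae0
  proof eventually_elim
    case (elim x)
    show ?case unfolding gh[OF elim, symmetric] F_def right_diff_distrib[symmetric] sq ..
  qed
  have i1: "integrable lborel (\<lambda>x. norm x powr a * (h x)\<^sup>2)"
    by (rule integrable_cong_AE_imp[OF g(2) _ e1]) simp
  have i2: "integrable lborel (\<lambda>x. norm x powr a * (f k x - h x)\<^sup>2)" for k
    by (rule integrable_cong_AE_imp[OF g(3) _ e2]) simp
  have n1: "(LINT x|lborel. (g x)\<^sup>2) = (LINT x|lborel. norm x powr a * (h x)\<^sup>2)"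
    by (rule integral_cong_AE[OF _ _ e1]) simp_all
  have n2: "(LINT x|lborel. (F k x - g x)\<^sup>2) = (LINT x|lborel. norm x powr a * (f k x - h x)\<^sup>2)" for k
    by (rule integral_cong_AE[OF _ _ e2]) simp_all
  have l1: "(\<lambda>k. LINT x|lborel. norm x powr a * (f k x)\<^sup>2) \<longlonglongrightarrow> (LINT x|lborel. norm x powr a * (h x)\<^sup>2)"
    using L2_norm_tendsto[of F lborel g, OF _ _ g(3) g(2) g(4)] unfolding n1 by (simp add: F_def sq)
  have K: "integrable lborel (\<lambda>x. indicator K x * h x) \<and> (\<lambda>k. LINT x|lborel. indicator K x * \<bar>f k x - h x\<bar>) \<longlonglongrightarrow> 0"
    if Kc: "compact K" "0 \<notin> K" for K :: "(real ^ 'n) set"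
  proof -
    have [measurable]: "K \<in> sets borel" by (rule compact_borel[OF Kc(1)])
    \<comment> \<open>On a compact set away from the origin the inverse weight is bounded, so
      \<open>Y\<close> is square integrable, and the product of \<open>F k - g\<close> with
      \<open>Y\<close> is exactly \<open>f k - h\<close> on \<open>K\<close>.\<close>
    define Y where "Y x = indicator K x * norm x powr (- a / 2)" for x :: "real ^ 'n"
    have Ym[measurable]: "Y \<in> borel_measurable borel" unfolding Y_def by measurable
    have "bounded ((\<lambda>x. norm x powr (- a / 2)) ` K)"
      by (intro compact_imp_bounded compact_continuous_image Kc continuous_intros) (use Kc in auto)
    then obtain B where B: "\<forall>x\<in>K. norm x powr (- a / 2) \<le> B" by (auto simp: bounded_real)
    obtain R where R: "\<forall>x\<in>K. norm x \<le> R" using compact_imp_bounded[OF Kc(1)] bounded_iff by blast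
    have Y2: "integrable lborel (\<lambda>x. (Y x)\<^sup>2)"
    proof (rule integrable_bounded_supportN[of _ R "B\<^sup>2"])
      show "(Y x)\<^sup>2 = 0" if "R < norm x" for x
      proof -
        have "x \<notin> K" using R that by fastforce
        then show ?thesis by (simp add: Y_def)
      qed
      show "\<bar>(Y x)\<^sup>2\<bar> \<le> B\<^sup>2" for x
      proof (cases "x \<in> K")
        case True
        then show ?thesis using B by (simp add: Y_def power_mono)
      qed (simp add: Y_def)
    qed simp
    have p: "integrable lborel (\<lambda>x. (F k x - g x) * Y x)" "(\<lambda>k. LINT x|lborel. \<bar>(F k x - g x) * Y x\<bar>) \<longlonglongrightarrow> 0" for k
      by (rule L2_product_tendsto_0[OF _ _ g(3) Y2 g(4)]; simp)+
    have eq: "(F k x - g x) * Y x = indicator K x * (f k x - h x)" for k x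
    proof (cases "x \<in> K")
      case True
      then have x: "x \<noteq> 0" using Kc(2) by auto
      have "(F k x - g x) * Y x = (norm x powr (a / 2) * norm x powr (- a / 2)) * (f k x - h x)"
        using True by (simp add: F_def Y_def gh[OF x, symmetric] algebra_simps)
      also have "norm x powr (a / 2) * norm x powr (- a / 2) = 1" using x by (simp add: powr_add[symmetric])
      finally show ?thesis using True by simp
    qed (simp add: Y_def)
    have "integrable lborel (\<lambda>x. indicator K x * f 0 x - indicator K x * (f 0 x - h x))"
    proof (rule Bochner_Integration.integrable_diff)
      show "integrable lborel (\<lambda>x. indicator K x * (f 0 x - h x))" using p(1)[of 0] unfolding eq .
      show "integrable lborel (\<lambda>x. indicator K x * f 0 x)"
        using integrable_mult_indicator[OF _ test_integrable[OF test[of 0]], of K] by simp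
    qed
    then have "integrable lborel (\<lambda>x. indicator K x * h x)" by (simp add: right_diff_distrib)
    moreover have "(\<lambda>k. LINT x|lborel. indicator K x * \<bar>f k x - h x\<bar>) \<longlonglongrightarrow> 0"
      using p(2) unfolding eq by (simp add: abs_mult)
    ultimately show ?thesis by blast
  qed
  show ?thesis
    by (rule that[OF h i1 l1 i2]) (use g(4) K in \<open>simp_all add: n2\<close>)
qed

lemma integrable_indicator_abs_diff:
  fixes f h :: "real ^ 'n::finite \<Rightarrow> real"
  assumes f: "f \<in> test_functions" and K: "K \<in> sets borel" and h: "integrable lborel (\<lambda>x. indicator K x * h x)"
  shows "integrable lborel (\<lambda>x. indicator K x * \<bar>f x - h x\<bar>)"
proof -
  have "integrable lborel (\<lambda>x. indicator K x * f x - indicator K x * h x)"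
    using integrable_mult_indicator[OF _ test_integrable[OF f], of K] K h by simp
  then have "integrable lborel (\<lambda>x. \<bar>indicator K x * f x - indicator K x * h x\<bar>)" by (rule integrable_abs)
  moreover have "\<bar>indicator K x * f x - indicator K x * h x\<bar> = indicator K x * \<bar>f x - h x\<bar>" for x
    by (simp add: indicator_def)
  ultimately show ?thesis by simp
qed

lemma pairing_tendsto:
  fixes f :: "nat \<Rightarrow> real ^ 'n::finite \<Rightarrow> real"
  assumes test: "\<And>k. f k \<in> test_functions" and h[measurable]: "h \<in> borel_measurable borel"
    and int: "\<And>K. compact K \<Longrightarrow> 0 \<notin> K \<Longrightarrow> integrable lborel (\<lambda>x. indicator K x * h x)"
    and lim: "\<And>K. compact K \<Longrightarrow> 0 \<notin> K \<Longrightarrow> (\<lambda>k. LINT x|lborel. indicator K x * \<bar>f k x - h x\<bar>) \<longlonglongrightarrow> 0"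
    and \<psi>: "\<psi> \<in> test_functions"
  shows "(\<lambda>k. LINT x|lborel. f k x * \<psi> x) \<longlonglongrightarrow> (LINT x|lborel. h x * \<psi> x)"
proof -
  obtain K where K: "compact K" "0 \<notin> K" "\<And>x. \<psi> x \<noteq> 0 \<Longrightarrow> x \<in> K" using \<psi> by (rule test_compact_supportE) blast
  have [measurable]: "K \<in> sets borel" by (rule compact_borel[OF K(1)])
  obtain B where B: "\<forall>x. \<bar>\<psi> x\<bar> \<le> B" using test_bounded[OF \<psi>] by blast
  have [measurable]: "f k \<in> borel_measurable borel" "\<psi> \<in> borel_measurable borel" for k using test \<psi> by simp_all
  have "integrable lebesgue (\<lambda>x. h x * \<psi> x)"
    by (rule locally_integrable_times_test[OF locally_integrable_borel[OF h int] \<psi>])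
  then have hi: "integrable lborel (\<lambda>x. h x * \<psi> x)" by (subst (asm) integrable_completion) simp_all
  have fi: "integrable lborel (\<lambda>x. f k x * \<psi> x)" for k
    by (rule test_mult_integrable(1)[OF test_functions_smooth[OF test] \<psi>])
  have Ki: "integrable lborel (\<lambda>x. indicator K x * \<bar>f k x - h x\<bar>)" for k
    by (rule integrable_indicator_abs_diff[OF test _ int[OF K(1,2)]]) simp
  have "(\<lambda>k. (LINT x|lborel. f k x * \<psi> x) - (LINT x|lborel. h x * \<psi> x)) \<longlonglongrightarrow> 0"
  proof (rule Lim_null_comparison)
    show "\<forall>\<^sub>F k in sequentially. norm ((LINT x|lborel. f k x * \<psi> x) - (LINT x|lborel. h x * \<psi> x))
      \<le> B * (LINT x|lborel. indicator K x * \<bar>f k x - h x\<bar>)"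
    proof (intro always_eventually allI)
      fix k
      have "(LINT x|lborel. f k x * \<psi> x) - (LINT x|lborel. h x * \<psi> x) = (LINT x|lborel. f k x * \<psi> x - h x * \<psi> x)"
        using fi hi by simp
      also have "norm \<dots> \<le> (LINT x|lborel. norm (f k x * \<psi> x - h x * \<psi> x))" by (rule integral_norm_bound)
      also have "\<dots> \<le> (LINT x|lborel. B * (indicator K x * \<bar>f k x - h x\<bar>))"
      proof (rule integral_mono)
        fix x
        have "f k x * \<psi> x - h x * \<psi> x = \<psi> x * (f k x - h x)" by (simp add: algebra_simps)
        then have "norm (f k x * \<psi> x - h x * \<psi> x) = \<bar>\<psi> x\<bar> * \<bar>f k x - h x\<bar>"
          by (simp only: real_norm_def abs_mult)
        also have "\<dots> \<le> B * (indicator K x * \<bar>f k x - h x\<bar>)"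
        proof (cases "\<psi> x = 0")
          case True
          have "B \<ge> 0" using B abs_ge_zero order_trans by blast
          then show ?thesis using True by (simp add: indicator_def)
        next
          case False
          then show ?thesis using K(3)[OF False] B by (simp add: mult_right_mono)
        qed
        finally show "norm (f k x * \<psi> x - h x * \<psi> x) \<le> B * (indicator K x * \<bar>f k x - h x\<bar>)" .
      qed (use fi hi Ki in auto)
      also have "\<dots> = B * (LINT x|lborel. indicator K x * \<bar>f k x - h x\<bar>)" by simp
      finally show "norm ((LINT x|lborel. f k x * \<psi> x) - (LINT x|lborel. h x * \<psi> x))
        \<le> B * (LINT x|lborel. indicator K x * \<bar>f k x - h x\<bar>)" .
    qed
    show "(\<lambda>k. B * (LINT x|lborel. indicator K x * \<bar>f k x - h x\<bar>)) \<longlonglongrightarrow> 0"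
      using tendsto_mult_right_zero[OF lim[OF K(1,2)]] by simp
  qed
  then show ?thesis by (subst LIM_zero_iff[symmetric])
qed

text \<open>The limit produced by completeness is a priori unrelated to the given \<open>u\<close>.
  Both are local limits of the same sequence, hence equal on each compact set off the origin, and
  countably many annuli suffice.\<close>

lemma L1_limit_AE_unique:
  fixes u h :: "real ^ 'n::finite \<Rightarrow> real"
  assumes um: "u \<in> borel_measurable lebesgue" and h: "h \<in> borel_measurable borel"
    and test: "\<And>k. f k \<in> test_functions"
    and int: "\<And>K. compact K \<Longrightarrow> 0 \<notin> K \<Longrightarrow> integrable lborel (\<lambda>x. indicator K x * h x)"
    and lim: "\<And>K. compact K \<Longrightarrow> 0 \<notin> K \<Longrightarrow> (\<lambda>k. LINT x|lborel. indicator K x * \<bar>f k x - h x\<bar>) \<longlonglongrightarrow> 0"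
    and limu: "\<And>K. compact K \<Longrightarrow> 0 \<notin> K \<Longrightarrow> (\<lambda>k. \<integral>\<^sup>+x\<in>K. ennreal \<bar>f k x - u x\<bar> \<partial>lebesgue) \<longlonglongrightarrow> 0"
  shows "AE x in lebesgue. u x = h x"
proof -
  have hm[measurable]: "h \<in> borel_measurable borel" by (rule h)
  have fm[measurable]: "f k \<in> borel_measurable borel" for k using test by simp
  note m = um measurable_completion[of h lborel borel, simplified] test_measurable_lebesgue[OF test]
  have part: "AE x in lebesgue. x \<in> K \<longrightarrow> u x = h x" if K: "compact K" "0 \<notin> K" for K :: "(real ^ 'n) set"
  proof -
    have KB[measurable]: "K \<in> sets borel" by (rule compact_borel[OF K(1)])
    have KL: "K \<in> sets lebesgue" using KB by simp
    have Ki: "integrable lborel (\<lambda>x. indicator K x * \<bar>f k x - h x\<bar>)" for k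
      by (rule integrable_indicator_abs_diff[OF test _ int[OF K]]) simp
    have conv: "(\<integral>\<^sup>+x\<in>K. ennreal \<bar>f k x - h x\<bar> \<partial>lebesgue) = ennreal (LINT x|lborel. indicator K x * \<bar>f k x - h x\<bar>)" for k
    proof -
      have "(\<integral>\<^sup>+x\<in>K. ennreal \<bar>f k x - h x\<bar> \<partial>lebesgue) = (\<integral>\<^sup>+x. ennreal (indicator K x * \<bar>f k x - h x\<bar>) \<partial>lborel)"
        by (subst nn_integral_completion) (auto intro!: nn_integral_cong simp: indicator_def)
      also have "\<dots> = ennreal (LINT x|lborel. indicator K x * \<bar>f k x - h x\<bar>)"
        by (rule nn_integral_eq_integral[OF Ki]) (simp add: indicator_def)
      finally show ?thesis .
    qed
    have le: "(\<integral>\<^sup>+x\<in>K. ennreal \<bar>u x - h x\<bar> \<partial>lebesgue)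
       \<le> (\<integral>\<^sup>+x\<in>K. ennreal \<bar>f k x - u x\<bar> \<partial>lebesgue) + (\<integral>\<^sup>+x\<in>K. ennreal \<bar>f k x - h x\<bar> \<partial>lebesgue)" for k
    proof -
      have "(\<integral>\<^sup>+x\<in>K. ennreal \<bar>u x - h x\<bar> \<partial>lebesgue)
         \<le> (\<integral>\<^sup>+x. ennreal \<bar>f k x - u x\<bar> * indicator K x + ennreal \<bar>f k x - h x\<bar> * indicator K x \<partial>lebesgue)"
      proof (rule nn_integral_mono)
        fix x
        have "ennreal \<bar>u x - h x\<bar> \<le> ennreal (\<bar>f k x - u x\<bar> + \<bar>f k x - h x\<bar>)" by (rule ennreal_leI) simp
        then show "ennreal \<bar>u x - h x\<bar> * indicator K x \<le> ennreal \<bar>f k x - u x\<bar> * indicator K x + ennreal \<bar>f k x - h x\<bar> * indicator K x"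
          by (simp add: indicator_def)
      qed
      also have "\<dots> = (\<integral>\<^sup>+x\<in>K. ennreal \<bar>f k x - u x\<bar> \<partial>lebesgue) + (\<integral>\<^sup>+x\<in>K. ennreal \<bar>f k x - h x\<bar> \<partial>lebesgue)"
        by (rule nn_integral_add) (use m KL in measurable)
      finally show ?thesis .
    qed
    have "(\<lambda>k. (\<integral>\<^sup>+x\<in>K. ennreal \<bar>f k x - u x\<bar> \<partial>lebesgue) + (\<integral>\<^sup>+x\<in>K. ennreal \<bar>f k x - h x\<bar> \<partial>lebesgue)) \<longlonglongrightarrow> 0 + ennreal 0"
      unfolding conv by (intro tendsto_add limu K tendsto_ennrealI lim)
    from LIMSEQ_le_const[OF this] le have "(\<integral>\<^sup>+x\<in>K. ennreal \<bar>u x - h x\<bar> \<partial>lebesgue) \<le> 0 + ennreal 0" by blast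
    then have "(\<integral>\<^sup>+x\<in>K. ennreal \<bar>u x - h x\<bar> \<partial>lebesgue) = 0" by simp
    then have "AE x in lebesgue. ennreal \<bar>u x - h x\<bar> * indicator K x = 0"
      by (subst (asm) nn_integral_0_iff_AE) (use m KL in measurable)
    then show ?thesis by eventually_elim (auto simp: indicator_def split: if_splits)
  qed
  have "AE x in lebesgue. \<forall>j::nat. x \<in> {x. 1 / Suc j \<le> norm x \<and> norm x \<le> Suc j} \<longrightarrow> u x = h x"
    by (subst AE_all_countable) (rule allI, rule part, rule compact_annulus, simp)
  moreover have "AE x in lebesgue. x \<noteq> (0 :: real ^ 'n)"
    by (subst AE_completion_iff) (rule AE_lborel_singleton)
  ultimately show ?thesis
  proof eventually_elim
    case (elim x)
    obtain i where i: "norm x < real i" using reals_Archimedean2 by blast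
    have "norm x > 0" using elim by simp
    then obtain j where j: "1 / Suc j < norm x" using nat_approx_posE by blast
    define k where "k = max i j"
    have "1 / real (Suc k) \<le> 1 / real (Suc j)" unfolding k_def by (intro divide_left_mono) auto
    then have "x \<in> {x. 1 / Suc k \<le> norm x \<and> norm x \<le> Suc k}" using i j by (auto simp: k_def)
    with elim(1) show ?case by blast
  qed
qed

text \<open>The Hardy-Rellich inequality, applied to differences, turns a sequence that is Cauchy in
  the norm of the Laplacian into one that is also Cauchy for the function and for each partial
  derivative in the respective weights. The limits are weak derivatives because pairing with a test
  function is continuous under local convergence. So every term of the numerator is a limit of the
  same term for test functions, and it is integrable, which excludes the default value 0 of the
  integral.\<close>

lemma D22_limits:
  fixes u :: "real ^ 'n::finite \<Rightarrow> real"
  assumes u: "u \<in> D22 \<alpha>" and c: "c = (\<alpha> + 2) * (real CARD('n) - 4 - \<alpha>) / 2" "c > 0"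
  obtains \<phi> h where
    "\<And>k. \<phi> k \<in> test_functions" "h \<in> borel_measurable borel" "AE x in lebesgue. u x = h x"
    "integrable lborel (\<lambda>x. norm x powr (- \<alpha> - 4) * (h x)\<^sup>2)"
    "\<And>k. integrable lborel (\<lambda>x. norm x powr (- \<alpha> - 4) * (\<phi> k x - h x)\<^sup>2)"
    "(\<lambda>k. LINT x|lborel. norm x powr (- \<alpha> - 4) * (\<phi> k x - h x)\<^sup>2) \<longlonglongrightarrow> 0"
    "(\<lambda>k. LINT x|lborel. norm x powr (- \<alpha> - 4) * (\<phi> k x)\<^sup>2) \<longlonglongrightarrow> (LINT x|lborel. norm x powr (- \<alpha> - 4) * (h x)\<^sup>2)"
    "integrable lebesgue (\<lambda>x. norm x powr (- \<alpha> - 2) * (norm (weak_gradient u x))\<^sup>2)"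
    "(\<lambda>k. LINT x|lborel. norm x powr (- \<alpha> - 2) * gradsq (\<phi> k) x) \<longlonglongrightarrow>
       (LINT x|lebesgue. norm x powr (- \<alpha> - 2) * (norm (weak_gradient u x))\<^sup>2)"
    "integrable lebesgue (\<lambda>x. norm x powr (- \<alpha>) * \<bar>weak_laplacian u x\<bar>\<^sup>2)"
    "(\<lambda>k. LINT x|lborel. norm x powr (- \<alpha>) * (laplacian (\<phi> k) x)\<^sup>2) \<longlonglongrightarrow>
       (LINT x|lebesgue. norm x powr (- \<alpha>) * \<bar>weak_laplacian u x\<bar>\<^sup>2)"
proof -
  have ux: "u \<in> borel_measurable lebesgue \<and> (\<exists>\<phi>. (\<forall>k::nat. \<phi> k \<in> test_functions) \<and>
      (\<forall>e>0. \<exists>N. \<forall>j\<ge>N. \<forall>k\<ge>N. D22_norm \<alpha> (\<lambda>x. \<phi> j x - \<phi> k x) < e) \<and>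
      (\<forall>K. compact K \<and> 0 \<notin> K \<longrightarrow> (\<lambda>k. \<integral>\<^sup>+x\<in>K. ennreal \<bar>\<phi> k x - u x\<bar> \<partial>lebesgue) \<longlonglongrightarrow> 0))"
    using u unfolding D22_def mem_Collect_eq .
  note um = ux[THEN conjunct1]
  obtain \<phi> where \<phi>0: "(\<forall>k::nat. \<phi> k \<in> test_functions) \<and>
      (\<forall>e>0. \<exists>N. \<forall>j\<ge>N. \<forall>k\<ge>N. D22_norm \<alpha> (\<lambda>x. \<phi> j x - \<phi> k x) < e) \<and>
      (\<forall>K. compact K \<and> 0 \<notin> K \<longrightarrow> (\<lambda>k. \<integral>\<^sup>+x\<in>K. ennreal \<bar>\<phi> k x - u x\<bar> \<partial>lebesgue) \<longlonglongrightarrow> 0)"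
    using ux[THEN conjunct2] by (rule exE)
  have \<phi>: "\<phi> k \<in> test_functions" for k using \<phi>0[THEN conjunct1] by (rule spec)
  note cauchy = \<phi>0[THEN conjunct2, THEN conjunct1, rule_format]
  have limu: "(\<lambda>k. \<integral>\<^sup>+x\<in>K. ennreal \<bar>\<phi> k x - u x\<bar> \<partial>lebesgue) \<longlonglongrightarrow> 0" if "compact K" "0 \<notin> K" for K
    using \<phi>0[THEN conjunct2, THEN conjunct2, THEN spec, THEN mp, OF conjI[OF that]] .
  note s = test_functions_smooth[OF \<phi>]
  have D: "(\<lambda>x. \<phi> j x - \<phi> k x) \<in> test_functions" for j k by (rule test_diff[OF \<phi> \<phi>])
  define L where "L j k = (LINT x|lborel. norm x powr (- \<alpha>) * (laplacian (\<lambda>x. \<phi> j x - \<phi> k x) x)\<^sup>2)" for j k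
  have norm_L: "D22_norm \<alpha> (\<lambda>x. \<phi> j x - \<phi> k x) = sqrt (L j k)" for j k
    unfolding D22_norm_def L_def power2_abs
    by (simp add: test_integral_lebesgue(2)[OF test_powr[OF test_sq[OF test_laplacian[OF D]]]])
  have L: "\<exists>N. \<forall>j\<ge>N. \<forall>k\<ge>N. L j k < e" if "e > 0" for e
  proof -
    from cauchy[of "sqrt e"] that obtain N where "\<forall>j\<ge>N. \<forall>k\<ge>N. sqrt (L j k) < sqrt e"
      unfolding norm_L by auto
    then show ?thesis by (auto simp: real_sqrt_less_iff)
  qed
  note hr = hardy_rellich[OF D c, folded L_def]
  have Z_le: "(LINT x|lborel. norm x powr (- \<alpha> - 4) * (\<phi> j x - \<phi> k x)\<^sup>2) \<le> L j k / c\<^sup>2" for j k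
  proof -
    have "(LINT x|lborel. norm x powr (- \<alpha> - 2) * gradsq (\<lambda>x. \<phi> j x - \<phi> k x) x) \<ge> 0"
      by (intro integral_nonneg_AE AE_I2) (simp add: gradsq_def sum_nonneg)
    with hr[of j k] have "c / 2 * (LINT x|lborel. norm x powr (- \<alpha> - 4) * (\<phi> j x - \<phi> k x)\<^sup>2) \<le> 1 / (2 * c) * L j k" by simp
    then show ?thesis using c(2) by (simp add: field_simps power2_eq_square)
  qed
  have G_le: "(LINT x|lborel. norm x powr (- \<alpha> - 2) * (partial i (\<phi> j) x - partial i (\<phi> k) x)\<^sup>2) \<le> L j k / (2 * c)" for i j k
  proof -
    have "(LINT x|lborel. norm x powr (- \<alpha> - 2) * (partial i (\<phi> j) x - partial i (\<phi> k) x)\<^sup>2)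
      \<le> (LINT x|lborel. norm x powr (- \<alpha> - 2) * gradsq (\<lambda>x. \<phi> j x - \<phi> k x) x)"
    proof (rule integral_mono)
      show "integrable lborel (\<lambda>x. norm x powr (- \<alpha> - 2) * (partial i (\<phi> j) x - partial i (\<phi> k) x)\<^sup>2)"
        by (intro test_integrable test_powr test_sq test_diff test_partial \<phi>)
      show "integrable lborel (\<lambda>x. norm x powr (- \<alpha> - 2) * gradsq (\<lambda>x. \<phi> j x - \<phi> k x) x)"
        by (intro test_integrable test_powr test_gradsq D)
      fix x
      have "(partial i (\<phi> j) x - partial i (\<phi> k) x)\<^sup>2 \<le> gradsq (\<lambda>x. \<phi> j x - \<phi> k x) x"
        unfolding gradsq_def partial_diff[OF s s] by (rule member_le_sum) auto
      then show "norm x powr (- \<alpha> - 2) * (partial i (\<phi> j) x - partial i (\<phi> k) x)\<^sup>2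
          \<le> norm x powr (- \<alpha> - 2) * gradsq (\<lambda>x. \<phi> j x - \<phi> k x) x"
        by (rule mult_left_mono) simp
    qed
    moreover have "(LINT x|lborel. norm x powr (- \<alpha> - 4) * (\<phi> j x - \<phi> k x)\<^sup>2) \<ge> 0"
      by (intro integral_nonneg_AE AE_I2) simp
    then have "c / 2 * (LINT x|lborel. norm x powr (- \<alpha> - 4) * (\<phi> j x - \<phi> k x)\<^sup>2) \<ge> 0" using c(2) by simp
    ultimately show ?thesis using hr[of j k] by simp
  qed
  have small: "\<exists>N. \<forall>j\<ge>N. \<forall>k\<ge>N. I j k < e" if sm: "e > 0" "d > 0" "\<And>j k. I j k \<le> L j k / d" for I e d
  proof -
    obtain N where "\<forall>j\<ge>N. \<forall>k\<ge>N. L j k < e * d" using L[of "e * d"] sm(1,2) by auto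
    then have "\<forall>j\<ge>N. \<forall>k\<ge>N. L j k / d < e" using sm(2) by (simp add: pos_divide_less_eq)
    then show ?thesis using sm(3) le_less_trans by blast
  qed
  obtain h where h: "h \<in> borel_measurable borel"
    "integrable lborel (\<lambda>x. norm x powr (- \<alpha> - 4) * (h x)\<^sup>2)"
    "(\<lambda>k. LINT x|lborel. norm x powr (- \<alpha> - 4) * (\<phi> k x)\<^sup>2) \<longlonglongrightarrow> (LINT x|lborel. norm x powr (- \<alpha> - 4) * (h x)\<^sup>2)"
    "\<And>k. integrable lborel (\<lambda>x. norm x powr (- \<alpha> - 4) * (\<phi> k x - h x)\<^sup>2)"
    "(\<lambda>k. LINT x|lborel. norm x powr (- \<alpha> - 4) * (\<phi> k x - h x)\<^sup>2) \<longlonglongrightarrow> 0"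
    "\<And>K. compact K \<Longrightarrow> 0 \<notin> K \<Longrightarrow> integrable lborel (\<lambda>x. indicator K x * h x)"
    "\<And>K. compact K \<Longrightarrow> 0 \<notin> K \<Longrightarrow> (\<lambda>k. LINT x|lborel. indicator K x * \<bar>\<phi> k x - h x\<bar>) \<longlonglongrightarrow> 0"
    by (rule weighted_L2_limit[of \<phi> "- \<alpha> - 4", OF \<phi> small[OF _ _ Z_le]]) (use c(2) in \<open>simp_all\<close>)
  have uh: "AE x in lebesgue. u x = h x"
    by (rule L1_limit_AE_unique[OF um h(1) \<phi> h(6) h(7) limu])
  \<comment> \<open>All properties of the limit are collected in one predicate, so that one limit
    can be chosen for each coordinate \<open>i\<close>.\<close>
  define Q where "Q i g \<longleftrightarrow> g \<in> borel_measurable borel \<and>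
    integrable lborel (\<lambda>x. norm x powr (- \<alpha> - 2) * (g x)\<^sup>2) \<and>
    (\<lambda>k. LINT x|lborel. norm x powr (- \<alpha> - 2) * (partial i (\<phi> k) x)\<^sup>2) \<longlonglongrightarrow> (LINT x|lborel. norm x powr (- \<alpha> - 2) * (g x)\<^sup>2) \<and>
    (\<forall>K. compact K \<longrightarrow> 0 \<notin> K \<longrightarrow> integrable lborel (\<lambda>x. indicator K x * g x)) \<and>
    (\<forall>K. compact K \<longrightarrow> 0 \<notin> K \<longrightarrow> (\<lambda>k. LINT x|lborel. indicator K x * \<bar>partial i (\<phi> k) x - g x\<bar>) \<longlonglongrightarrow> 0)" for i g
  have "\<exists>g. Q i g" for i
    by (rule weighted_L2_limit[of "\<lambda>k. partial i (\<phi> k)" "- \<alpha> - 2", OF test_partial[OF \<phi>] small[OF _ _ G_le]])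
      (use c(2) in \<open>simp_all, unfold Q_def, blast\<close>)
  then obtain g where Q: "\<And>i. Q i (g i)" by metis
  have g: "g i \<in> borel_measurable borel"
    "integrable lborel (\<lambda>x. norm x powr (- \<alpha> - 2) * (g i x)\<^sup>2)"
    "(\<lambda>k. LINT x|lborel. norm x powr (- \<alpha> - 2) * (partial i (\<phi> k) x)\<^sup>2) \<longlonglongrightarrow> (LINT x|lborel. norm x powr (- \<alpha> - 2) * (g i x)\<^sup>2)"
    "compact K \<Longrightarrow> 0 \<notin> K \<Longrightarrow> integrable lborel (\<lambda>x. indicator K x * g i x)"
    "compact K \<Longrightarrow> 0 \<notin> K \<Longrightarrow> (\<lambda>k. LINT x|lborel. indicator K x * \<bar>partial i (\<phi> k) x - g i x\<bar>) \<longlonglongrightarrow> 0" for i K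
    using Q[of i] unfolding Q_def by simp_all
  have lap_diff: "laplacian (\<phi> j) x - laplacian (\<phi> k) x = laplacian (\<lambda>x. \<phi> j x - \<phi> k x) x" for j k x
    by (simp add: laplacian_diff[OF s s])
  obtain w where w: "w \<in> borel_measurable borel"
    "integrable lborel (\<lambda>x. norm x powr (- \<alpha>) * (w x)\<^sup>2)"
    "(\<lambda>k. LINT x|lborel. norm x powr (- \<alpha>) * (laplacian (\<phi> k) x)\<^sup>2) \<longlonglongrightarrow> (LINT x|lborel. norm x powr (- \<alpha>) * (w x)\<^sup>2)"
    "\<And>K. compact K \<Longrightarrow> 0 \<notin> K \<Longrightarrow> integrable lborel (\<lambda>x. indicator K x * w x)"
    "\<And>K. compact K \<Longrightarrow> 0 \<notin> K \<Longrightarrow> (\<lambda>k. LINT x|lborel. indicator K x * \<bar>laplacian (\<phi> k) x - w x\<bar>) \<longlonglongrightarrow> 0"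
    by (rule weighted_L2_limit[of "\<lambda>k. laplacian (\<phi> k)" "- \<alpha>", OF test_laplacian[OF \<phi>]])
      (use L in \<open>simp_all add: lap_diff L_def\<close>)
  have loc: "locally_integrable h" "locally_integrable w" "locally_integrable (g i)" for i
    by (rule locally_integrable_borel[OF h(1) h(6)], assumption+,
        rule locally_integrable_borel[OF w(1) w(4)], assumption+,
        rule locally_integrable_borel[OF g(1) g(4)], assumption+)
  have locu: "locally_integrable u"
    unfolding locally_integrable_def
  proof (intro allI impI)
    fix K :: "(real ^ 'n) set" assume K: "compact K \<and> 0 \<notin> K"
    then have KL: "K \<in> sets lebesgue" using compact_borel[of K] by simp
    have "integrable lebesgue (\<lambda>x. indicator K x * h x)"
      using loc(1) K unfolding locally_integrable_def set_integrable_def by simp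
    moreover have "(\<lambda>x. indicator K x * u x) \<in> borel_measurable lebesgue"
      by (intro borel_measurable_times borel_measurable_indicator KL um)
    moreover have "AE x in lebesgue. indicator K x * h x = indicator K x * u x" using uh by eventually_elim simp
    ultimately have "integrable lebesgue (\<lambda>x. indicator K x * u x)" by (rule integrable_cong_AE_imp)
    then show "set_integrable lebesgue K u" by (simp add: set_integrable_def)
  qed
  have mh: "h \<in> borel_measurable lebesgue" by (rule measurable_completion) (use h(1) in simp)
  have pair_u: "(LINT x|lebesgue. u x * \<psi> x) = (LINT x|lborel. h x * \<psi> x)" if \<psi>: "\<psi> \<in> test_functions" for \<psi>
  proof -
    have "(LINT x|lebesgue. u x * \<psi> x) = (LINT x|lebesgue. h x * \<psi> x)"
    proof (rule integral_cong_AE)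
      show "AE x in lebesgue. u x * \<psi> x = h x * \<psi> x" using uh by eventually_elim simp
    qed (rule borel_measurable_times[OF um test_measurable_lebesgue[OF \<psi>]],
        rule borel_measurable_times[OF mh test_measurable_lebesgue[OF \<psi>]])
    also have "\<dots> = (LINT x|lborel. h x * \<psi> x)" by (rule LINT_completion) (use h(1) \<psi> in simp)
    finally show ?thesis .
  qed
  have pair_h: "(\<lambda>k. LINT x|lborel. \<phi> k x * \<psi> x) \<longlonglongrightarrow> (LINT x|lborel. h x * \<psi> x)" if "\<psi> \<in> test_functions" for \<psi>
    by (rule pairing_tendsto[OF \<phi> h(1) h(6) h(7) that])
  have "has_weak_laplacian u w"
    unfolding has_weak_laplacian_def
  proof (intro conjI locu loc ballI)
    fix \<psi> :: "real ^ 'n \<Rightarrow> real" assume \<psi>: "\<psi> \<in> test_functions"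
    have "(\<lambda>k. LINT x|lborel. laplacian (\<phi> k) x * \<psi> x) \<longlonglongrightarrow> (LINT x|lborel. w x * \<psi> x)"
      by (rule pairing_tendsto[OF test_laplacian[OF \<phi>] w(1) w(4) w(5) \<psi>])
    moreover have "(\<lambda>k. LINT x|lborel. laplacian (\<phi> k) x * \<psi> x) \<longlonglongrightarrow> (LINT x|lborel. h x * laplacian \<psi> x)"
      using pair_h[OF test_laplacian[OF \<psi>]] by (simp only: test_green[OF \<phi> \<psi>])
    ultimately have "(LINT x|lborel. h x * laplacian \<psi> x) = (LINT x|lborel. w x * \<psi> x)" using LIMSEQ_unique by blast
    then show "(LINT x|lebesgue. u x * laplacian \<psi> x) = (LINT x|lebesgue. w x * \<psi> x)"
      unfolding pair_u[OF test_laplacian[OF \<psi>]] by (subst LINT_completion) (use w(1) \<psi> in simp_all)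
  qed
  then have uw: "AE x in lebesgue. weak_laplacian u x = w x" by (rule weak_laplacian_AE)
  have "has_weak_gradient u (\<lambda>x. \<chi> i. g i x)"
    unfolding has_weak_gradient_def vec_lambda_beta
  proof (intro conjI locu loc ballI allI)
    fix \<psi> :: "real ^ 'n \<Rightarrow> real" and i assume \<psi>: "\<psi> \<in> test_functions"
    have "(\<lambda>k. LINT x|lborel. partial i (\<phi> k) x * \<psi> x) \<longlonglongrightarrow> (LINT x|lborel. g i x * \<psi> x)"
      by (rule pairing_tendsto[OF test_partial[OF \<phi>] g(1) g(4) g(5) \<psi>])
    then have "(\<lambda>k. - (LINT x|lborel. partial i (\<phi> k) x * \<psi> x)) \<longlonglongrightarrow> - (LINT x|lborel. g i x * \<psi> x)"
      by (rule tendsto_minus)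
    moreover have "(\<lambda>k. - (LINT x|lborel. partial i (\<phi> k) x * \<psi> x)) \<longlonglongrightarrow> (LINT x|lborel. h x * partial i \<psi> x)"
      using pair_h[OF test_partial[OF \<psi>]] by (simp only: test_parts[OF s \<psi>])
    ultimately have "(LINT x|lborel. h x * partial i \<psi> x) = - (LINT x|lborel. g i x * \<psi> x)" using LIMSEQ_unique by blast
    then show "(LINT x|lebesgue. u x * partial i \<psi> x) = - (LINT x|lebesgue. g i x * \<psi> x)"
      unfolding pair_u[OF test_partial[OF \<psi>]] by (subst LINT_completion) (use g(1) \<psi> in simp_all)
  qed
  then have ug: "AE x in lebesgue. weak_gradient u x = (\<chi> i. g i x)" by (rule weak_gradient_AE)
  have [measurable]: "w \<in> borel_measurable borel" "g i \<in> borel_measurable borel" for i using w(1) g(1) by simp_all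
  let ?W = "\<lambda>x. norm x powr (- \<alpha>) * (w x)\<^sup>2"
  let ?G = "\<lambda>x. \<Sum>i\<in>UNIV. norm x powr (- \<alpha> - 2) * (g i x)\<^sup>2"
  have Wl: "integrable lebesgue ?W" by (subst integrable_completion) (use w(2) in simp_all)
  have Gi: "integrable lborel ?G" by (rule Bochner_Integration.integrable_sum[OF g(2)])
  have Gl: "integrable lebesgue ?G" by (subst integrable_completion) (use Gi in simp_all)
  have aeW: "AE x in lebesgue. ?W x = norm x powr (- \<alpha>) * \<bar>weak_laplacian u x\<bar>\<^sup>2" using uw by eventually_elim simp
  have aeG: "AE x in lebesgue. ?G x = norm x powr (- \<alpha> - 2) * (norm (weak_gradient u x))\<^sup>2"
    using ug
  proof eventually_elim
    case (elim x)
    show ?case unfolding elim sum_coord_sq[symmetric] vec_lambda_beta sum_distrib_left by (simp add: power2_eq_square)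
  qed
  show ?thesis
  proof (rule that[OF \<phi> h(1) uh h(2) h(4) h(5) h(3)])
    note mW = borel_measurable_AE[OF borel_measurable_integrable[OF Wl] aeW] and mG = borel_measurable_AE[OF borel_measurable_integrable[OF Gl] aeG]
    show "integrable lebesgue (\<lambda>x. norm x powr (- \<alpha>) * \<bar>weak_laplacian u x\<bar>\<^sup>2)"
      by (rule integrable_cong_AE_imp[OF Wl mW aeW])
    show "integrable lebesgue (\<lambda>x. norm x powr (- \<alpha> - 2) * (norm (weak_gradient u x))\<^sup>2)"
      by (rule integrable_cong_AE_imp[OF Gl mG aeG])
    have "(LINT x|lebesgue. norm x powr (- \<alpha>) * \<bar>weak_laplacian u x\<bar>\<^sup>2) = (LINT x|lebesgue. ?W x)"
      by (rule integral_cong_AE[OF mW borel_measurable_integrable[OF Wl]]) (rule eventually_mono[OF aeW], erule sym)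
    also have "\<dots> = (LINT x|lborel. ?W x)" by (rule LINT_completion) simp
    finally show "(\<lambda>k. LINT x|lborel. norm x powr (- \<alpha>) * (laplacian (\<phi> k) x)\<^sup>2) \<longlonglongrightarrow>
       (LINT x|lebesgue. norm x powr (- \<alpha>) * \<bar>weak_laplacian u x\<bar>\<^sup>2)" using w(3) by simp
    have "(LINT x|lebesgue. norm x powr (- \<alpha> - 2) * (norm (weak_gradient u x))\<^sup>2) = (LINT x|lebesgue. ?G x)"
      by (rule integral_cong_AE[OF mG borel_measurable_integrable[OF Gl]]) (rule eventually_mono[OF aeG], erule sym)
    also have "\<dots> = (LINT x|lborel. ?G x)" by (rule LINT_completion) simp
    also have "\<dots> = (\<Sum>i\<in>UNIV. LINT x|lborel. norm x powr (- \<alpha> - 2) * (g i x)\<^sup>2)"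
      by (rule Bochner_Integration.integral_sum[OF g(2)])
    finally have e: "(LINT x|lebesgue. norm x powr (- \<alpha> - 2) * (norm (weak_gradient u x))\<^sup>2) =
      (\<Sum>i\<in>UNIV. LINT x|lborel. norm x powr (- \<alpha> - 2) * (g i x)\<^sup>2)" .
    have "(LINT x|lborel. norm x powr (- \<alpha> - 2) * gradsq (\<phi> k) x) =
      (\<Sum>i\<in>UNIV. LINT x|lborel. norm x powr (- \<alpha> - 2) * (partial i (\<phi> k) x)\<^sup>2)" for k
      unfolding gradsq_def sum_distrib_left
      by (intro Bochner_Integration.integral_sum test_integrable test_powr test_sq test_partial \<phi>)
    then show "(\<lambda>k. LINT x|lborel. norm x powr (- \<alpha> - 2) * gradsq (\<phi> k) x) \<longlonglongrightarrow>
       (LINT x|lebesgue. norm x powr (- \<alpha> - 2) * (norm (weak_gradient u x))\<^sup>2)"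
      unfolding e by (simp add: tendsto_sum g(3))
  qed
qed

section \<open>The one-dimensional variational problem\<close>

definition power_integral :: "real \<Rightarrow> (real \<Rightarrow> real) \<Rightarrow> real" where
  "power_integral q w = (LINT s|lborel. \<bar>w s\<bar> powr q)"

lemma tests1_powr_integrable:
  assumes w: "w \<in> tests1" and q: "q > 0"
  shows "integrable lborel (\<lambda>s. \<bar>w s\<bar> powr q)"
proof -
  from w obtain R where R: "\<And>s. \<bar>s\<bar> > R \<Longrightarrow> w s = 0" by (auto simp: tests1_def)
  obtain B where B: "\<forall>s. \<bar>w s\<bar> \<le> B" using tests1_bounded[OF w] by blast
  have [measurable]: "w \<in> borel_measurable borel" using w by simp
  show ?thesis
  proof (rule integrable_bounded_support[of _ R "B powr q"])
    show "\<bar>\<bar>w s\<bar> powr q\<bar> \<le> B powr q" for s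
      using powr_mono2[of q "\<bar>w s\<bar>" B] q B by simp
  qed (use R in simp_all)
qed

lemma power_integral_nonneg: "power_integral q w \<ge> 0"
  unfolding power_integral_def by (intro integral_nonneg_AE AE_I2) simp

lemma tests1_abs_le:
  assumes f: "f \<in> tests1"
  shows "\<bar>f s\<bar> \<le> (LINT t|lborel. \<bar>deriv f t\<bar>)"
proof -
  from f obtain R where R: "\<And>s. \<bar>s\<bar> > R \<Longrightarrow> f s = 0" by (auto simp: tests1_def)
  \<comment> \<open>A point to the left of \<open>s\<close> and outside the support, from which the
    derivative is integrated.\<close>
  define a where "a = min s (- \<bar>R\<bar> - 1)"
  have a: "a \<le> s" "f a = 0" unfolding a_def by (auto intro!: R simp: min_def)
  have int: "integrable lborel (deriv f)" by (rule tests1_integrable[OF tests1_deriv[OF f]])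
  have "(LINT t|lborel. deriv f t * indicator {a..s} t) = f s - f a"
  proof (rule integral_FTC_Icc_real[OF a(1)])
    show "DERIV f x :> deriv f x" for x by (rule smooth1_DERIV[OF tests1_smooth1[OF f]])
    show "isCont (deriv f) x" for x
      using smooth1_continuous_on[OF tests1_smooth1[OF tests1_deriv[OF f]], of UNIV]
      by (simp add: continuous_on_eq_continuous_at)
  qed
  then have "\<bar>f s\<bar> = \<bar>LINT t|lborel. deriv f t * indicator {a..s} t\<bar>" using a(2) by simp
  also have "\<dots> \<le> (LINT t|lborel. \<bar>deriv f t * indicator {a..s} t\<bar>)" by (rule integral_abs_bound)
  also have "\<dots> \<le> (LINT t|lborel. \<bar>deriv f t\<bar>)"
  proof (rule integral_mono)
    show "integrable lborel (\<lambda>t. \<bar>deriv f t * indicator {a..s} t\<bar>)"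
      using integrable_mult_indicator[OF _ int, of "{a..s}"] by (intro integrable_abs) (simp add: mult.commute)
    show "integrable lborel (\<lambda>t. \<bar>deriv f t\<bar>)" using int by (rule integrable_abs)
  qed (simp add: indicator_def)
  finally show ?thesis .
qed

text \<open>The fundamental theorem of calculus for the square of \<open>w\<close> and Young's
  inequality. The parameter \<open>d\<close> is the point: if the integral of \<open>w'\<close>
  squared is of order \<open>d\<close> squared, then both terms on the right are of order
  \<open>d\<close>.\<close>

lemma tests1_sq_le:
  assumes w: "w \<in> tests1" and d: "d > 0"
  shows "(w s)\<^sup>2 \<le> d * (LINT t|lborel. (w t)\<^sup>2) + (LINT t|lborel. (deriv w t)\<^sup>2) / d"
proof -
  have "(w s)\<^sup>2 \<le> (LINT t|lborel. \<bar>deriv (\<lambda>t. (w t)\<^sup>2) t\<bar>)"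
    using tests1_abs_le[OF tests1_sq[OF w], of s] by simp
  also have "deriv (\<lambda>t. (w t)\<^sup>2) = (\<lambda>t. 2 * (w t * deriv w t))"
    unfolding power2_eq_square deriv_mult_smooth1[OF tests1_smooth1[OF w] tests1_smooth1[OF w]] by (simp add: mult.commute)
  also have "(LINT t|lborel. \<bar>2 * (w t * deriv w t)\<bar>) \<le> (LINT t|lborel. d * (w t)\<^sup>2 + (deriv w t)\<^sup>2 / d)"
  proof (rule integral_mono)
    show "integrable lborel (\<lambda>t. \<bar>2 * (w t * deriv w t)\<bar>)"
      by (intro integrable_abs integrable_mult_right) (rule tests1_mult_integrable[OF w tests1_deriv[OF w]])
    show "integrable lborel (\<lambda>t. d * (w t)\<^sup>2 + (deriv w t)\<^sup>2 / d)"
      using tests1_integrable[OF tests1_sq[OF w]] tests1_integrable[OF tests1_sq[OF tests1_deriv[OF w]]] by simp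
    fix t
    have "0 \<le> (d * \<bar>w t\<bar> - \<bar>deriv w t\<bar>)\<^sup>2 / d" using d by simp
    also have "\<dots> = d * (w t)\<^sup>2 + (deriv w t)\<^sup>2 / d - 2 * (\<bar>w t\<bar> * \<bar>deriv w t\<bar>)"
      using d by (simp add: power2_diff power_mult_distrib field_simps power2_eq_square)
    finally show "\<bar>2 * (w t * deriv w t)\<bar> \<le> d * (w t)\<^sup>2 + (deriv w t)\<^sup>2 / d" by (simp add: abs_mult)
  qed
  also have "\<dots> = d * (LINT t|lborel. (w t)\<^sup>2) + (LINT t|lborel. (deriv w t)\<^sup>2) / d"
    using tests1_integrable[OF tests1_sq[OF w]] tests1_integrable[OF tests1_sq[OF tests1_deriv[OF w]]] by simp
  finally show ?thesis .
qed

lemma power_integral_le: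
  assumes w: "w \<in> tests1" and q: "q > 2" and M: "\<And>s. (w s)\<^sup>2 \<le> M"
  shows "power_integral q w \<le> M powr ((q - 2) / 2) * (LINT s|lborel. (w s)\<^sup>2)"
proof -
  have "power_integral q w \<le> (LINT s|lborel. M powr ((q - 2) / 2) * (w s)\<^sup>2)"
    unfolding power_integral_def
  proof (rule integral_mono)
    show "integrable lborel (\<lambda>s. \<bar>w s\<bar> powr q)" by (rule tests1_powr_integrable[OF w]) (use q in simp)
    show "integrable lborel (\<lambda>s. M powr ((q - 2) / 2) * (w s)\<^sup>2)"
      using tests1_integrable[OF tests1_sq[OF w]] by simp
    fix s
    show "\<bar>w s\<bar> powr q \<le> M powr ((q - 2) / 2) * (w s)\<^sup>2"
    proof (cases "w s = 0")
      case False
      have e2: "\<bar>w s\<bar> powr 2 = (w s)\<^sup>2" using False powr_realpow[of "\<bar>w s\<bar>" 2] by simp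
      have e: "\<bar>w s\<bar> powr (q - 2) = ((w s)\<^sup>2) powr ((q - 2) / 2)" unfolding e2[symmetric] powr_powr
        by (rule arg_cong[of _ _ "\<lambda>e. \<bar>w s\<bar> powr e"]) simp
      have "\<bar>w s\<bar> powr q = \<bar>w s\<bar> powr (q - 2) * \<bar>w s\<bar> powr 2"
        by (subst powr_add[symmetric]) (simp only: diff_add_cancel)
      also have "\<dots> = ((w s)\<^sup>2) powr ((q - 2) / 2) * (w s)\<^sup>2" unfolding e e2 ..
      also have "((w s)\<^sup>2) powr ((q - 2) / 2) * (w s)\<^sup>2 \<le> M powr ((q - 2) / 2) * (w s)\<^sup>2"
        by (intro mult_right_mono powr_mono2 M) (use q in auto)
      finally show ?thesis .
    qed simp
  qed
  then show ?thesis by simp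
qed

section \<open>The energy and its homogeneity\<close>

lemma sq_integral_nonneg: "0 \<le> (LINT s|(lborel :: real measure). (f s)\<^sup>2 :: real)"
  by (intro integral_nonneg_AE AE_I2) simp

lemma energy_nonneg: "a \<ge> 0 \<Longrightarrow> b \<ge> 0 \<Longrightarrow> energy a b w \<ge> 0"
  unfolding energy_def by (intro add_nonneg_nonneg mult_nonneg_nonneg sq_integral_nonneg)

lemma energy_add: "energy (a + l) b w = energy a b w + l * (LINT s|lborel. (deriv w s)\<^sup>2)"
  by (simp add: energy_def algebra_simps)

lemma energy_ge:
  assumes "a \<ge> 0" "b \<ge> 0"
  shows "b * (LINT s|lborel. (w s)\<^sup>2) \<le> energy a b w" "a * (LINT s|lborel. (deriv w s)\<^sup>2) \<le> energy a b w"
proof -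
  have "0 \<le> a * (LINT s|lborel. (deriv w s)\<^sup>2)" "0 \<le> b * (LINT s|lborel. (w s)\<^sup>2)"
    by (intro mult_nonneg_nonneg assms sq_integral_nonneg)+
  then show "b * (LINT s|lborel. (w s)\<^sup>2) \<le> energy a b w" "a * (LINT s|lborel. (deriv w s)\<^sup>2) \<le> energy a b w"
    using sq_integral_nonneg[of "deriv (deriv w)"] by (simp_all add: energy_def)
qed

lemma energy_scale:
  assumes w: "w \<in> tests1" shows "energy a b (\<lambda>s. c * w s) = c\<^sup>2 * energy a b w"
  unfolding energy_def deriv_cmult_smooth1[OF tests1_smooth1[OF w] tests1_smooth1[OF w]]
    deriv_cmult_smooth1[OF tests1_smooth1[OF tests1_deriv[OF w]] tests1_smooth1[OF w]]
  by (simp add: power_mult_distrib algebra_simps)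

lemma power_integral_scale: "c \<ge> 0 \<Longrightarrow> power_integral q (\<lambda>s. c * w s) = c powr q * power_integral q w"
  unfolding power_integral_def by (simp add: abs_mult powr_mult)

text \<open>Both sides are homogeneous of degree 2, so it suffices to treat profiles normalised by a
  reference energy, which may differ from the energy in the conclusion. If the reference energy is
  0, then so is the integral of \<open>w\<close> squared, and \<open>power_integral_le\<close> makes
  the left side vanish.\<close>

lemma energy_bound_homogeneous:
  assumes ab: "a > 0" "b > 0" and q: "q > 2" and e: "a' \<ge> 0" "b' \<ge> 0"
    and unit: "\<And>w. w \<in> tests1 \<Longrightarrow> energy a b w = 1 \<Longrightarrow> k * power_integral q w powr (2 / q) \<le> energy a' b' w"
    and w: "w \<in> tests1"
  shows "k * power_integral q w powr (2 / q) \<le> energy a' b' w"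
proof (cases "energy a b w = 0")
  case True
  have "(LINT s|lborel. (w s)\<^sup>2) = 0"
    using energy_ge(1)[of a b w] True ab sq_integral_nonneg[of w] by (simp add: mult_le_0_iff)
  moreover obtain B where B: "\<forall>s. \<bar>w s\<bar> \<le> B" using tests1_bounded[OF w] by blast
  have "(w s)\<^sup>2 \<le> B\<^sup>2" for s using B by (metis abs_le_square_iff abs_of_nonneg abs_ge_zero order_trans)
  then have "power_integral q w \<le> (B\<^sup>2) powr ((q - 2) / 2) * (LINT s|lborel. (w s)\<^sup>2)" by (rule power_integral_le[OF w q])
  ultimately have "power_integral q w = 0" using power_integral_nonneg[of q w] by simp
  then show ?thesis using energy_nonneg[OF e] by simp
next
  case False
  define E where "E = energy a b w"
  have E: "E > 0" using energy_nonneg[of a b w] ab False by (simp add: E_def)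
  define c where "c = 1 / sqrt E"
  have c: "c > 0" "c\<^sup>2 * E = 1" using E by (simp_all add: c_def power_divide)
  have "k * power_integral q (\<lambda>s. c * w s) powr (2 / q) \<le> energy a' b' (\<lambda>s. c * w s)"
    by (rule unit[OF tests1_cmult[OF w]]) (use c in \<open>simp add: energy_scale[OF w] E_def\<close>)
  moreover have "power_integral q (\<lambda>s. c * w s) powr (2 / q) = c\<^sup>2 * power_integral q w powr (2 / q)"
  proof -
    have "power_integral q (\<lambda>s. c * w s) powr (2 / q) = (c powr q) powr (2 / q) * power_integral q w powr (2 / q)"
      using c(1) power_integral_nonneg[of q w] by (simp add: power_integral_scale powr_mult)
    also have "(c powr q) powr (2 / q) = c\<^sup>2" using q c(1) powr_realpow[of c 2] by (simp add: powr_powr)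
    finally show ?thesis .
  qed
  ultimately have "c\<^sup>2 * (k * power_integral q w powr (2 / q)) \<le> c\<^sup>2 * energy a' b' w"
    by (simp add: energy_scale[OF w] mult_ac)
  then show ?thesis using c(1) by simp
qed

text \<open>With \<open>a = (\<alpha> + 2)\<^sup>2 + 2 * \<gamma>\<close> and
  \<open>b = \<gamma>\<^sup>2\<close> this is, up to the factor
  \<open>sphere_area powr (1 - 2 / q)\<close>, the infimum of the quotient with \<lambda> = \<mu> =
  0 over the functions \<open>rad m w\<close>. The factor arises because the area enters the
  numerator once and the denominator with power \<open>2 / q\<close>.\<close>

definition best_constant :: "real \<Rightarrow> real \<Rightarrow> real \<Rightarrow> real" where
  "best_constant a b q = Inf {energy a b w / power_integral q w powr (2 / q) | w. w \<in> tests1 \<and> power_integral q w > 0}"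

lemma ex_power_integral_pos:
  assumes q: "q > 0" shows "\<exists>w\<in>tests1. power_integral q w > 0"
proof -
  obtain w s where w: "w \<in> tests1" "w s \<noteq> 0" using ex_tests1_nonzero by blast
  have "power_integral q w \<noteq> 0"
  proof
    assume "power_integral q w = 0"
    then have "AE s in lborel. \<bar>w s\<bar> powr q = 0"
      unfolding power_integral_def
      by (subst (asm) integral_nonneg_eq_0_iff_AE[OF tests1_powr_integrable[OF w(1) q]]) auto
    then have "AE s in lebesgue. s \<notin> {s. w s \<noteq> 0}" by (subst AE_completion_iff) (simp add: eventually_mono)
    then have "{s. w s \<noteq> 0} \<in> null_sets lebesgue" by (simp add: completion.null_sets_iff_AE)
    then have "negligible {s. w s \<noteq> 0}" by (simp add: negligible_iff_null_sets)
    moreover have "open {s. w s \<noteq> 0}"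
      by (intro open_Collect_neq smooth1_continuous_on tests1_smooth1 w continuous_intros)
    ultimately show False using open_not_negligible w(2) by blast
  qed
  then show ?thesis using power_integral_nonneg[of q w] w(1) by (intro bexI[of _ w]) simp_all
qed

lemma best_constant_le:
  assumes "a > 0" "b > 0" "w \<in> tests1"
  shows "best_constant a b q * power_integral q w powr (2 / q) \<le> energy a b w"
proof (cases "power_integral q w = 0")
  case True
  then show ?thesis using energy_nonneg[of a b w] assms by simp
next
  case False
  then have p: "power_integral q w > 0" using power_integral_nonneg[of q w] by simp
  have "best_constant a b q \<le> energy a b w / power_integral q w powr (2 / q)"
    unfolding best_constant_def
  proof (rule cInf_lower)
    show "bdd_below {energy a b w / power_integral q w powr (2 / q) |w. w \<in> tests1 \<and> 0 < power_integral q w}"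
      by (rule bdd_belowI[of _ 0]) (use energy_nonneg assms in \<open>auto intro!: divide_nonneg_nonneg simp: less_imp_le\<close>)
  qed (use assms p in blast)
  then show ?thesis using p by (simp add: pos_le_divide_eq)
qed

lemma best_constant_approx:
  assumes "q > 0" "best_constant a b q < k"
  obtains w where "w \<in> tests1" "power_integral q w > 0" "energy a b w < k * power_integral q w powr (2 / q)"
proof -
  let ?S = "{energy a b w / power_integral q w powr (2 / q) |w. w \<in> tests1 \<and> 0 < power_integral q w}"
  have "?S \<noteq> {}" using ex_power_integral_pos[OF assms(1)] by blast
  from cInf_lessD[OF this assms(2)[unfolded best_constant_def]] obtain y where y: "y \<in> ?S" "y < k" by blast
  then obtain w where w: "w \<in> tests1" "0 < power_integral q w" "energy a b w / power_integral q w powr (2 / q) < k" by blast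
  then show ?thesis by (intro that[of w]) (simp_all add: pos_divide_less_eq)
qed

text \<open>For unit energy the integral of \<open>w\<close> squared is at most
  \<open>1 / b\<close>, and a small integral of \<open>w'\<close> squared makes the supremum of
  \<open>w\<close> small; the exponent above 2 turns this into smallness of the power integral. With
  \<open>d = 1\<close> it gives positivity of the best constant, with \<open>d\<close> tending to 0
  the gain below.\<close>

lemma energy_one_power_integral_le:
  assumes ab: "a > 0" "b > 0" and q: "q > 2" and d: "d > 0"
    and w: "w \<in> tests1" "energy a b w = 1" and W1: "(LINT s|lborel. (deriv w s)\<^sup>2) \<le> d\<^sup>2 * r"
  shows "power_integral q w \<le> (d * (1 / b + r)) powr ((q - 2) / 2) / b"
proof -
  have W0: "(LINT s|lborel. (w s)\<^sup>2) \<le> 1 / b"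
    using energy_ge(1)[of a b w] ab w(2) by (simp add: field_simps)
  have "(w s)\<^sup>2 \<le> d * (1 / b + r)" for s
  proof -
    have "(w s)\<^sup>2 \<le> d * (LINT t|lborel. (w t)\<^sup>2) + (LINT t|lborel. (deriv w t)\<^sup>2) / d" by (rule tests1_sq_le[OF w(1) d])
    also have "\<dots> \<le> d * (1 / b) + (d\<^sup>2 * r) / d"
      by (intro add_mono mult_left_mono divide_right_mono W0 W1) (use d in auto)
    also have "\<dots> = d * (1 / b + r)" using d by (simp add: field_simps power2_eq_square)
    finally show ?thesis .
  qed
  then have "power_integral q w \<le> (d * (1 / b + r)) powr ((q - 2) / 2) * (LINT s|lborel. (w s)\<^sup>2)"
    by (rule power_integral_le[OF w(1) q])
  also have "\<dots> \<le> (d * (1 / b + r)) powr ((q - 2) / 2) * (1 / b)" by (rule mult_left_mono[OF W0]) simp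
  finally show ?thesis by simp
qed

lemma best_constant_pos:
  assumes ab: "a > 0" "b > 0" and q: "q > 2"
  shows "best_constant a b q > 0"
proof -
  define C where "C = (1 * (1 / b + 1 / a)) powr ((q - 2) / 2) / b"
  have "1 / b + 1 / a > 0" using ab by (simp add: add_pos_pos)
  then have C: "C > 0" unfolding C_def using ab by simp
  define k where "k = 1 / C powr (2 / q)"
  have k: "k > 0" using C by (simp add: k_def)
  have le: "k * power_integral q w powr (2 / q) \<le> energy a b w" if w: "w \<in> tests1" for w
  proof (rule energy_bound_homogeneous[OF ab q _ _ _ w])
    fix w assume w: "w \<in> tests1" "energy a b w = 1"
    have "(LINT s|lborel. (deriv w s)\<^sup>2) \<le> 1\<^sup>2 * (1 / a)"
      using energy_ge(2)[of a b w] ab w(2) by (simp add: field_simps)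
    then have "power_integral q w \<le> C" unfolding C_def
      by (rule energy_one_power_integral_le[OF ab q _ w, rotated]) simp
    then have "power_integral q w powr (2 / q) \<le> C powr (2 / q)"
      by (intro powr_mono2 power_integral_nonneg) (use q in auto)
    then show "k * power_integral q w powr (2 / q) \<le> energy a b w"
      using C w(2) by (simp add: k_def pos_divide_le_eq)
  qed (use ab in auto)
  have "k \<le> best_constant a b q"
    unfolding best_constant_def
  proof (rule cInf_greatest)
    show "{energy a b w / power_integral q w powr (2 / q) |w. w \<in> tests1 \<and> 0 < power_integral q w} \<noteq> {}"
      using ex_power_integral_pos[of q] q by auto
    fix y assume "y \<in> {energy a b w / power_integral q w powr (2 / q) |w. w \<in> tests1 \<and> 0 < power_integral q w}"
    then obtain w where w: "w \<in> tests1" "0 < power_integral q w" "y = energy a b w / power_integral q w powr (2 / q)" by blast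
    then show "k \<le> y" using le[OF w(1)] by (simp add: pos_le_divide_eq)
  qed
  with k show ?thesis by simp
qed

text \<open>If \<open>w\<close> is nearly optimal then \<open>\<integral>w'\<^sup>2\<close> cannot be small compared with the energy, because
  \<open>\<integral>|w|\<^sup>q\<close> is controlled by an interpolation between \<open>\<integral>w\<^sup>2\<close> and \<open>\<integral>w'\<^sup>2\<close>.
  Hence adding \<open>l * \<integral>w'\<^sup>2\<close> raises the best constant strictly.\<close>

lemma energy_gain:
  assumes ab: "a > 0" "b > 0" and q: "q > 2" and l: "l > 0"
  obtains k where "k > best_constant a b q"
    "\<And>w. w \<in> tests1 \<Longrightarrow> k * power_integral q w powr (2 / q) \<le> energy (a + l) b w"
proof -
  define S where "S = best_constant a b q"
  have S: "S > 0" unfolding S_def by (rule best_constant_pos[OF ab q])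
  \<comment> \<open>\<open>C d\<close> bounds \<open>power_integral q w powr (2 / q)\<close> for
    unit energy when the integral of \<open>w'\<close> squared is at most \<open>d\<^sup>2\<close>.
    It tends to 0 with \<open>d\<close>, so \<open>d\<close> can be chosen such that these profiles
    have a quotient above \<open>2 * S\<close>.\<close>
  define C where "C d = ((d * (1 / b + 1)) powr ((q - 2) / 2) / b) powr (2 / q)" for d
  have "(C \<longlongrightarrow> ((0 * (1 / b + 1)) powr ((q - 2) / 2) / b) powr (2 / q)) (at_right 0)"
    unfolding C_def using q ab
    by (intro tendsto_powr2 tendsto_intros) (auto simp: eventually_at_right_field intro!: exI[of _ 1] add_nonneg_nonneg)
  then have "(C \<longlongrightarrow> 0) (at_right 0)" using q by simp
  moreover have "0 < 1 / (2 * S)" using S by simp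
  ultimately have "\<forall>\<^sub>F d in at_right 0. C d < 1 / (2 * S)" by (rule order_tendstoD)
  then obtain d where d: "d > 0" "C d < 1 / (2 * S)" unfolding eventually_at_right_field by (metis dense)
  \<comment> \<open>The minimum covers the two alternatives: the factor 2 for profiles with small
    first derivative, the factor \<open>1 + l * d\<^sup>2\<close> for the others, where the added
    term contributes at least \<open>l * d\<^sup>2\<close> to unit energy.\<close>
  define k where "k = S * min 2 (1 + l * d\<^sup>2)"
  show ?thesis
  proof (rule that)
    have "1 < min 2 (1 + l * d\<^sup>2)" using l d by simp
    then show "k > best_constant a b q" using S unfolding k_def S_def[symmetric] by simp
    fix w0 assume w0: "w0 \<in> tests1"
    show "k * power_integral q w0 powr (2 / q) \<le> energy (a + l) b w0"
    proof (rule energy_bound_homogeneous[OF ab q _ _ _ w0])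
      fix w assume w: "w \<in> tests1" "energy a b w = 1"
      let ?P = "power_integral q w powr (2 / q)"
      have SP: "S * ?P \<le> 1" using best_constant_le[OF ab w(1), of q] w(2) by (simp add: S_def)
      show "k * ?P \<le> energy (a + l) b w"
      proof (cases "(LINT s|lborel. (deriv w s)\<^sup>2) \<le> d\<^sup>2 * 1")
        case True
        have "power_integral q w \<le> (d * (1 / b + 1)) powr ((q - 2) / 2) / b"
          by (rule energy_one_power_integral_le[OF ab q d(1) w True])
        then have "?P \<le> C d" unfolding C_def
          by (intro powr_mono2 power_integral_nonneg) (use q in auto)
        with d(2) have "?P \<le> 1 / (2 * S)" by simp
        then have "2 * S * ?P \<le> 1" using S by (simp add: field_simps)
        moreover have "k * ?P \<le> (2 * S) * ?P" unfolding k_def using S by (intro mult_right_mono) auto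
        moreover have "energy (a + l) b w \<ge> 1"
          unfolding energy_add w(2) using l sq_integral_nonneg[of "deriv w"] by simp
        ultimately show ?thesis by linarith
      next
        case False
        have "k * ?P \<le> (S * (1 + l * d\<^sup>2)) * ?P" unfolding k_def using S by (intro mult_right_mono mult_left_mono) auto
        also have "\<dots> = (1 + l * d\<^sup>2) * (S * ?P)" by (simp add: mult_ac)
        also have "\<dots> \<le> (1 + l * d\<^sup>2) * 1" using SP l by (intro mult_left_mono) auto
        also have "\<dots> \<le> energy (a + l) b w" unfolding energy_add w(2) using False l by (simp add: mult_left_mono)
        finally show ?thesis .
      qed
    qed (use ab l in auto)
  qed
qed

text \<open>The weight \<open>t = (q - r) / (q - 2)\<close> solves
  \<open>r = 2 * t + q * (1 - t)\<close>. At \<open>r = q\<close> it is 0 and, for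
  \<open>k > 0\<close> and \<open>q > 2\<close>, the constant equals \<open>k\<close>, so the
  formula is continuous up to the endpoint at which the gain is known.\<close>

definition interpolation_constant :: "real \<Rightarrow> real \<Rightarrow> real \<Rightarrow> real \<Rightarrow> real" where
  "interpolation_constant b k q r =
     1 / ((q - r) / (q - 2) * (1 / b) + (1 - (q - r) / (q - 2)) * k powr (- (q / 2))) powr (2 / r)"

text \<open>Carries a bound from the exponent \<open>q\<close> to a smaller exponent. Pointwise,
  \<open>\<bar>w\<bar> powr r\<close> is a geometric mean of \<open>\<bar>w\<bar> powr 2\<close> and
  \<open>\<bar>w\<bar> powr q\<close>, hence at most their weighted arithmetic mean; for unit energy
  both integrals are bounded, the first by the energy itself, the second by hypothesis.\<close>

lemma energy_interpolation:
  assumes ab: "a > 0" "b > 0" and r: "2 < r" "r < q" and k: "k > 0"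
    and le: "\<And>w. w \<in> tests1 \<Longrightarrow> k * power_integral q w powr (2 / q) \<le> energy a b w"
    and w: "w \<in> tests1"
  shows "interpolation_constant b k q r * power_integral r w powr (2 / r) \<le> energy a b w"
proof (rule energy_bound_homogeneous[OF ab r(1) _ _ _ w])
  fix w assume w: "w \<in> tests1" "energy a b w = 1"
  define t where "t = (q - r) / (q - 2)"
  have t: "0 < t" "t < 1" using r by (simp_all add: t_def)
  have rt: "r = 2 * t + q * (1 - t)"
  proof -
    have "t * (q - 2) = q - r" using r by (simp add: t_def)
    then show ?thesis by (simp add: algebra_simps)
  qed
  have W0: "(LINT s|lborel. (w s)\<^sup>2) \<le> 1 / b"
    using energy_ge(1)[of a b w] ab w(2) by (simp add: field_simps)
  have "k * power_integral q w powr (2 / q) \<le> 1" using le[OF w(1)] w(2) by simp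
  then have "power_integral q w powr (2 / q) \<le> 1 / k" using k by (simp add: field_simps)
  then have "(power_integral q w powr (2 / q)) powr (q / 2) \<le> (1 / k) powr (q / 2)"
    by (intro powr_mono2) (use r in auto)
  then have Pq: "power_integral q w \<le> k powr (- (q / 2))"
  proof -
    have "(2 / q) * (q / 2) = 1" using r by simp
    then have "(power_integral q w powr (2 / q)) powr (q / 2) = power_integral q w"
      unfolding powr_powr using power_integral_nonneg[of q w] by (simp only: powr_one)
    moreover have "(1 / k) powr (q / 2) = k powr (- (q / 2))"
      using k by (simp only: powr_minus_divide powr_divide[of 1 k] powr_one_eq_one zero_le_one less_imp_le)
    ultimately show ?thesis using \<open>(power_integral q w powr (2 / q)) powr (q / 2) \<le> (1 / k) powr (q / 2)\<close> by (simp only:)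
  qed
  have "power_integral r w \<le> (LINT s|lborel. t * (w s)\<^sup>2 + (1 - t) * \<bar>w s\<bar> powr q)"
    unfolding power_integral_def
  proof (rule integral_mono)
    show "integrable lborel (\<lambda>s. \<bar>w s\<bar> powr r)" by (rule tests1_powr_integrable[OF w(1)]) (use r in simp)
    show "integrable lborel (\<lambda>s. t * (w s)\<^sup>2 + (1 - t) * \<bar>w s\<bar> powr q)"
      using tests1_integrable[OF tests1_sq[OF w(1)]] tests1_powr_integrable[OF w(1), of q] r by simp
    fix s
    show "\<bar>w s\<bar> powr r \<le> t * (w s)\<^sup>2 + (1 - t) * \<bar>w s\<bar> powr q"
    proof (cases "w s = 0")
      case False
      have e2: "\<bar>w s\<bar> powr 2 = (w s)\<^sup>2" using False powr_realpow[of "\<bar>w s\<bar>" 2] by simp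
      have "\<bar>w s\<bar> powr r = (\<bar>w s\<bar> powr 2) powr t * (\<bar>w s\<bar> powr q) powr (1 - t)"
        unfolding powr_powr powr_add[symmetric] rt[symmetric] ..
      also have "\<dots> \<le> t * \<bar>w s\<bar> powr 2 + (1 - t) * \<bar>w s\<bar> powr q"
        by (rule Youngs_inequality_0) (use t False in auto)
      finally show ?thesis unfolding e2 .
    qed simp
  qed
  also have "\<dots> = t * (LINT s|lborel. (w s)\<^sup>2) + (1 - t) * power_integral q w"
    using tests1_integrable[OF tests1_sq[OF w(1)]] tests1_powr_integrable[OF w(1), of q] r by (simp add: power_integral_def)
  also have "\<dots> \<le> t * (1 / b) + (1 - t) * k powr (- (q / 2))"
    by (intro add_mono mult_left_mono W0 Pq) (use t in auto)
  finally have le: "power_integral r w \<le> t * (1 / b) + (1 - t) * k powr (- (q / 2))" (is "_ \<le> ?C") .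
  have C: "?C > 0" using t ab k by (intro add_pos_nonneg mult_pos_pos) auto
  have "power_integral r w powr (2 / r) \<le> ?C powr (2 / r)"
    by (intro powr_mono2 power_integral_nonneg le) (use r in auto)
  then show "interpolation_constant b k q r * power_integral r w powr (2 / r) \<le> energy a b w"
    using C w(2) unfolding interpolation_constant_def t_def[symmetric] by (simp add: pos_divide_le_eq)
qed (use ab in auto)

section \<open>The quotient of radial functions\<close>

text \<open>The function \<open>f\<close> in the definition of \<open>radial\<close> is arbitrary
  and need not be measurable. A Borel version of \<open>u\<close> restricted to one generic ray is
  measurable, and it agrees with \<open>f\<close> for almost every radius, so it can serve as
  profile.\<close>

lemma radial_borel_representative:
  fixes u :: "real ^ 'n::finite \<Rightarrow> real"
  assumes um: "u \<in> borel_measurable lebesgue" and rad: "radial u"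
  obtains F where "F \<in> borel_measurable borel" "AE x in lebesgue. u x = F (- ln (norm x))"
proof -
  from rad obtain f where f: "AE x in lebesgue. u x = f (norm x)" unfolding radial_def by blast
  obtain u' where u': "u' \<in> borel_measurable lborel" "AE x in lborel. u x = u' x"
    using completion_ex_borel_measurable_real[OF um] by blast
  have f': "AE x in lborel. u x = f (norm x)" using f by (simp add: AE_completion_iff)
  have "AE x in lborel. u' x = f (norm x)" using f' u'(2) by eventually_elim simp
  from polar_AE[OF this]
  have "AE x in (cone_measure :: (real ^ 'n) measure). x \<noteq> 0 \<and> (AE s in lborel. u' (exp (- s) *\<^sub>R sgn x) = f (norm (exp (- s) *\<^sub>R sgn x)))"
    using AE_cone_nonzero by eventually_elim blast
  moreover have "emeasure (cone_measure :: (real ^ 'n) measure) (space cone_measure) \<noteq> 0"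
    using sphere_area_pos[where 'n='n] by (simp add: emeasure_cone_UNIV)
  \<comment> \<open>Such a direction exists because the property holds almost everywhere for a
    measure that is not 0.\<close>
  ultimately obtain x0 :: "real ^ 'n" where x0: "x0 \<noteq> 0"
    "AE s in lborel. u' (exp (- s) *\<^sub>R sgn x0) = f (norm (exp (- s) *\<^sub>R sgn x0))"
    using eventually_happens'[of "ae_filter (cone_measure :: (real ^ 'n) measure)"]
    unfolding ae_filter_eq_bot_iff[symmetric] by blast
  define F where "F s = u' (exp (- s) *\<^sub>R sgn x0)" for s
  have "u' \<in> borel_measurable borel" using u'(1) by simp
  then have F: "F \<in> borel_measurable borel" unfolding F_def by measurable
  have "AE s in lborel. F s = f (exp (- s))"
    using x0(2) unfolding F_def norm_polar(1)[OF x0(1)] .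
  from AE_radial[OF this] have "AE x in (lborel :: (real ^ 'n) measure). F (- ln (norm x)) = f (exp (ln (norm x)))" by simp
  then have "AE x in lborel. u x = F (- ln (norm x))"
    using f' AE_lborel_singleton[of "0 :: real ^ 'n"] by eventually_elim simp
  then have "AE x in lebesgue. u x = F (- ln (norm x))" by (simp add: AE_completion_iff)
  with F show ?thesis by (rule that)
qed

text \<open>For \<open>q = p + 1\<close> and \<open>m = (n - 4 - \<alpha>) / 2\<close> the exponent
  \<open>q * m - n\<close> is \<open>weight_exponent\<close>. The form with values in the extended
  nonnegative reals is the one that Fatou's lemma needs.\<close>

lemma radial_power_integral:
  fixes w :: "real \<Rightarrow> real"
  assumes w: "w \<in> tests1" and q: "q > 0"
  shows "(\<integral>\<^sup>+x. ennreal (norm (x :: real ^ 'n::finite) powr (q * m - real CARD('n)) * \<bar>rad m w x\<bar> powr q) \<partial>lborel)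
    = ennreal (sphere_area TYPE('n) * power_integral q w)"
proof -
  have [measurable]: "w \<in> borel_measurable borel" using w by simp
  have "norm x powr (q * m - real CARD('n)) * \<bar>rad m w x\<bar> powr q
      = norm x powr (- real CARD('n)) * \<bar>w (- ln (norm x))\<bar> powr q" for x :: "real ^ 'n"
  proof -
    have "\<bar>rad m w x\<bar> powr q = norm x powr (- (q * m)) * \<bar>w (- ln (norm x))\<bar> powr q"
      by (simp add: rad_def abs_mult powr_mult powr_powr mult.commute)
    then show ?thesis by (simp add: mult.assoc[symmetric] powr_add[symmetric])
  qed
  then have "(\<integral>\<^sup>+x. ennreal (norm (x :: real ^ 'n) powr (q * m - real CARD('n)) * \<bar>rad m w x\<bar> powr q) \<partial>lborel)
    = (\<integral>\<^sup>+x. ennreal (norm (x :: real ^ 'n) powr (- real CARD('n))) * ennreal (\<bar>w (- ln (norm x))\<bar> powr q) \<partial>lborel)"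
    by (simp add: ennreal_mult)
  also have "\<dots> = ennreal (sphere_area TYPE('n)) * (\<integral>\<^sup>+s. ennreal (\<bar>w s\<bar> powr q) \<partial>lborel)"
    by (rule nn_integral_radial) simp
  also have "(\<integral>\<^sup>+s. ennreal (\<bar>w s\<bar> powr q) \<partial>lborel) = ennreal (power_integral q w)"
    unfolding power_integral_def by (rule nn_integral_eq_integral[OF tests1_powr_integrable[OF w q]]) simp
  finally show ?thesis using sphere_area_pos[where 'n='n] power_integral_nonneg by (simp add: ennreal_mult)
qed

text \<open>The radial part is an orthogonal projection in every weighted space, and
  \<open>h\<close> is radial; so passing from \<open>\<phi>\<close> to its radial part cannot
  increase the distance to \<open>h\<close>.\<close>

lemma radial_part_distance_le:
  fixes \<phi> h :: "real ^ 'n::finite \<Rightarrow> real"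
  assumes \<phi>: "\<phi> \<in> test_functions" and h: "h \<in> borel_measurable borel"
    and h2: "integrable lborel (\<lambda>x. norm x powr c * (h x)\<^sup>2)"
    and F: "F \<in> borel_measurable borel" "AE x in lborel. h x = F (- ln (norm x))"
  shows "integrable lborel (\<lambda>x. norm x powr c * (radial_part m \<phi> x - h x)\<^sup>2)"
    and "(LINT x|lborel. norm x powr c * (radial_part m \<phi> x - h x)\<^sup>2) \<le> (LINT x|lborel. norm x powr c * (\<phi> x - h x)\<^sup>2)"
proof -
  define r where "r x = norm x powr (c / 2)" for x :: "real ^ 'n"
  have r2: "(r x * y)\<^sup>2 = norm x powr c * y\<^sup>2" for x y
    by (simp add: r_def power_mult_distrib power2_eq_square powr_add[symmetric])
  define v where "v = radial_part m \<phi>"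
  define w where "w = emden m \<phi>"
  have w: "w \<in> tests1" unfolding w_def by (rule tests1_emden[OF \<phi>])
  have v: "v \<in> test_functions" unfolding v_def by (rule test_radial_part[OF \<phi>])
  have [measurable]: "h \<in> borel_measurable borel" "v \<in> borel_measurable borel" "\<phi> \<in> borel_measurable borel"
    "F \<in> borel_measurable borel" "w \<in> borel_measurable borel" "r \<in> borel_measurable borel"
    using h v \<phi> F w unfolding r_def by simp_all
  have rm: "(\<lambda>x. r x * f x) \<in> borel_measurable lborel" if "f \<in> borel_measurable borel" for f
    using that by simp
  have t2: "integrable lborel (\<lambda>x. (r x * f x)\<^sup>2)" if "f \<in> test_functions" for f
    unfolding r2 by (rule test_integrable[OF test_powr[OF test_sq[OF that]]])
  have rh2: "integrable lborel (\<lambda>x. (r x * h x)\<^sup>2)" unfolding r2 by (rule h2)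
  have vh: "integrable lborel (\<lambda>x. (r x * (v x - h x))\<^sup>2)"
    using L2_diff_integrable[OF rm rm t2[OF v] rh2] by (simp add: right_diff_distrib)
  then show "integrable lborel (\<lambda>x. norm x powr c * (radial_part m \<phi> x - h x)\<^sup>2)" unfolding r2 v_def .
  have prod: "integrable lborel (\<lambda>x. (r x * f x) * (r x * (v x - h x)))" if f: "f \<in> test_functions" for f
    by (rule L2_product_integrable[OF rm rm t2[OF f] vh]) (use f in simp_all)
  \<comment> \<open>The profile of the weighted difference
    \<open>norm x powr c * (v x - h x)\<close>. It is merely measurable, since \<open>F\<close> is,
    which is why the orthogonality was stated for measurable profiles.\<close>
  define H where "H s = exp (- c * s) * (exp (m * s) * w s - F s)" for s
  have H: "H \<in> borel_measurable borel" unfolding H_def by measurable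
  have eq: "AE x in lborel. (r x * f x) * (r x * (v x - h x)) = f x * H (- ln (norm x))" for f :: "real ^ 'n \<Rightarrow> real"
    using F(2) AE_lborel_singleton[of "0 :: real ^ 'n"]
  proof eventually_elim
    case (elim x)
    have "r x * r x = norm x powr c" by (simp add: r_def powr_add[symmetric])
    also have "\<dots> = exp (c * ln (norm x))" using elim by (simp add: powr_def)
    finally have "r x * r x = exp (c * ln (norm x))" .
    moreover have "v x = exp (- (m * ln (norm x))) * w (- ln (norm x))"
      using elim by (simp add: v_def w_def rad_def powr_def)
    ultimately show ?case using elim by (simp add: H_def mult_ac)
  qed
  have int: "integrable lborel (\<lambda>x. f x * H (- ln (norm x)))" if f: "f \<in> test_functions" for f :: "real ^ 'n \<Rightarrow> real"
    by (rule integrable_cong_AE_imp[OF prod[OF f] _ eq]) (use f H in measurable)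
  have "(LINT x|lborel. (\<phi> x - v x) * H (- ln (norm x))) = 0"
    unfolding v_def by (rule radial_part_orthogonal[OF \<phi> H int[OF \<phi>] int[OF test_radial_part[OF \<phi>]]])
  moreover have D: "(\<lambda>x. \<phi> x - v x) \<in> test_functions" by (rule test_diff[OF \<phi> v])
  moreover have "(LINT x|lborel. (r x * (\<phi> x - v x)) * (r x * (v x - h x))) = (LINT x|lborel. (\<phi> x - v x) * H (- ln (norm x)))"
    by (rule integral_cong_AE[OF _ _ eq]) (use H in measurable)
  ultimately have o: "(LINT x|lborel. (r x * (\<phi> x - v x)) * (r x * (v x - h x))) = 0" by simp
  have "(LINT x|lborel. norm x powr c * (\<phi> x - h x)\<^sup>2) =
    (LINT x|lborel. (r x * (\<phi> x - v x))\<^sup>2 + 2 * ((r x * (\<phi> x - v x)) * (r x * (v x - h x))) + (r x * (v x - h x))\<^sup>2)"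
    unfolding r2[symmetric] by (rule Bochner_Integration.integral_cong) (simp_all add: power2_eq_square algebra_simps)
  also have "\<dots> = (LINT x|lborel. (r x * (\<phi> x - v x))\<^sup>2) + (LINT x|lborel. (r x * (v x - h x))\<^sup>2)"
    using t2[OF D] prod[OF D] vh o by simp
  finally have "(LINT x|lborel. norm x powr c * (\<phi> x - h x)\<^sup>2) =
    (LINT x|lborel. (r x * (\<phi> x - v x))\<^sup>2) + (LINT x|lborel. (r x * (v x - h x))\<^sup>2)" .
  moreover have "(LINT x|lborel. (r x * (\<phi> x - v x))\<^sup>2) \<ge> 0" by (intro integral_nonneg_AE AE_I2) simp
  ultimately show "(LINT x|lborel. norm x powr c * (radial_part m \<phi> x - h x)\<^sup>2) \<le> (LINT x|lborel. norm x powr c * (\<phi> x - h x)\<^sup>2)"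
    unfolding r2 v_def by simp
qed

text \<open>Only an upper bound for the denominator is needed to bound the quotient below, and
  Fatou's lemma gives it along an almost everywhere convergent subsequence. No embedding of
  \<open>D22\<close> into the weighted space of the denominator has to be known beforehand.\<close>

lemma power_integral_Fatou:
  fixes v :: "nat \<Rightarrow> real ^ 'n::finite \<Rightarrow> real"
  assumes v: "\<And>k. v k \<in> borel_measurable borel" and h: "h \<in> borel_measurable borel"
    and int: "\<And>k. integrable lborel (\<lambda>x. norm x powr c * (v k x - h x)\<^sup>2)"
    and lim: "(\<lambda>k. LINT x|lborel. norm x powr c * (v k x - h x)\<^sup>2) \<longlonglongrightarrow> 0"
    and q: "q > 0"
    and le: "\<And>k. (\<integral>\<^sup>+x. ennreal (norm x powr b * \<bar>v k x\<bar> powr q) \<partial>lborel) \<le> ennreal (y k)"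
    and y: "y \<longlonglongrightarrow> Y"
  shows "(\<integral>\<^sup>+x. ennreal (norm x powr b * \<bar>h x\<bar> powr q) \<partial>lborel) \<le> ennreal Y"
proof -
  have [measurable]: "v k \<in> borel_measurable borel" "h \<in> borel_measurable borel" for k by (rule v h)+
  have "(\<lambda>k. LINT x|lborel. norm (norm x powr c * (v k x - h x)\<^sup>2)) \<longlonglongrightarrow> 0" using lim by simp
  from tendsto_L1_AE_subseq[OF int this] obtain r where r: "strict_mono r"
    "AE x in lborel. (\<lambda>k. norm x powr c * (v (r k) x - h x)\<^sup>2) \<longlonglongrightarrow> 0" by blast
  have "AE x in lborel. (\<lambda>k. v (r k) x) \<longlonglongrightarrow> h x"
    using r(2) AE_lborel_singleton[of "0 :: real ^ 'n"]
  proof eventually_elim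
    case (elim x)
    have "(\<lambda>k. norm x powr (- c) * (norm x powr c * (v (r k) x - h x)\<^sup>2)) \<longlonglongrightarrow> norm x powr (- c) * 0"
      by (intro tendsto_intros elim)
    then have "(\<lambda>k. (v (r k) x - h x)\<^sup>2) \<longlonglongrightarrow> 0"
      using elim by (simp add: mult.assoc[symmetric] powr_add[symmetric])
    then have "(\<lambda>k. sqrt ((v (r k) x - h x)\<^sup>2)) \<longlonglongrightarrow> sqrt 0" by (rule tendsto_real_sqrt)
    then have "(\<lambda>k. \<bar>v (r k) x - h x\<bar>) \<longlonglongrightarrow> 0" by simp
    then have "(\<lambda>k. v (r k) x - h x) \<longlonglongrightarrow> 0" by (rule tendsto_rabs_zero_cancel)
    then show ?case by (rule LIM_zero_cancel)
  qed
  then have eq: "AE x in lborel. ennreal (norm x powr b * \<bar>h x\<bar> powr q) = liminf (\<lambda>k. ennreal (norm x powr b * \<bar>v (r k) x\<bar> powr q))"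
  proof eventually_elim
    case (elim x)
    have pw: "(\<lambda>k. \<bar>v (r k) x\<bar> powr q) \<longlonglongrightarrow> \<bar>h x\<bar> powr q"
      by (rule tendsto_powr2[OF tendsto_rabs[OF elim] tendsto_const _ q]) simp
    then have "(\<lambda>k. ennreal (norm x powr b * \<bar>v (r k) x\<bar> powr q)) \<longlonglongrightarrow> ennreal (norm x powr b * \<bar>h x\<bar> powr q)"
      by (intro tendsto_ennrealI tendsto_mult tendsto_const pw)
    from lim_imp_Liminf[OF _ this] show ?case by simp
  qed
  have "(\<integral>\<^sup>+x. ennreal (norm x powr b * \<bar>h x\<bar> powr q) \<partial>lborel)
    = (\<integral>\<^sup>+x. liminf (\<lambda>k. ennreal (norm x powr b * \<bar>v (r k) x\<bar> powr q)) \<partial>lborel)"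
    by (rule nn_integral_cong_AE[OF eq])
  also have "\<dots> \<le> liminf (\<lambda>k. \<integral>\<^sup>+x. ennreal (norm x powr b * \<bar>v (r k) x\<bar> powr q) \<partial>lborel)"
    by (rule nn_integral_liminf) measurable
  also have "\<dots> \<le> liminf (\<lambda>k. ennreal (y (r k)))"
    by (intro Liminf_mono always_eventually allI le)
  also have "\<dots> = ennreal Y"
    by (rule lim_imp_Liminf[OF trivial_limit_sequentially tendsto_ennrealI])
      (use LIMSEQ_subseq_LIMSEQ[OF y r(1)] in \<open>simp add: o_def\<close>)
  finally show ?thesis .
qed

text \<open>The one-dimensional bound for the profiles of radial parts is pushed to the limit. At
  the end \<mu> is lowered to \<open>lam * m\<^sup>2\<close>, the value at which the lower order
  terms reduce to \<open>- lam\<close> times the integral of \<open>w'\<close> squared.\<close>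

lemma quotient_radial_ge:
  fixes u :: "real ^ 'n::finite \<Rightarrow> real"
  assumes u: "u \<in> D22_rad \<alpha> - null_functions"
    and \<alpha>: "- 2 < \<alpha>" "\<alpha> < real CARD('n) - 4" and p: "p > 1" and lam: "lam \<le> 0"
    and mu: "mu \<ge> (real CARD('n) - 4 - \<alpha>)\<^sup>2 / 4 * lam"
    and g: "\<gamma> = (real CARD('n) - 4 - \<alpha>) * (real CARD('n) + \<alpha>) / 4"
    and k: "k > 0"
    and le: "\<And>w. w \<in> tests1 \<Longrightarrow> k * power_integral (p + 1) w powr (2 / (p + 1))
        \<le> energy ((\<alpha> + 2)\<^sup>2 + 2 * \<gamma> - lam) (\<gamma>\<^sup>2) w"
  shows "sphere_area TYPE('n) powr (1 - 2 / (p + 1)) * k \<le> quotient \<alpha> p lam mu u"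
proof -
  define n where "n = real CARD('n)"
  define \<omega> where "\<omega> = sphere_area TYPE('n)"
  have \<omega>: "\<omega> > 0" unfolding \<omega>_def by (rule sphere_area_pos)
  define q where "q = p + 1"
  have q: "q > 2" using p by (simp add: q_def)
  define m where "m = (n - 4 - \<alpha>) / 2"
  define c where "c = (\<alpha> + 2) * (real CARD('n) - 4 - \<alpha>) / 2"
  have c: "c > 0" unfolding c_def using \<alpha> by simp
  have uD: "u \<in> D22 \<alpha>" "radial u" "u \<notin> null_functions" using u by (auto simp: D22_rad_def)
  obtain \<phi> h where \<phi>: "\<And>k. \<phi> k \<in> test_functions" and h: "h \<in> borel_measurable borel"
    and uh: "AE x in lebesgue. u x = h x"
    and h2: "integrable lborel (\<lambda>x. norm x powr (- \<alpha> - 4) * (h x)\<^sup>2)"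
    and \<phi>h: "\<And>k. integrable lborel (\<lambda>x. norm x powr (- \<alpha> - 4) * (\<phi> k x - h x)\<^sup>2)"
    and \<phi>h_lim: "(\<lambda>k. LINT x|lborel. norm x powr (- \<alpha> - 4) * (\<phi> k x - h x)\<^sup>2) \<longlonglongrightarrow> 0"
    and Zlim: "(\<lambda>k. LINT x|lborel. norm x powr (- \<alpha> - 4) * (\<phi> k x)\<^sup>2) \<longlonglongrightarrow> (LINT x|lborel. norm x powr (- \<alpha> - 4) * (h x)\<^sup>2)"
    and Gi: "integrable lebesgue (\<lambda>x. norm x powr (- \<alpha> - 2) * (norm (weak_gradient u x))\<^sup>2)"
    and Glim: "(\<lambda>k. LINT x|lborel. norm x powr (- \<alpha> - 2) * gradsq (\<phi> k) x) \<longlonglongrightarrow>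
       (LINT x|lebesgue. norm x powr (- \<alpha> - 2) * (norm (weak_gradient u x))\<^sup>2)"
    and Li: "integrable lebesgue (\<lambda>x. norm x powr (- \<alpha>) * \<bar>weak_laplacian u x\<bar>\<^sup>2)"
    and Llim: "(\<lambda>k. LINT x|lborel. norm x powr (- \<alpha>) * (laplacian (\<phi> k) x)\<^sup>2) \<longlonglongrightarrow>
       (LINT x|lebesgue. norm x powr (- \<alpha>) * \<bar>weak_laplacian u x\<bar>\<^sup>2)"
    by (rule D22_limits[OF uD(1) c_def c]) (rule that)
  have um: "u \<in> borel_measurable lebesgue" using uD(1) by (simp add: D22_def)
  obtain F where F: "F \<in> borel_measurable borel" "AE x in lebesgue. u x = F (- ln (norm x))"
    using radial_borel_representative[OF um uD(2)] by blast
  have "AE x in lebesgue. h x = F (- ln (norm x))" using uh F(2) by eventually_elim simp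
  then have hF: "AE x in lborel. h x = F (- ln (norm x))" by (simp add: AE_completion_iff)
  define w where "w k = emden m (\<phi> k)" for k
  define v where "v k = radial_part m (\<phi> k)" for k
  have w: "w k \<in> tests1" for k unfolding w_def by (rule tests1_emden[OF \<phi>])
  have v: "v k \<in> test_functions" "v k = rad m (w k)" for k
    unfolding v_def w_def by (rule test_radial_part[OF \<phi>], rule refl)
  have [measurable]: "h \<in> borel_measurable borel" "v k \<in> borel_measurable borel" for k using h v(1) by simp_all
  have vh: "integrable lborel (\<lambda>x. norm x powr (- \<alpha> - 4) * (v k x - h x)\<^sup>2)" for k
    unfolding v_def by (rule radial_part_distance_le(1)[OF \<phi> h h2 F(1) hF])
  have vh_lim: "(\<lambda>k. LINT x|lborel. norm x powr (- \<alpha> - 4) * (v k x - h x)\<^sup>2) \<longlonglongrightarrow> 0"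
  proof (rule tendsto_sandwich[OF _ _ tendsto_const \<phi>h_lim])
    show "\<forall>\<^sub>F k in sequentially. 0 \<le> (LINT x|lborel. norm x powr (- \<alpha> - 4) * (v k x - h x)\<^sup>2)"
      by (intro always_eventually allI integral_nonneg_AE AE_I2) simp
    show "\<forall>\<^sub>F k in sequentially. (LINT x|lborel. norm x powr (- \<alpha> - 4) * (v k x - h x)\<^sup>2)
       \<le> (LINT x|lborel. norm x powr (- \<alpha> - 4) * (\<phi> k x - h x)\<^sup>2)"
      unfolding v_def by (intro always_eventually allI radial_part_distance_le(2)[OF \<phi> h h2 F(1) hF])
  qed
  define L where "L k = (LINT x|lborel. norm x powr (- \<alpha>) * (laplacian (\<phi> k) x)\<^sup>2)" for k
  define G where "G k = (LINT x|lborel. norm x powr (- \<alpha> - 2) * gradsq (\<phi> k) x)" for k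
  define Z where "Z k = (LINT x|lborel. norm x powr (- \<alpha> - 4) * (\<phi> k x)\<^sup>2)" for k
  define W0 where "W0 k = (LINT s|lborel. (w k s)\<^sup>2)" for k
  define Lu where "Lu = (LINT x|lebesgue. norm x powr (- \<alpha>) * \<bar>weak_laplacian u x\<bar>\<^sup>2)"
  define Gu where "Gu = (LINT x|lebesgue. norm x powr (- \<alpha> - 2) * (norm (weak_gradient u x))\<^sup>2)"
  define Zu where "Zu = (LINT x|lborel. norm x powr (- \<alpha> - 4) * (h x)\<^sup>2)"
  have lims: "L \<longlonglongrightarrow> Lu" "G \<longlonglongrightarrow> Gu" "Z \<longlonglongrightarrow> Zu"
    using Llim Glim Zlim unfolding L_def Lu_def G_def Gu_def Z_def Zu_def .
  note ri = radial_integrals[OF w m_def[unfolded n_def] g, folded v(2)]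
  have "(\<lambda>k. LINT x|lborel. norm x powr (- \<alpha> - 4) * (v k x)\<^sup>2) \<longlonglongrightarrow> Zu"
  proof -
    define r where "r x = norm x powr (- \<alpha> / 2 - 2)" for x :: "real ^ 'n"
    have rm: "r \<in> borel_measurable borel" unfolding r_def by measurable
    have "r x * r x = norm x powr (- \<alpha> - 4)" for x by (simp add: r_def powr_add[symmetric])
    then have r2: "(r x * y)\<^sup>2 = norm x powr (- \<alpha> - 4) * y\<^sup>2" for x y
      by (simp add: power2_eq_square mult_ac)
    show ?thesis
      using L2_norm_tendsto[of "\<lambda>k x. r x * v k x" lborel "\<lambda>x. r x * h x"] rm vh vh_lim h2
      unfolding right_diff_distrib[symmetric] r2 Zu_def by simp
  qed
  then have W0lim: "(\<lambda>k. \<omega> * W0 k) \<longlonglongrightarrow> Zu" unfolding ri(1) W0_def \<omega>_def .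
  \<comment> \<open>The first two terms belong to \<open>\<phi> k\<close>, the last to its radial
    part. Passing to the radial part lowers the Laplacian and gradient terms, which have nonnegative
    coefficients. The coefficient of the last term is nonpositive, so there the comparison would go
    the wrong way; instead its integral is taken for the radial part from the start, which is
    harmless because the radial parts have the same limit.\<close>
  define T where "T k = L k - lam * G k + lam * m\<^sup>2 * (\<omega> * W0 k)" for k
  define Tu where "Tu = Lu - lam * Gu + lam * m\<^sup>2 * Zu"
  have Tlim: "T \<longlonglongrightarrow> Tu" unfolding T_def Tu_def by (intro tendsto_intros lims W0lim)
  have T_ge: "\<omega> * (k * power_integral q (w j) powr (2 / q)) \<le> T j" for j
  proof -
    have 1: "\<omega> * energy ((\<alpha> + 2)\<^sup>2 + 2 * \<gamma>) (\<gamma>\<^sup>2) (w j) \<le> L j"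
      using radial_part_laplacian_le[OF \<phi>[of j], where m=m and \<alpha>=\<alpha>, folded v_def]
      unfolding ri(3) L_def \<omega>_def .
    have 2: "\<omega> * ((LINT s|lborel. (deriv (w j) s)\<^sup>2) + m\<^sup>2 * W0 j) \<le> G j"
      using radial_part_gradsq_le[OF \<phi>[of j], where m=m and c="- \<alpha> - 2", folded v_def]
      unfolding ri(2) G_def W0_def \<omega>_def .
    have "\<omega> * (k * power_integral q (w j) powr (2 / q)) \<le> \<omega> * energy ((\<alpha> + 2)\<^sup>2 + 2 * \<gamma> + - lam) (\<gamma>\<^sup>2) (w j)"
      using le[OF w[of j]] \<omega> by (simp add: q_def)
    also have "\<dots> = \<omega> * energy ((\<alpha> + 2)\<^sup>2 + 2 * \<gamma>) (\<gamma>\<^sup>2) (w j)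
        + (- lam) * (\<omega> * ((LINT s|lborel. (deriv (w j) s)\<^sup>2) + m\<^sup>2 * W0 j)) + lam * m\<^sup>2 * (\<omega> * W0 j)"
      unfolding energy_add by (simp add: algebra_simps)
    also have "\<dots> \<le> L j + (- lam) * G j + lam * m\<^sup>2 * (\<omega> * W0 j)"
      by (intro add_mono mult_left_mono 1 2 order_refl) (use lam in simp)
    finally show ?thesis by (simp add: T_def)
  qed
  \<comment> \<open>\<open>T_ge\<close> solved for the power integral: a bound for the denominator
    that converges with \<open>T\<close>.\<close>
  define y where "y j = \<omega> * (T j / (\<omega> * k)) powr (q / 2)" for j
  have T_nonneg: "T j \<ge> 0" for j
    by (rule order_trans[OF _ T_ge]) (use \<omega> k in simp)
  have Tu_nonneg: "Tu \<ge> 0" by (rule LIMSEQ_le_const[OF Tlim]) (use T_nonneg in blast)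
  have ylim: "y \<longlonglongrightarrow> \<omega> * (Tu / (\<omega> * k)) powr (q / 2)"
    unfolding y_def
    by (intro tendsto_mult tendsto_const tendsto_powr2 tendsto_divide Tlim)
      (use \<omega> k q T_nonneg in \<open>auto intro!: always_eventually divide_nonneg_nonneg\<close>)
  have y_ge: "\<omega> * power_integral q (w j) \<le> y j" for j
  proof -
    have "power_integral q (w j) powr (2 / q) \<le> T j / (\<omega> * k)"
      using T_ge[of j] \<omega> k by (simp add: field_simps)
    then have "(power_integral q (w j) powr (2 / q)) powr (q / 2) \<le> (T j / (\<omega> * k)) powr (q / 2)"
      by (intro powr_mono2) (use q in auto)
    moreover have "(2 / q) * (q / 2) = 1" using q by simp
    then have "(power_integral q (w j) powr (2 / q)) powr (q / 2) = power_integral q (w j)"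
      unfolding powr_powr using power_integral_nonneg[of q "w j"] by (simp only: powr_one)
    ultimately show ?thesis unfolding y_def using \<omega> by simp
  qed
  define \<beta> where "\<beta> = q * m - n"
  have \<beta>: "weight_exponent (real CARD('n)) \<alpha> p = \<beta>"
    unfolding weight_exponent_eq[OF p] \<beta>_def q_def m_def n_def by simp
  have nn: "(\<integral>\<^sup>+x. ennreal (norm x powr \<beta> * \<bar>h x\<bar> powr q) \<partial>lborel) \<le> ennreal (\<omega> * (Tu / (\<omega> * k)) powr (q / 2))"
  proof (rule power_integral_Fatou[OF _ h vh vh_lim _ _ ylim])
    fix j
    have "(\<integral>\<^sup>+x. ennreal (norm x powr \<beta> * \<bar>v j x\<bar> powr q) \<partial>lborel) = ennreal (\<omega> * power_integral q (w j))"
      unfolding v(2) \<beta>_def n_def \<omega>_def by (rule radial_power_integral[OF w]) (use q in simp)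
    also have "\<dots> \<le> ennreal (y j)" by (intro ennreal_leI y_ge)
    finally show "(\<integral>\<^sup>+x. ennreal (norm x powr \<beta> * \<bar>v j x\<bar> powr q) \<partial>lborel) \<le> ennreal (y j)" .
  qed (use q in simp_all)
  define Q where "Q = (LINT x|lborel. norm x powr \<beta> * \<bar>h x\<bar> powr q)"
  \<comment> \<open>Integrability is essential here: without it the integral in the denominator
    would be 0 by default and the quotient would be 0 as well.\<close>
  have Qi: "integrable lborel (\<lambda>x. norm x powr \<beta> * \<bar>h x\<bar> powr q)"
  proof (rule integrableI_bounded)
    have "(\<integral>\<^sup>+x. ennreal (norm (norm x powr \<beta> * \<bar>h x\<bar> powr q)) \<partial>lborel) \<le> ennreal (\<omega> * (Tu / (\<omega> * k)) powr (q / 2))"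
      using nn by simp
    then show "(\<integral>\<^sup>+x. ennreal (norm (norm x powr \<beta> * \<bar>h x\<bar> powr q)) \<partial>lborel) < \<infinity>"
      by (rule le_less_trans) simp
  qed simp
  have Q_le: "Q \<le> \<omega> * (Tu / (\<omega> * k)) powr (q / 2)"
  proof -
    have "ennreal Q = (\<integral>\<^sup>+x. ennreal (norm x powr \<beta> * \<bar>h x\<bar> powr q) \<partial>lborel)"
      unfolding Q_def by (rule nn_integral_eq_integral[OF Qi, symmetric]) simp
    with nn have "ennreal Q \<le> ennreal (\<omega> * (Tu / (\<omega> * k)) powr (q / 2))" by simp
    then show ?thesis using \<omega> by (subst (asm) ennreal_le_iff) auto
  qed
  \<comment> \<open>The denominator is positive because \<open>u\<close> is not a null function, so
    the division in \<open>quotient\<close> is a genuine one.\<close>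
  have Q_pos: "Q > 0"
  proof -
    have "Q \<ge> 0" unfolding Q_def by (intro integral_nonneg_AE AE_I2) simp
    moreover have "Q \<noteq> 0"
    proof
      assume "Q = 0"
      then have "AE x in lborel. norm x powr \<beta> * \<bar>h x\<bar> powr q = 0"
        unfolding Q_def by (subst (asm) integral_nonneg_eq_0_iff_AE[OF Qi]) auto
      then have "AE x in lborel. h x = 0"
        using AE_lborel_singleton[of "0 :: real ^ 'n"] by eventually_elim simp
      then have "AE x in lebesgue. h x = 0" by (simp add: AE_completion_iff)
      with uh have "AE x in lebesgue. u x = 0" by eventually_elim simp
      then show False using uD(3) by (simp add: null_functions_def)
    qed
    ultimately show ?thesis by simp
  qed
  have main: "\<omega> powr (1 - 2 / q) * k * Q powr (2 / q) \<le> Tu"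
  proof -
    have e: "(q / 2) * (2 / q) = 1" using q by simp
    have "Q powr (2 / q) \<le> (\<omega> * (Tu / (\<omega> * k)) powr (q / 2)) powr (2 / q)"
      using Q_le Q_pos q by (intro powr_mono2) auto
    also have "\<dots> = \<omega> powr (2 / q) * (Tu / (\<omega> * k))"
      using \<omega> k Tu_nonneg by (simp only: powr_mult powr_powr e) simp
    finally have "\<omega> powr (1 - 2 / q) * k * Q powr (2 / q) \<le> \<omega> powr (1 - 2 / q) * k * (\<omega> powr (2 / q) * (Tu / (\<omega> * k)))"
      using k by (intro mult_left_mono) auto
    also have "\<dots> = (\<omega> powr (1 - 2 / q) * \<omega> powr (2 / q)) * (k * (Tu / (\<omega> * k)))" by (simp only: mult_ac)
    also have "\<omega> powr (1 - 2 / q) * \<omega> powr (2 / q) = \<omega>" using \<omega> by (simp add: powr_add[symmetric])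
    also have "\<omega> * (k * (Tu / (\<omega> * k))) = Tu" using \<omega> k by simp
    finally show ?thesis .
  qed
  have hl: "h \<in> borel_measurable lebesgue" by (rule measurable_completion) simp
  have Zi: "integrable lebesgue (\<lambda>x. norm x powr (- \<alpha> - 4) * (h x)\<^sup>2)"
    by (subst integrable_completion) (use h2 in simp_all)
  have aeZ: "AE x in lebesgue. norm x powr (- \<alpha> - 4) * (h x)\<^sup>2 = norm x powr (- \<alpha> - 4) * (u x)\<^sup>2"
    using uh by eventually_elim simp
  have Zum: "(\<lambda>x. norm x powr (- \<alpha> - 4) * (u x)\<^sup>2) \<in> borel_measurable lebesgue"
    by (rule borel_measurable_AE[OF borel_measurable_integrable[OF Zi] aeZ])
  have Zui: "integrable lebesgue (\<lambda>x. norm x powr (- \<alpha> - 4) * (u x)\<^sup>2)"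
    by (rule integrable_cong_AE_imp[OF Zi Zum aeZ])
  have "(LINT x|lebesgue. norm x powr (- \<alpha> - 4) * (u x)\<^sup>2) = (LINT x|lebesgue. norm x powr (- \<alpha> - 4) * (h x)\<^sup>2)"
    by (rule integral_cong_AE[OF Zum borel_measurable_integrable[OF Zi]]) (rule eventually_mono[OF aeZ], erule sym)
  also have "\<dots> = Zu" unfolding Zu_def by (rule LINT_completion) simp
  finally have Zeq: "(LINT x|lebesgue. norm x powr (- \<alpha> - 4) * (u x)\<^sup>2) = Zu" .
  have num: "(LINT x|lebesgue. norm x powr (- \<alpha>) * \<bar>weak_laplacian u x\<bar>\<^sup>2
        - lam * norm x powr (- \<alpha> - 2) * (norm (weak_gradient u x))\<^sup>2
        + mu * norm x powr (- \<alpha> - 4) * (u x)\<^sup>2) = Lu - lam * Gu + mu * Zu"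
    unfolding mult.assoc using Li Gi Zui by (simp add: Lu_def Gu_def Zeq)
  have aeQ: "AE x in lebesgue. norm x powr \<beta> * \<bar>u x\<bar> powr q = norm x powr \<beta> * \<bar>h x\<bar> powr q"
    using uh by eventually_elim simp
  have Qhm: "(\<lambda>x. norm x powr \<beta> * \<bar>h x\<bar> powr q) \<in> borel_measurable lebesgue" by (rule measurable_completion) simp
  have Qum: "(\<lambda>x. norm x powr \<beta> * \<bar>u x\<bar> powr q) \<in> borel_measurable lebesgue"
    by (rule borel_measurable_AE[OF Qhm]) (rule eventually_mono[OF aeQ], erule sym)
  have den: "(LINT x|lebesgue. norm x powr \<beta> * \<bar>u x\<bar> powr q) = Q"
    unfolding Q_def by (subst integral_cong_AE[OF Qum Qhm aeQ]) (rule LINT_completion, simp)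
  have "Zu \<ge> 0" unfolding Zu_def by (intro integral_nonneg_AE AE_I2) simp
  moreover have "lam * m\<^sup>2 \<le> mu" using mu by (simp add: m_def n_def power_divide mult.commute)
  ultimately have "lam * m\<^sup>2 * Zu \<le> mu * Zu" by (rule mult_right_mono[rotated])
  with main have "\<omega> powr (1 - 2 / q) * k * Q powr (2 / q) \<le> Lu - lam * Gu + mu * Zu"
    unfolding Tu_def by linarith
  then show ?thesis
    unfolding quotient_def \<beta> num den[unfolded q_def] \<omega>_def[symmetric] q_def[symmetric]
    using Q_pos den by (simp add: pos_le_divide_eq q_def)
qed

section \<open>The quotient of test functions\<close>

text \<open>On the fixed range between \<open>1 / M\<close> and \<open>M\<close> both bounds tend to
  1 as the exponent tends to 0. This is what makes the quotient of a fixed test function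
  semicontinuous in the weights.\<close>

lemma powr_bounds:
  fixes t M a :: real
  assumes "t > 0" "1 / M \<le> t" "t \<le> M" "M \<ge> 1"
  shows "t powr a \<le> M powr \<bar>a\<bar>" "M powr (- \<bar>a\<bar>) \<le> t powr a"
proof -
  have "ln t \<le> ln M" using assms by simp
  moreover have "ln (1 / M) \<le> ln t" using assms by (subst ln_le_cancel_iff) auto
  then have "- ln M \<le> ln t" using assms by (simp add: ln_div)
  ultimately have "\<bar>ln t\<bar> \<le> ln M" by simp
  then have "\<bar>a\<bar> * \<bar>ln t\<bar> \<le> \<bar>a\<bar> * ln M" by (rule mult_left_mono) simp
  then have b: "\<bar>a * ln t\<bar> \<le> \<bar>a\<bar> * ln M" by (simp add: abs_mult)
  show "t powr a \<le> M powr \<bar>a\<bar>" using b assms by (simp add: powr_def)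
  show "M powr (- \<bar>a\<bar>) \<le> t powr a" using b assms by (simp add: powr_def)
qed

text \<open>All derivatives of \<open>\<psi>\<close> live in the annulus of \<open>\<psi>\<close>,
  so each weight can be traded for a power of \<open>M\<close>, and
  \<open>\<bar>\<psi>\<bar> powr q'\<close> for \<open>\<bar>\<psi>\<bar> powr q\<close> at the cost
  of \<open>B powr (q' - q)\<close>. The numbers \<open>K\<close> and \<open>N\<close> do not depend
  on \<open>\<alpha>\<close> and \<open>p\<close>, so the dependence of the bound on them is
  explicit and continuous; for \<open>\<alpha> = \<beta> = 0\<close> and \<open>q = q'\<close> it
  becomes \<open>K / N powr (2 / q)\<close>.\<close>

lemma quotient_test_le:
  fixes \<psi> :: "real ^ 'n::finite \<Rightarrow> real"
  assumes \<psi>: "\<psi> \<in> test_functions"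
    and M: "M \<ge> 1" "\<And>x. \<psi> x \<noteq> 0 \<Longrightarrow> 1 / M \<le> norm x \<and> norm x \<le> M"
    and B: "B \<ge> 1" "\<And>x. \<bar>\<psi> x\<bar> \<le> B"
    and q: "q = p + 1" "p > 1" "q \<le> q'"
    and N: "N = (LINT x|lborel. \<bar>\<psi> x\<bar> powr q')" "N > 0"
    and K: "K = (LINT x|lborel. (laplacian \<psi> x)\<^sup>2) + \<bar>lam\<bar> * (LINT x|lborel. norm x powr (- 2) * gradsq \<psi> x)
      + \<bar>mu\<bar> * (LINT x|lborel. norm x powr (- 4) * (\<psi> x)\<^sup>2)"
    and \<beta>: "\<beta> = q * (real CARD('n) - 4 - \<alpha>) / 2 - real CARD('n)"
  shows "quotient \<alpha> p lam mu \<psi> \<le> M powr \<bar>\<alpha>\<bar> * K / (M powr (- \<bar>\<beta>\<bar>) * B powr (- (q' - q)) * N) powr (2 / q)"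
proof -
  have [measurable]: "\<psi> \<in> borel_measurable borel" using \<psi> by simp
  note \<psi>' = test_laplacian[OF \<psi>] test_gradsq[OF \<psi>]
  have Mpos: "1 / M > 0" using M(1) by simp
  have supp_p: "1 / M \<le> norm x \<and> norm x \<le> M" if "partial i \<psi> x \<noteq> 0" for i x
    by (rule partial_eq_0_outside[of \<psi> "1 / M" M i x]) (use M(2) that in auto)
  have supp_pp: "1 / M \<le> norm x \<and> norm x \<le> M" if "partial i (partial i \<psi>) x \<noteq> 0" for i x
    by (rule partial_eq_0_outside[of "partial i \<psi>" "1 / M" M i x]) (use supp_p that in auto)
  have supp_l: "1 / M \<le> norm x \<and> norm x \<le> M" if "laplacian \<psi> x \<noteq> 0" for x
  proof -
    obtain i where "partial i (partial i \<psi>) x \<noteq> 0" using \<open>laplacian \<psi> x \<noteq> 0\<close> unfolding laplacian_def by (meson sum.neutral)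
    then show ?thesis by (rule supp_pp)
  qed
  have supp_g: "1 / M \<le> norm x \<and> norm x \<le> M" if "gradsq \<psi> x \<noteq> 0" for x
  proof -
    obtain i where "(partial i \<psi> x)\<^sup>2 \<noteq> 0" using \<open>gradsq \<psi> x \<noteq> 0\<close> unfolding gradsq_def by (meson sum.neutral)
    then show ?thesis using supp_p by simp
  qed
  have wt: "norm x powr (- \<alpha>) \<le> M powr \<bar>\<alpha>\<bar>" if "1 / M \<le> norm x \<and> norm x \<le> M" for x :: "real ^ 'n"
    using powr_bounds(1)[of "norm x" M "- \<alpha>"] that M(1) Mpos by (cases "x = 0") simp_all
  let ?L = "\<lambda>x. norm x powr (- \<alpha>) * (laplacian \<psi> x)\<^sup>2"
  let ?G = "\<lambda>x. norm x powr (- \<alpha> - 2) * gradsq \<psi> x"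
  let ?Z = "\<lambda>x. norm x powr (- \<alpha> - 4) * (\<psi> x)\<^sup>2"
  let ?La = "\<lambda>x. (laplacian \<psi> x)\<^sup>2"
  let ?Ga = "\<lambda>x. norm x powr (- 2) * gradsq \<psi> x"
  let ?Za = "\<lambda>x. norm x powr (- 4) * (\<psi> x)\<^sup>2"
  have tests: "?L \<in> test_functions" "?G \<in> test_functions" "?Z \<in> test_functions"
    "?La \<in> test_functions" "?Ga \<in> test_functions" "?Za \<in> test_functions"
    by (intro test_powr test_sq \<psi> \<psi>')+
  note ints = tests[THEN test_integrable]
  have gpos: "gradsq \<psi> x \<ge> 0" for x by (simp add: gradsq_def sum_nonneg)
  have le: "?L x \<le> M powr \<bar>\<alpha>\<bar> * ?La x" "?G x \<le> M powr \<bar>\<alpha>\<bar> * ?Ga x" "?Z x \<le> M powr \<bar>\<alpha>\<bar> * ?Za x" for x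
  proof -
    show "?L x \<le> M powr \<bar>\<alpha>\<bar> * ?La x"
    proof (cases "laplacian \<psi> x = 0")
      case False
      then show ?thesis by (intro mult_right_mono wt supp_l) simp_all
    qed simp
    have s: "norm x powr (- \<alpha> - c) = norm x powr (- \<alpha>) * norm x powr (- c)" for c
      by (simp add: powr_add[symmetric])
    show "?G x \<le> M powr \<bar>\<alpha>\<bar> * ?Ga x"
    proof (cases "gradsq \<psi> x = 0")
      case False
      then have "norm x powr (- \<alpha>) * ?Ga x \<le> M powr \<bar>\<alpha>\<bar> * ?Ga x"
        by (intro mult_right_mono wt supp_g mult_nonneg_nonneg gpos) simp_all
      then show ?thesis unfolding s by (simp add: mult.assoc)
    qed simp
    show "?Z x \<le> M powr \<bar>\<alpha>\<bar> * ?Za x"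
    proof (cases "\<psi> x = 0")
      case False
      then have "norm x powr (- \<alpha>) * ?Za x \<le> M powr \<bar>\<alpha>\<bar> * ?Za x"
        by (intro mult_right_mono wt M(2)) simp_all
      then show ?thesis unfolding s by (simp add: mult.assoc)
    qed simp
  qed
  let ?W = "\<lambda>x. norm x powr (- \<alpha>) * \<bar>weak_laplacian \<psi> x\<bar>\<^sup>2
        - lam * norm x powr (- \<alpha> - 2) * (norm (weak_gradient \<psi> x))\<^sup>2
        + mu * norm x powr (- \<alpha> - 4) * (\<psi> x)\<^sup>2"
  let ?C = "\<lambda>x. ?L x - lam * ?G x + mu * ?Z x"
  have ae: "AE x in lebesgue. ?C x = ?W x"
    using weak_derivatives_test[OF \<psi>]
  proof eventually_elim
    case (elim x)
    have "(norm (\<chi> i. partial i \<psi> x))\<^sup>2 = gradsq \<psi> x"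
      unfolding sum_coord_sq[symmetric] gradsq_def by (simp add: power2_eq_square)
    then show ?case unfolding elim by simp
  qed
  have Ct: "?C \<in> test_functions"
    by (rule test_add[OF test_diff[OF tests(1) test_cmult[OF tests(2)]] test_cmult[OF tests(3)]])
  have Cm: "?C \<in> borel_measurable lebesgue" by (rule test_measurable_lebesgue[OF Ct])
  have "(LINT x|lebesgue. ?W x) = (LINT x|lebesgue. ?C x)"
    by (rule integral_cong_AE[OF borel_measurable_AE[OF Cm ae] Cm]) (rule eventually_mono[OF ae], erule sym)
  also have "\<dots> = (LINT x|lborel. ?C x)" by (rule test_integral_lebesgue(2)[OF Ct])
  also have "\<dots> \<le> (LINT x|lborel. M powr \<bar>\<alpha>\<bar> * (?La x + \<bar>lam\<bar> * ?Ga x + \<bar>mu\<bar> * ?Za x))"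
  proof (rule integral_mono)
    fix x
    have "- lam * ?G x \<le> \<bar>lam\<bar> * ?G x" by (rule mult_right_mono) (use gpos in auto)
    also have "\<dots> \<le> \<bar>lam\<bar> * (M powr \<bar>\<alpha>\<bar> * ?Ga x)" by (rule mult_left_mono[OF le(2)]) simp
    finally have 1: "- lam * ?G x \<le> \<bar>lam\<bar> * (M powr \<bar>\<alpha>\<bar> * ?Ga x)" .
    have "mu * ?Z x \<le> \<bar>mu\<bar> * ?Z x" by (rule mult_right_mono) auto
    also have "\<dots> \<le> \<bar>mu\<bar> * (M powr \<bar>\<alpha>\<bar> * ?Za x)" by (rule mult_left_mono[OF le(3)]) simp
    finally have 2: "mu * ?Z x \<le> \<bar>mu\<bar> * (M powr \<bar>\<alpha>\<bar> * ?Za x)" .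
    show "?C x \<le> M powr \<bar>\<alpha>\<bar> * (?La x + \<bar>lam\<bar> * ?Ga x + \<bar>mu\<bar> * ?Za x)"
      using le(1)[of x] 1 2 by (simp only: distrib_left mult.left_commute)
  qed (use ints in auto)
  also have "\<dots> = M powr \<bar>\<alpha>\<bar> * K" unfolding K using ints by simp
  finally have num: "(LINT x|lebesgue. ?W x) \<le> M powr \<bar>\<alpha>\<bar> * K" .
  have "K \<ge> 0" unfolding K
    by (intro add_nonneg_nonneg mult_nonneg_nonneg integral_nonneg_AE AE_I2) (simp_all add: gpos)
  then have num0: "M powr \<bar>\<alpha>\<bar> * K \<ge> 0" by simp
  have \<beta>': "weight_exponent (real CARD('n)) \<alpha> p = \<beta>"
    unfolding weight_exponent_eq[OF q(2)] \<beta> q(1) ..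
  let ?D = "\<lambda>x. norm x powr \<beta> * \<bar>\<psi> x\<bar> powr q"
  have q0: "q > 0" "q' > 0" using q by simp_all
  have Di: "integrable lborel ?D"
  proof (rule integrable_bounded_supportN[of _ M "M powr \<bar>\<beta>\<bar> * B powr q"])
    show "?D x = 0" if "M < norm x" for x using M(2)[of x] that by fastforce
    show "\<bar>?D x\<bar> \<le> M powr \<bar>\<beta>\<bar> * B powr q" for x
    proof (cases "\<psi> x = 0")
      case False
      then have "norm x powr \<beta> \<le> M powr \<bar>\<beta>\<bar>" using powr_bounds(1)[of "norm x" M \<beta>] M Mpos by force
      moreover have "\<bar>\<psi> x\<bar> powr q \<le> B powr q" using B(2) q0 by (intro powr_mono2) auto
      ultimately show ?thesis by (simp add: abs_mult mult_mono)
    qed simp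
  qed simp
  have Ni: "integrable lborel (\<lambda>x. \<bar>\<psi> x\<bar> powr q')"
  proof (rule integrable_bounded_supportN[of _ M "B powr q'"])
    show "\<bar>\<psi> x\<bar> powr q' = 0" if "M < norm x" for x using M(2)[of x] that by fastforce
    show "\<bar>\<bar>\<psi> x\<bar> powr q'\<bar> \<le> B powr q'" for x using powr_mono2[of q' "\<bar>\<psi> x\<bar>" B] B(2) q0 by simp
  qed simp
  have "M powr (- \<bar>\<beta>\<bar>) * B powr (- (q' - q)) * N = (LINT x|lborel. M powr (- \<bar>\<beta>\<bar>) * B powr (- (q' - q)) * \<bar>\<psi> x\<bar> powr q')"
    unfolding N(1) using Ni by simp
  also have "\<dots> \<le> (LINT x|lborel. ?D x)"
  proof (rule integral_mono[OF _ Di])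
    show "integrable lborel (\<lambda>x. M powr (- \<bar>\<beta>\<bar>) * B powr (- (q' - q)) * \<bar>\<psi> x\<bar> powr q')" using Ni by simp
    fix x
    show "M powr (- \<bar>\<beta>\<bar>) * B powr (- (q' - q)) * \<bar>\<psi> x\<bar> powr q' \<le> ?D x"
    proof (cases "\<psi> x = 0")
      case False
      have "\<bar>\<psi> x\<bar> powr q' = \<bar>\<psi> x\<bar> powr (q' - q) * \<bar>\<psi> x\<bar> powr q" by (simp add: powr_add[symmetric])
      also have "\<dots> \<le> B powr (q' - q) * \<bar>\<psi> x\<bar> powr q"
        by (intro mult_right_mono powr_mono2) (use B(2) q(3) in auto)
      finally have "B powr (- (q' - q)) * \<bar>\<psi> x\<bar> powr q' \<le> B powr (- (q' - q)) * (B powr (q' - q) * \<bar>\<psi> x\<bar> powr q)"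
        by (rule mult_left_mono) simp
      also have "\<dots> = \<bar>\<psi> x\<bar> powr q" using B(1) by (simp add: mult.assoc[symmetric] powr_add[symmetric])
      finally have 1: "B powr (- (q' - q)) * \<bar>\<psi> x\<bar> powr q' \<le> \<bar>\<psi> x\<bar> powr q" .
      have "M powr (- \<bar>\<beta>\<bar>) \<le> norm x powr \<beta>" using powr_bounds(2)[of "norm x" M \<beta>] M False Mpos by force
      then show ?thesis unfolding mult.assoc by (rule mult_mono[OF _ 1]) simp_all
    qed simp
  qed
  also have "\<dots> = (LINT x|lebesgue. ?D x)" by (rule LINT_completion[symmetric]) simp
  finally have den: "M powr (- \<bar>\<beta>\<bar>) * B powr (- (q' - q)) * N \<le> (LINT x|lebesgue. ?D x)" .
  have den0: "M powr (- \<bar>\<beta>\<bar>) * B powr (- (q' - q)) * N > 0" using M(1) B(1) N(2) by simp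
  show ?thesis unfolding quotient_def \<beta>' q(1)[symmetric]
    by (rule frac_le[OF num0 num]) (use den den0 q0 in \<open>auto intro!: powr_mono2\<close>)
qed

lemma test_in_D22:
  assumes \<psi>: "\<psi> \<in> test_functions" shows "\<psi> \<in> D22 \<alpha>"
proof -
  have z: "laplacian (\<lambda>x. \<psi> x - \<psi> x) = (\<lambda>x. 0)"
    unfolding laplacian_diff[OF test_functions_smooth[OF \<psi>] test_functions_smooth[OF \<psi>]] by simp
  have "D22_norm \<alpha> (\<lambda>x. \<psi> x - \<psi> x) = 0" unfolding D22_norm_def z by simp
  then show ?thesis unfolding D22_def
    by (intro CollectI conjI exI[of _ "\<lambda>k. \<psi>"] test_measurable_lebesgue[OF \<psi>]) (simp_all add: \<psi>)
qed

section \<open>Translates of test functions\<close>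

lemma test_translate:
  fixes \<phi> :: "real ^ 'n::finite \<Rightarrow> real"
  assumes \<phi>: "\<phi> \<in> test_functions" and R: "\<And>x. \<phi> x \<noteq> 0 \<Longrightarrow> norm x \<le> R" and y: "norm y > R"
  shows "(\<lambda>x. \<phi> (x - y)) \<in> test_functions"
    and "\<phi> (x - y) \<noteq> 0 \<Longrightarrow> norm y - R \<le> norm x \<and> norm x \<le> norm y + R"
proof -
  show s: "\<phi> (x - y) \<noteq> 0 \<Longrightarrow> norm y - R \<le> norm x \<and> norm x \<le> norm y + R" for x
    using R[of "x - y"] norm_triangle_ineq2[of y x] norm_triangle_ineq2[of x y] by (simp add: norm_minus_commute)
  have "norm y - R > 0" using y by simp
  then show "(\<lambda>x. \<phi> (x - y)) \<in> test_functions"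
    unfolding test_functions_iff using s smooth_translate[OF test_functions_smooth[OF \<phi>], of y] by blast
qed

lemma gradsq_translate:
  "smooth \<phi> \<Longrightarrow> gradsq (\<lambda>x. \<phi> (x - y)) x = gradsq \<phi> (x - y)"
  by (simp add: gradsq_def partial_translate)

lemma lborel_integral_translate_diff:
  fixes f :: "real ^ 'n::finite \<Rightarrow> real"
  assumes "f \<in> borel_measurable borel"
  shows "(LINT x|lborel. f (x - y)) = (LINT x|lborel. f x)"
  using lborel_integral_translate(1)[OF assms, of "- y"] by simp

lemma translated_weight_integral_le:
  fixes f :: "real ^ 'n::finite \<Rightarrow> real"
  assumes f: "f \<in> test_functions" "\<And>x. f x \<ge> 0" and R: "\<And>x. f x \<noteq> 0 \<Longrightarrow> norm x \<le> R"
    and y: "norm y \<ge> R + T" "T > 0" and a: "a > 0"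
  shows "(LINT x|lborel. norm x powr (- a) * f (x - y)) \<le> T powr (- a) * (LINT x|lborel. f x)"
proof -
  have t: "(\<lambda>x. f (x - y)) \<in> test_functions" by (rule test_translate(1)[OF f(1) R]) (use y in simp_all)
  have fm: "f \<in> borel_measurable borel" using f(1) by simp
  have "(LINT x|lborel. norm x powr (- a) * f (x - y)) \<le> (LINT x|lborel. T powr (- a) * f (x - y))"
  proof (rule integral_mono)
    show "integrable lborel (\<lambda>x. norm x powr (- a) * f (x - y))" by (rule test_integrable[OF test_powr[OF t]])
    show "integrable lborel (\<lambda>x. T powr (- a) * f (x - y))" by (rule integrable_mult_right[OF test_integrable[OF t]])
    fix x
    show "norm x powr (- a) * f (x - y) \<le> T powr (- a) * f (x - y)"
    proof (cases "f (x - y) = 0")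
      case False
      have "norm y - R \<le> norm x" using test_translate(2)[OF f(1) R _ False] y by simp
      then have "T \<le> norm x" using y by simp
      then have "norm x powr (- a) \<le> T powr (- a)" using y(2) a by (intro powr_mono2') auto
      then show ?thesis by (rule mult_right_mono) (rule f(2))
    qed simp
  qed
  also have "\<dots> = T powr (- a) * (LINT x|lborel. f x)" by (simp add: lborel_integral_translate_diff[OF fm])
  finally show ?thesis .
qed

section \<open>Comparison of the infima\<close>

text \<open>Absorbs the variation of the coefficients with \<alpha>. The coefficient of
  \<open>w\<close> squared may drop slightly below its limit value, which costs the factor
  \<open>t\<close>; the coefficient of \<open>w'\<close> squared has slack and is not allowed to
  drop.\<close>

lemma energy_scale_le:
  assumes "0 \<le> t" "t \<le> 1" "0 \<le> a" "a \<le> a'" "t * b \<le> b'"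
  shows "t * energy a b w \<le> energy a' b' w"
proof -
  have "t * a \<le> a'" using mult_left_le_one_le[of a t] assms by simp
  moreover have "t * energy a b w = t * (LINT s|lborel. (deriv (deriv w) s)\<^sup>2)
      + (t * a) * (LINT s|lborel. (deriv w s)\<^sup>2) + (t * b) * (LINT s|lborel. (w s)\<^sup>2)"
    by (simp add: energy_def algebra_simps)
  moreover have "t * (LINT s|lborel. (deriv (deriv w) s)\<^sup>2) \<le> (LINT s|lborel. (deriv (deriv w) s)\<^sup>2)"
    using assms(1,2) sq_integral_nonneg[of "deriv (deriv w)"] by (simp add: mult_left_le_one_le)
  ultimately show ?thesis
    unfolding energy_def by (simp only:) (intro add_mono mult_right_mono sq_integral_nonneg assms(5))
qed

text \<open>A nearly optimal profile with exponent \<open>(n - 4) / 2\<close> is realised as a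
  radial test function and translated. The unweighted integrals \<open>L\<close> and
  \<open>N\<close> are unaffected, while the gradient and zero order terms, whose weights are
  \<open>norm x powr (- 2)\<close> and \<open>norm x powr (- 4)\<close>, decay. The restriction
  \<open>snd z \<le> critical_exponent n\<close> stems from \<open>quotient_test_le\<close>, which
  compares with a larger exponent.\<close>

lemma ex_test_near_optimal:
  fixes lam mu :: real
  assumes n: "n = real CARD('n::finite)" "n \<ge> 5"
    and g0: "\<gamma>\<^sub>0 = (n - 4) * n / 4"
    and kap: "sphere_area TYPE('n) powr (1 - 2 / critical_exponent n)
       * best_constant (4 + 2 * \<gamma>\<^sub>0) (\<gamma>\<^sub>0\<^sup>2) (critical_exponent n) < \<kappa>"
  obtains \<psi> :: "real ^ 'n \<Rightarrow> real" where "\<psi> \<in> test_functions" "\<psi> \<notin> null_functions"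
    "\<forall>\<^sub>F z in nhds (0, critical_exponent n). snd z > 2 \<longrightarrow> snd z \<le> critical_exponent n \<longrightarrow>
       quotient (fst z) (snd z - 1) lam mu \<psi> < \<kappa>"
proof -
  define Q where "Q = critical_exponent n"
  \<comment> \<open>The second identity says that \<open>\<beta> = 0\<close> at the limit point, so
    that the denominator carries no weight and is invariant under translations.\<close>
  have Q: "Q > 2" "Q * (n - 4) / 2 - n = 0" using n(2) by (simp_all add: Q_def critical_exponent_def field_simps)
  define \<omega> where "\<omega> = sphere_area TYPE('n)"
  have \<omega>: "\<omega> > 0" unfolding \<omega>_def by (rule sphere_area_pos)
  define e where "e = \<omega> powr (1 - 2 / Q)"
  have e: "e > 0" using \<omega> by (simp add: e_def)
  let ?S = "best_constant (4 + 2 * \<gamma>\<^sub>0) (\<gamma>\<^sub>0\<^sup>2) Q"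
  have "?S < \<kappa> / e" using kap e unfolding Q_def[symmetric] \<omega>_def[symmetric] e_def[symmetric] by (simp add: field_simps)
  then obtain w where w: "w \<in> tests1" "power_integral Q w > 0"
    "energy (4 + 2 * \<gamma>\<^sub>0) (\<gamma>\<^sub>0\<^sup>2) w < \<kappa> / e * power_integral Q w powr (2 / Q)"
    using best_constant_approx[of Q "4 + 2 * \<gamma>\<^sub>0" "\<gamma>\<^sub>0\<^sup>2" "\<kappa> / e"] Q(1) by auto
  define \<phi> :: "real ^ 'n \<Rightarrow> real" where "\<phi> = rad ((n - 4) / 2) w"
  have \<phi>: "\<phi> \<in> test_functions" unfolding \<phi>_def by (rule test_rad[OF w(1)])
  have [measurable]: "\<phi> \<in> borel_measurable borel" using \<phi> by simp
  define L where "L = (LINT x|lborel. (laplacian \<phi> x)\<^sup>2)"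
  define N where "N = (LINT x|lborel. \<bar>\<phi> x\<bar> powr Q)"
  have L_eq: "L = \<omega> * energy (4 + 2 * \<gamma>\<^sub>0) (\<gamma>\<^sub>0\<^sup>2) w"
  proof -
    have "norm x powr (- 0) * (laplacian \<phi> x)\<^sup>2 = (laplacian \<phi> x)\<^sup>2" for x
      using test_at_0[OF test_laplacian[OF \<phi>]] by (cases "x = 0") simp_all
    then have "L = (LINT x|lborel. norm x powr (- 0) * (laplacian \<phi> x)\<^sup>2)" unfolding L_def by (simp only:)
    also have "\<dots> = \<omega> * energy ((0 + 2)\<^sup>2 + 2 * \<gamma>\<^sub>0) (\<gamma>\<^sub>0\<^sup>2) w"
      unfolding \<phi>_def \<omega>_def by (rule radial_integral_laplacian[OF w(1)]) (simp_all add: n(1) g0)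
    finally show ?thesis by simp
  qed
  have N_eq: "N = \<omega> * power_integral Q w"
  proof -
    have wt: "norm x powr (Q * ((n - 4) / 2) - real CARD('n)) * \<bar>\<phi> x\<bar> powr Q = \<bar>\<phi> x\<bar> powr Q" for x
      using Q(2) test_at_0[OF \<phi>] by (cases "x = 0") (simp_all add: n(1))
    have "Q > 0" using Q(1) by simp
    have "(\<integral>\<^sup>+x. ennreal (\<bar>\<phi> x\<bar> powr Q) \<partial>lborel) = ennreal (\<omega> * power_integral Q w)"
      using radial_power_integral[OF w(1) \<open>Q > 0\<close>, of "(n - 4) / 2", where 'n='n]
      unfolding \<phi>_def[symmetric] \<omega>_def[symmetric] wt .
    then show ?thesis unfolding N_def
      by (intro integral_eq_nn_integral[THEN trans]) (use \<omega> power_integral_nonneg[of Q w] in auto)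
  qed
  have N: "N > 0" using \<omega> w(2) by (simp add: N_eq)
  have base: "L / N powr (2 / Q) < \<kappa>"
  proof -
    have "\<omega> = e * \<omega> powr (2 / Q)" using \<omega> by (simp add: e_def powr_add[symmetric])
    then have "L / N powr (2 / Q) = e * (energy (4 + 2 * \<gamma>\<^sub>0) (\<gamma>\<^sub>0\<^sup>2) w / power_integral Q w powr (2 / Q))"
      unfolding L_eq N_eq using \<omega> w(2) by (simp add: powr_mult field_simps)
    also have "\<dots> < e * (\<kappa> / e)"
      by (rule mult_strict_left_mono) (use w e in \<open>simp_all add: pos_divide_less_eq\<close>)
    finally show ?thesis using e by simp
  qed
  define G where "G = (LINT x|lborel. gradsq \<phi> x)"
  define Z where "Z = (LINT x|lborel. (\<phi> x)\<^sup>2)"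
  let ?K = "\<lambda>T. L + \<bar>lam\<bar> * (T powr (- 2) * G) + \<bar>mu\<bar> * (T powr (- 4) * Z)"
  \<comment> \<open>\<open>T\<close> will be the distance of the support from the origin. Its
    choice, and with it the final thresholds, depends on \<lambda> and \<mu>.\<close>
  have "((\<lambda>T. ?K T / N powr (2 / Q)) \<longlongrightarrow> (L + \<bar>lam\<bar> * (0 * G) + \<bar>mu\<bar> * (0 * Z)) / N powr (2 / Q)) at_top"
    by (intro tendsto_intros tendsto_neg_powr filterlim_ident) (use N in simp_all)
  then have "\<forall>\<^sub>F T in at_top. ?K T / N powr (2 / Q) < \<kappa>" by (rule order_tendstoD(2)) (use base in simp)
  from eventually_conj[OF this eventually_ge_at_top[of 1]] obtain T where T: "?K T / N powr (2 / Q) < \<kappa>" "T \<ge> 1"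
    unfolding eventually_at_top_linorder by blast
  obtain r0 R0 where R0: "r0 > 0" "\<And>x. \<phi> x \<noteq> 0 \<Longrightarrow> r0 \<le> norm x \<and> norm x \<le> R0" using \<phi> by (rule test_functionsE) blast
  define R where "R = max R0 0"
  have R: "R \<ge> 0" "\<phi> x \<noteq> 0 \<Longrightarrow> norm x \<le> R" for x using R0(2)[of x] by (simp_all add: R_def le_max_iff_disj)
  have Rp: "norm x \<le> R" if "partial i \<phi> x \<noteq> 0" for i x
    using partial_eq_0_outside[of \<phi> 0 R i x] R(2) that by simp
  have Rg: "norm x \<le> R" if "gradsq \<phi> x \<noteq> 0" for x
  proof -
    obtain i where "(partial i \<phi> x)\<^sup>2 \<noteq> 0" using \<open>gradsq \<phi> x \<noteq> 0\<close> unfolding gradsq_def by (meson sum.neutral)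
    then show ?thesis using Rp by simp
  qed
  \<comment> \<open>The direction is irrelevant; the length \<open>R + T\<close> keeps the support,
    of radius \<open>R\<close> around \<open>y\<close>, outside the open ball of radius
    \<open>T\<close>.\<close>
  define y :: "real ^ 'n" where "y = (R + T) *\<^sub>R axis undefined 1"
  have y: "norm y = R + T" using R(1) T(2) by (simp add: y_def)
  define \<psi> where "\<psi> = (\<lambda>x. \<phi> (x - y))"
  have \<psi>: "\<psi> \<in> test_functions" unfolding \<psi>_def by (rule test_translate(1)[OF \<phi> R(2)]) (use y T in simp_all)
  \<comment> \<open>The translated support lies between the radii \<open>T\<close> and
    \<open>2 * R + T\<close>; since \<open>T \<ge> 1\<close>, the lower radius is also at least
    \<open>1 / M\<close>.\<close>
  define M where "M = 2 * R + T"
  have M1: "M \<ge> 1" using R T by (simp add: M_def)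
  have Msupp: "1 / M \<le> norm x \<and> norm x \<le> M" if "\<psi> x \<noteq> 0" for x
  proof -
    have "norm y - R \<le> norm x \<and> norm x \<le> norm y + R"
      by (rule test_translate(2)[OF \<phi> R(2)]) (use y T that in \<open>simp_all add: \<psi>_def\<close>)
    then have "1 \<le> norm x" "norm x \<le> M" using y T by (simp_all add: M_def)
    moreover have "1 / M \<le> 1" using M1 by simp
    ultimately show ?thesis by linarith
  qed
  obtain B0 where B0: "\<forall>x. \<bar>\<phi> x\<bar> \<le> B0" using test_bounded[OF \<phi>] by blast
  define B where "B = max B0 1"
  have B: "B \<ge> 1" "\<bar>\<psi> x\<bar> \<le> B" for x using B0 by (simp_all add: B_def \<psi>_def le_max_iff_disj)
  have N\<psi>: "N = (LINT x|lborel. \<bar>\<psi> x\<bar> powr Q)"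
    unfolding N_def \<psi>_def by (rule lborel_integral_translate_diff[symmetric]) simp
  define K where "K = (LINT x|lborel. (laplacian \<psi> x)\<^sup>2) + \<bar>lam\<bar> * (LINT x|lborel. norm x powr (- 2) * gradsq \<psi> x)
      + \<bar>mu\<bar> * (LINT x|lborel. norm x powr (- 4) * (\<psi> x)\<^sup>2)"
  have "K \<le> ?K T"
  proof -
    have 1: "(LINT x|lborel. (laplacian \<psi> x)\<^sup>2) = L"
      unfolding L_def \<psi>_def laplacian_translate[OF test_functions_smooth[OF \<phi>]]
      by (rule lborel_integral_translate_diff) (use test_laplacian[OF \<phi>] in simp)
    have 2: "(LINT x|lborel. norm x powr (- 2) * gradsq \<psi> x) \<le> T powr (- 2) * G"
      unfolding G_def \<psi>_def gradsq_translate[OF test_functions_smooth[OF \<phi>]]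
      by (rule translated_weight_integral_le[OF test_gradsq[OF \<phi>] _ Rg])
        (use y T in \<open>simp_all add: gradsq_def sum_nonneg\<close>)
    have 3: "(LINT x|lborel. norm x powr (- 4) * (\<psi> x)\<^sup>2) \<le> T powr (- 4) * Z"
      unfolding Z_def \<psi>_def
      by (rule translated_weight_integral_le[OF test_sq[OF \<phi>] _ R(2)]) (use y T in simp_all)
    show ?thesis unfolding K_def 1 by (intro add_mono mult_left_mono 2 3 order_refl) simp_all
  qed
  then have "K / N powr (2 / Q) \<le> ?K T / N powr (2 / Q)" by (rule divide_right_mono) simp
  with T(1) have KN: "K / N powr (2 / Q) < \<kappa>" by simp
  let ?\<beta> = "\<lambda>z. snd z * (n - 4 - fst z) / 2 - n"
  let ?U = "\<lambda>z. M powr \<bar>fst z\<bar> * K / (M powr (- \<bar>?\<beta> z\<bar>) * B powr (- (Q - snd z)) * N) powr (2 / snd z)"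
  have id: "((\<lambda>z. z) \<longlongrightarrow> (0, Q)) (nhds (0 :: real, Q))" by (rule filterlim_ident)
  have z: "(fst \<longlongrightarrow> 0) (nhds (0 :: real, Q))" "(snd \<longlongrightarrow> Q) (nhds (0 :: real, Q))"
    using tendsto_fst[OF id] tendsto_snd[OF id] by simp_all
  have "(?U \<longlongrightarrow> M powr \<bar>0\<bar> * K / (M powr (- \<bar>Q * (n - 4 - 0) / 2 - n\<bar>) * B powr (- (Q - Q)) * N) powr (2 / Q)) (nhds (0, Q))"
    by (intro tendsto_intros z) (use M1 B N Q in auto)
  moreover have "M powr \<bar>0\<bar> * K / (M powr (- \<bar>Q * (n - 4 - 0) / 2 - n\<bar>) * B powr (- (Q - Q)) * N) powr (2 / Q) = K / N powr (2 / Q)"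
    using Q(2) M1 B by simp
  ultimately have "(?U \<longlongrightarrow> K / N powr (2 / Q)) (nhds (0, Q))" by simp
  then have ev: "\<forall>\<^sub>F z in nhds (0, Q). ?U z < \<kappa>" by (rule order_tendstoD(2)[OF _ KN])
  show ?thesis
  proof (rule that[OF \<psi>])
    show "\<psi> \<notin> null_functions"
    proof
      assume "\<psi> \<in> null_functions"
      then have "AE x in lborel. \<psi> x = 0" by (simp add: null_functions_def AE_completion_iff)
      then have "AE x in lborel. \<bar>\<psi> x\<bar> powr Q = 0" by eventually_elim simp
      then have "N = 0" unfolding N\<psi> by (rule integral_eq_zero_AE)
      with N show False by simp
    qed
    show "\<forall>\<^sub>F z in nhds (0, critical_exponent n). snd z > 2 \<longrightarrow> snd z \<le> critical_exponent n \<longrightarrow>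
       quotient (fst z) (snd z - 1) lam mu \<psi> < \<kappa>"
      unfolding Q_def[symmetric] using ev
    proof eventually_elim
      case (elim z)
      show ?case
      proof (intro impI)
        assume q: "2 < snd z" "snd z \<le> Q"
        have "quotient (fst z) (snd z - 1) lam mu \<psi> \<le> ?U z"
          by (rule quotient_test_le[OF \<psi> M1 Msupp B _ _ q(2) N\<psi> N K_def]) (use q n(1) in simp_all)
        with elim show "quotient (fst z) (snd z - 1) lam mu \<psi> < \<kappa>" by simp
      qed
    qed
  qed
qed

theorem theorem1p4:
  fixes lam mu n :: real
  assumes n_def: "n = real CARD('n::finite)"
    and "n \<ge> 5"
    and "lam < 0"
  shows "\<exists>\<alpha>\<^sub>0>0. \<exists>p\<^sub>0. 2 < p\<^sub>0 \<and> p\<^sub>0 < critical_exponent n \<and>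
    (\<forall>\<alpha> p. - n < \<alpha> \<and> \<alpha> < n - 4 \<and> \<bar>\<alpha>\<bar> < \<alpha>\<^sub>0 \<and> mu > (n - 4 - \<alpha>)\<^sup>2 / 4 * lam \<and>
           p\<^sub>0 - 1 < p \<and> p < critical_exponent n - 1 \<longrightarrow>
       S_inf TYPE('n) \<alpha> p lam mu < S_rad TYPE('n) \<alpha> p lam mu)"
proof -
  define Q where "Q = critical_exponent n"
  have Q: "Q > 2" using assms(2) by (simp add: Q_def critical_exponent_def field_simps)
  define \<omega> where "\<omega> = sphere_area TYPE('n)"
  have \<omega>: "\<omega> > 0" unfolding \<omega>_def by (rule sphere_area_pos)
  define g where "g \<alpha> = (n - 4 - \<alpha>) * (n + \<alpha>) / 4" for \<alpha>
  define a where "a = 4 + 2 * g 0"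
  define b where "b = (g 0)\<^sup>2"
  \<comment> \<open>Only half of \<open>\<bar>lam\<bar>\<close> is spent on the gain. The other half
    pays for the variation of \<open>(\<alpha> + 2)\<^sup>2 + 2 * g \<alpha>\<close> near
    \<open>\<alpha> = 0\<close>, see \<open>ev2\<close>.\<close>
  define l where "l = - lam / 2"
  have g0: "g 0 > 0" using assms(2) by (simp add: g_def)
  have ab: "a > 0" "b > 0" and l: "l > 0" using g0 assms(3) by (simp_all add: a_def b_def l_def)
  obtain k where k: "k > best_constant a b Q"
    "\<And>w. w \<in> tests1 \<Longrightarrow> k * power_integral Q w powr (2 / Q) \<le> energy (a + l) b w"
    using energy_gain[OF ab Q l] by blast
  define e where "e = \<omega> powr (1 - 2 / Q)"
  have e: "e > 0" using \<omega> by (simp add: e_def)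
  have S: "best_constant a b Q > 0" by (rule best_constant_pos[OF ab Q])
  then have kpos: "k > 0" using k(1) by simp
  have "e * best_constant a b Q < e * k" using k(1) e by simp
  \<comment> \<open>The separating number: the quotient of one test function will stay below it, the
    quotients of all radial functions above it.\<close>
  then obtain \<kappa> where \<kappa>: "e * best_constant a b Q < \<kappa>" "\<kappa> < e * k" using dense by blast
  have \<kappa>pos: "\<kappa> > 0" using \<kappa>(1) mult_pos_pos[OF e S] by simp
  obtain \<psi> :: "real ^ 'n \<Rightarrow> real" where \<psi>: "\<psi> \<in> test_functions" "\<psi> \<notin> null_functions"
    "\<forall>\<^sub>F z in nhds (0, Q). snd z > 2 \<longrightarrow> snd z \<le> Q \<longrightarrow> quotient (fst z) (snd z - 1) lam mu \<psi> < \<kappa>"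
    using ex_test_near_optimal[OF n_def assms(2), of "g 0" \<kappa> lam mu] \<kappa>(1)
    unfolding Q_def[symmetric] \<omega>_def[symmetric] e_def[symmetric] a_def b_def g_def by auto
  \<comment> \<open>The largest factor allowed by \<open>energy_scale_le\<close> for the coefficient
    \<open>(g \<alpha>)\<^sup>2\<close> in place of \<open>b\<close>; it tends to 1 as \<alpha>
    tends to 0.\<close>
  let ?t = "\<lambda>\<alpha>. min 1 ((g \<alpha>)\<^sup>2 / b)"
  let ?I = "\<lambda>q. interpolation_constant b k Q q"
  have id: "((\<lambda>z. z) \<longlongrightarrow> (0, Q)) (nhds (0 :: real, Q))" by (rule filterlim_ident)
  have z: "(fst \<longlongrightarrow> 0) (nhds (0 :: real, Q))" "(snd \<longlongrightarrow> Q) (nhds (0 :: real, Q))"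
    using tendsto_fst[OF id] tendsto_snd[OF id] by simp_all
  have gl: "((\<lambda>z. g (fst z)) \<longlongrightarrow> g 0) (nhds (0, Q))" unfolding g_def by (intro tendsto_intros z) simp
  have ka: "k powr (- (Q / 2)) > 0" using kpos by simp
  have "((\<lambda>z. \<omega> powr (1 - 2 / snd z) * (?t (fst z) * ?I (snd z))) \<longlongrightarrow>
      \<omega> powr (1 - 2 / Q) * (min 1 ((g 0)\<^sup>2 / b) *
        (1 / ((Q - Q) / (Q - 2) * (1 / b) + (1 - (Q - Q) / (Q - 2)) * k powr (- (Q / 2))) powr (2 / Q)))) (nhds (0, Q))"
    unfolding interpolation_constant_def
    by (intro tendsto_intros tendsto_min z gl) (use \<omega> Q ab ka in auto)
  \<comment> \<open>At the endpoint the interpolation weight is 0, so the whole gain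
    \<open>k\<close> is recovered in the limit.\<close>
  moreover have "1 / (k powr (- (Q / 2))) powr (2 / Q) = k"
  proof -
    have "- (Q / 2) * (2 / Q) = - 1" using Q by simp
    then show ?thesis unfolding powr_powr using kpos by (simp add: powr_minus_divide)
  qed
  ultimately have "((\<lambda>z. \<omega> powr (1 - 2 / snd z) * (?t (fst z) * ?I (snd z))) \<longlongrightarrow> e * k) (nhds (0, Q))"
    using g0 by (simp add: b_def e_def)
  then have ev1: "\<forall>\<^sub>F z in nhds (0, Q). \<kappa> < \<omega> powr (1 - 2 / snd z) * (?t (fst z) * ?I (snd z))"
    by (rule order_tendstoD(1)[OF _ \<kappa>(2)])
  have "((\<lambda>z. (fst z + 2)\<^sup>2 + 2 * g (fst z) - lam) \<longlongrightarrow> (0 + 2)\<^sup>2 + 2 * g 0 - lam) (nhds (0, Q))"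
    by (intro tendsto_intros z gl)
  then have ev2: "\<forall>\<^sub>F z in nhds (0, Q). a + l < (fst z + 2)\<^sup>2 + 2 * g (fst z) - lam"
    by (rule order_tendstoD(1)) (use assms(3) in \<open>simp add: a_def l_def\<close>)
  \<comment> \<open>The range in which the constant of \<open>hardy_rellich\<close> is positive, as
    required for the limits in \<open>D22\<close>.\<close>
  have ev3: "\<forall>\<^sub>F z in nhds (0 :: real, Q). - 2 < fst z"
    by (rule order_tendstoD(1)[OF z(1)]) simp
  from eventually_conj[OF \<psi>(3) eventually_conj[OF ev1 eventually_conj[OF ev2 ev3]]]
  obtain d where d: "d > 0" and P: "\<And>z. dist z (0, Q) < d \<Longrightarrow>
      (snd z > 2 \<longrightarrow> snd z \<le> Q \<longrightarrow> quotient (fst z) (snd z - 1) lam mu \<psi> < \<kappa>) \<and>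
      \<kappa> < \<omega> powr (1 - 2 / snd z) * (?t (fst z) * ?I (snd z)) \<and>
      a + l < (fst z + 2)\<^sup>2 + 2 * g (fst z) - lam \<and> - 2 < fst z"
    unfolding eventually_nhds_metric by blast
  \<comment> \<open>This bounds the exponent \<open>p + 1\<close>, not \<open>p\<close>. The first
    entry keeps it within \<open>d / 2\<close> of \<open>Q\<close>, which together with
    \<open>\<bar>\<alpha>\<bar> < d / 2\<close> puts the pair in the ball of radius
    \<open>d\<close>; the second keeps it strictly between 2 and \<open>Q\<close>.\<close>
  define p\<^sub>0 where "p\<^sub>0 = max (Q - d / 2) ((2 + Q) / 2)"
  have p0: "2 < p\<^sub>0" "p\<^sub>0 < Q" using Q d by (auto simp: p\<^sub>0_def less_max_iff_disj)
  have main: "S_inf TYPE('n) \<alpha> p lam mu < S_rad TYPE('n) \<alpha> p lam mu"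
    if \<alpha>: "\<alpha> < n - 4" "\<bar>\<alpha>\<bar> < d / 2" and mu: "mu > (n - 4 - \<alpha>)\<^sup>2 / 4 * lam" and p: "p\<^sub>0 - 1 < p" "p < Q - 1" for \<alpha> p
  proof -
    have q: "p + 1 > 2" "p + 1 < Q" "\<bar>p + 1 - Q\<bar> < d / 2" using p p0 by (auto simp: p\<^sub>0_def)
    have "dist (\<alpha>, p + 1) (0, Q) \<le> \<bar>\<alpha>\<bar> + \<bar>p + 1 - Q\<bar>"
      unfolding dist_Pair_Pair dist_real_def using sqrt_sum_squares_le_sum_abs[of "\<alpha> - 0" "p + 1 - Q"] by simp
    then have "dist (\<alpha>, p + 1) (0, Q) < d" using \<alpha> q by simp
    from P[OF this] q have f: "quotient \<alpha> p lam mu \<psi> < \<kappa>"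
      "\<kappa> < \<omega> powr (1 - 2 / (p + 1)) * (?t \<alpha> * ?I (p + 1))"
      "a + l < (\<alpha> + 2)\<^sup>2 + 2 * g \<alpha> - lam" "- 2 < \<alpha>" by simp_all
    have k': "?t \<alpha> * ?I (p + 1) > 0"
      using less_trans[OF \<kappa>pos f(2)] \<omega> by (simp only: zero_less_mult_iff) auto
    have le: "?t \<alpha> * ?I (p + 1) * power_integral (p + 1) w powr (2 / (p + 1))
        \<le> energy ((\<alpha> + 2)\<^sup>2 + 2 * g \<alpha> - lam) ((g \<alpha>)\<^sup>2) w" if w: "w \<in> tests1" for w
    proof -
      have t: "0 \<le> ?t \<alpha>" "?t \<alpha> \<le> 1" using ab by auto
      have "?I (p + 1) * power_integral (p + 1) w powr (2 / (p + 1)) \<le> energy (a + l) b w"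
        by (rule energy_interpolation[OF _ ab(2) q(1,2) kpos k(2) w]) (use ab l in simp)
      then have "?t \<alpha> * (?I (p + 1) * power_integral (p + 1) w powr (2 / (p + 1))) \<le> ?t \<alpha> * energy (a + l) b w"
        by (rule mult_left_mono[OF _ t(1)])
      also have "\<dots> \<le> energy ((\<alpha> + 2)\<^sup>2 + 2 * g \<alpha> - lam) ((g \<alpha>)\<^sup>2) w"
      proof (rule energy_scale_le[OF t])
        have "?t \<alpha> * b \<le> (g \<alpha>)\<^sup>2 / b * b" by (rule mult_right_mono) (use ab in auto)
        then show "?t \<alpha> * b \<le> (g \<alpha>)\<^sup>2" using ab by simp
      qed (use ab l f(3) in auto)
      finally show ?thesis by (simp only: mult.assoc)
    qed
    have "S_inf TYPE('n) \<alpha> p lam mu \<le> ereal (quotient \<alpha> p lam mu \<psi>)"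
      unfolding S_inf_def by (rule INF_lower) (use test_in_D22[OF \<psi>(1)] \<psi>(2) in blast)
    also have "\<dots> < ereal \<kappa>" using f(1) by simp
    also have "ereal \<kappa> \<le> S_rad TYPE('n) \<alpha> p lam mu"
      unfolding S_rad_def
    proof (rule INF_greatest)
      fix u :: "real ^ 'n \<Rightarrow> real" assume u: "u \<in> D22_rad \<alpha> - null_functions"
      have "\<omega> powr (1 - 2 / (p + 1)) * (?t \<alpha> * ?I (p + 1)) \<le> quotient \<alpha> p lam mu u"
        unfolding \<omega>_def
        by (rule quotient_radial_ge[OF u f(4) _ _ _ _ _ k' le])
          (use \<alpha>(1) q(1) assms(3) mu in \<open>simp_all add: n_def g_def\<close>)
      with f(2) show "ereal \<kappa> \<le> ereal (quotient \<alpha> p lam mu u)" by simp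
    qed
    finally show ?thesis .
  qed
  show ?thesis
    unfolding Q_def[symmetric]
  proof (rule exI[of _ "d / 2"], rule conjI)
    show "d / 2 > 0" using d by simp
    show "\<exists>p\<^sub>0>2. p\<^sub>0 < Q \<and> (\<forall>\<alpha> p. - n < \<alpha> \<and> \<alpha> < n - 4 \<and> \<bar>\<alpha>\<bar> < d / 2 \<and>
        (n - 4 - \<alpha>)\<^sup>2 / 4 * lam < mu \<and> p\<^sub>0 - 1 < p \<and> p < Q - 1 \<longrightarrow>
        S_inf TYPE('n) \<alpha> p lam mu < S_rad TYPE('n) \<alpha> p lam mu)"
      by (intro exI[of _ p\<^sub>0] conjI allI impI p0; elim conjE) (rule main)
  qed
qed

end
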